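(* Let $\Omega=(-1,1)^2$, $a>0$, $0<\epsilon\le 1$, $Lu=-\epsilon^2\Delta u+au$, and consider decompositions $\Omega_1,\dots,\Omega_N$ of $\Omega$ with maps $M_l:S\to\Omega_l$ as in the context. The quadratic form $\mathcal U^{N,W}$ is spectrally equivalent to the quadratic form $\mathcal V^{N,W}$: there exist positive constants $c_\epsilon$ and $C_\epsilon$ (depending on $\epsilon$, but independent of $N$ and $W$) such that $$c_\epsilon\,\mathcal V^{N,W}(\{\mathcal F_u\})\le\mathcal U^{N,W}(\{\mathcal F_u\})\le C_\epsilon(\log W)^2\,\mathcal V^{N,W}(\{\mathcal F_u\})\qquad\text{for all }\{\mathcal F_u\}\in\mathcal S^{N,W},$$ provided $W=O(1/\epsilon)$, i.e. for all integers $W\ge 2$ with $W\le K/\epsilon$, where $K>0$ is any fixed constant (on which the constants may depend).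
   Context: The underlying boundary value problem is $-\epsilon^2\Delta w+aw=f$ in $\Omega=(-1,1)^2$, $w=g$ on $\Gamma=\partial\Omega$, with $a>0$ a real constant and $0<\epsilon\le1$. Decomposition: $\Omega$ is divided into rectangles (or squares) $\Omega_1,\dots,\Omega_N$ by a uniform or non-uniform refinement in each coordinate direction. $S=(-1,1)^2$ is the reference square with coordinates $(\xi,\eta)$, $I=(-1,1)$, and $M_l:S\to\Omega_l$ is an analytic map with analytic inverse, mapping sides of $S$ to sides of $\Omega_l$, with Jacobian determinant $J_l>0$; the parametrizations of a common edge induced by the two adjacent maps coincide. Spectral element functions: $\mathcal S^{N,W}$ is the set of families $\{\mathcal F_u\}=\{\hat u_l(\xi,\eta)\}_{l=1}^N$, where each $\hat u_l$ is a polynomial of degree at most $W$ in each of $\xi,\eta$ separately. Put $u_l=\hat u_l\circ M_l^{-1}$ on $\Omega_l$. No continuity across elements is imposed. $L_l$ is defined by $L_l\hat u_l=\sqrt{J_l}\,\big((Lu_l)\circ M_l\big)$, so that $\int_{\Omega_l}|Lu_l|^2\,d\mathbf x=\int_S|L_l\hat u_l|^2\,d\xi d\eta$. Norms on $I$: for $0<\sigma<1$, $\|v\|_{\sigma,I}^2=\|v\|_{0,I}^2+\int_I\int_I\frac{(v(t)-v(t'))^2}{|t-t'|^{1+2\sigma}}\,dt\,dt'$, and $\|v\|_{1+\sigma,I}^2=\|v\|_{0,I}^2+\|v'\|_{\sigma,I}^2$, where $\|\cdot\|_{0,I}$ is the $L^2$ norm. Norms on an edge are the norms over $I$ of the function pulled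 back by the parametrization of the edge by $I$ induced by the element maps. For an edge $\gamma$ shared by $\Omega_m$ and $\Omega_n$, $[u]=u_m-u_n$ and $[u_{x_k}]=(u_m)_{x_k}-(u_n)_{x_k}$ on $\gamma$, $k=1,2$ (physical-coordinate derivatives), regarded as functions on $I$. Quadratic forms: $$\mathcal V^{N,W}(\{\mathcal F_u\})=\sum_{l=1}^N\|L_l\hat u_l\|_{0,S}^2+\sum_{\gamma}\Big(\|[u]\|_{0,\gamma}^2+\sum_{k=1}^2\|[u_{x_k}]\|_{1/2,\gamma}^2\Big)+\sum_{\Gamma^s\subseteq\partial\Omega}\|u\|_{3/2,\Gamma^s}^2,$$ where $\gamma$ runs over all inter-element edges (those not on $\partial\Omega$) and $\Gamma^s$ over all element edges on $\partial\Omega$; $$\mathcal U^{N,W}(\{\mathcal F_u\})=\sum_{l=1}^N\int_S\Big(\epsilon^4\big((\hat u_l)_{\xi\xi}^2+2(\hat u_l)_{\xi\eta}^2+(\hat u_l)_{\eta\eta}^2\big)+\epsilon^2\big((\hat u_l)_\xi^2+(\hat u_l)_\eta^2\big)+\hat u_l^2\Big)\,d\xi d\eta.$$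
   Formalization: The constants also depend on a bound B for the first and second derivatives of the maps M_l, with J_l ≥ 1/B (which forces N ≤ B); without it the claim is false: on uniform n×n grids u=(1-x²)(1-y²) has V fixed but U growing like N. *)

theory Defs
  imports "HOL-Analysis.Analysis"
begin

definition refI :: "real set" where
  "refI = {-1<..<1}"

definition refS :: "(real \<times> real) set" where
  "refS = {-1<..<1} \<times> {-1<..<1}"

definition refSc :: "(real \<times> real) set" where
  "refSc = {-1..1} \<times> {-1..1}"

datatype side = West | East | South | North

text \<open>Every side of the reference square is parametrized by the coordinate that varies along it.\<close>

fun ref_side :: "side \<Rightarrow> real \<Rightarrow> real \<times> real" where
  "ref_side West t = (-1, t)"
| "ref_side East t = (1, t)"
| "ref_side South t = (t, -1)"
| "ref_side North t = (t, 1)"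

text \<open>
  Partial derivatives are taken within a closed rectangle \<open>R\<close>. At interior points this is the usual
  partial derivative; on an edge it is the one-sided trace from \<open>R\<close>. The derivative within a
  nondegenerate closed rectangle is unique. The direction \<open>b\<close> is one of the two elements
  \<open>ex\<close>, \<open>ey\<close> of \<open>Basis\<close>.
\<close>

definition pdiff :: "(real \<times> real) set \<Rightarrow> real \<times> real \<Rightarrow> (real \<times> real \<Rightarrow> real) \<Rightarrow> real \<times> real \<Rightarrow> real" where
  "pdiff R b f p = frechet_derivative f (at p within R) b"

abbreviation ex :: "real \<times> real" where "ex \<equiv> (1, 0)"
abbreviation ey :: "real \<times> real" where "ey \<equiv> (0, 1)"

text \<open>
  Real analyticity up to the boundary of a closed rectangle \<open>T\<close>: around each point of \<open>T\<close>, corners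
  and edges included, the function is given on \<open>T\<close> by a convergent double power series. Values
  outside \<open>T\<close> play no role.
\<close>

definition analytic2_on :: "(real \<times> real \<Rightarrow> real) \<Rightarrow> (real \<times> real) set \<Rightarrow> bool" where
  "analytic2_on f T \<longleftrightarrow>
     (\<forall>p\<in>T. \<exists>r>0. \<exists>c :: nat \<Rightarrow> nat \<Rightarrow> real. \<forall>q\<in>T \<inter> ball p r.
        ((\<lambda>(i, j). c i j * (fst q - fst p) ^ i * (snd q - snd p) ^ j) has_sum f q) UNIV)"

text \<open>
  A decomposition is given by grid points \<open>-1 = xs 0 < \<dots> < xs nx = 1\<close> and
  \<open>-1 = ys 0 < \<dots> < ys ny = 1\<close> and the element maps. The \<open>N = nx * ny\<close> elements are indexed by
  pairs \<open>(i, j)\<close>.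
\<close>

record decomp =
  nx :: nat
  ny :: nat
  xs :: "nat \<Rightarrow> real"
  ys :: "nat \<Rightarrow> real"
  emap :: "nat \<times> nat \<Rightarrow> real \<times> real \<Rightarrow> real \<times> real"

definition elements :: "decomp \<Rightarrow> (nat \<times> nat) set" where
  "elements D = {..<nx D} \<times> {..<ny D}"

definition elem :: "decomp \<Rightarrow> nat \<times> nat \<Rightarrow> (real \<times> real) set" where
  "elem D = (\<lambda>(i, j). {xs D i..xs D (Suc i)} \<times> {ys D j..ys D (Suc j)})"

fun elem_side :: "decomp \<Rightarrow> nat \<times> nat \<Rightarrow> side \<Rightarrow> (real \<times> real) set" where
  "elem_side D (i, j) West = {xs D i} \<times> {ys D j..ys D (Suc j)}"
| "elem_side D (i, j) East = {xs D (Suc i)} \<times> {ys D j..ys D (Suc j)}"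
| "elem_side D (i, j) South = {xs D i..xs D (Suc i)} \<times> {ys D j}"
| "elem_side D (i, j) North = {xs D i..xs D (Suc i)} \<times> {ys D (Suc j)}"

definition einv :: "decomp \<Rightarrow> nat \<times> nat \<Rightarrow> real \<times> real \<Rightarrow> real \<times> real" where
  "einv D l = inv_into refSc (emap D l)"

definition jac :: "decomp \<Rightarrow> nat \<times> nat \<Rightarrow> real \<times> real \<Rightarrow> real" where
  "jac D l p =
     pdiff refSc ex (fst \<circ> emap D l) p * pdiff refSc ey (snd \<circ> emap D l) p
   - pdiff refSc ey (fst \<circ> emap D l) p * pdiff refSc ex (snd \<circ> emap D l) p"

text \<open>
  Parametrization of the geometric side \<open>g\<close> of an element induced by its element map. The map may
  carry any side of the reference square to \<open>g\<close> (rotated element maps are admitted).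
\<close>

definition edge_par :: "decomp \<Rightarrow> nat \<times> nat \<Rightarrow> side \<Rightarrow> real \<Rightarrow> real \<times> real" where
  "edge_par D l g t =
     emap D l (ref_side (THE s. emap D l ` ref_side s ` {-1..1} = elem_side D l g) t)"

definition is_decomp :: "nat \<Rightarrow> decomp \<Rightarrow> bool" where
  "is_decomp N D \<longleftrightarrow>
     N = nx D * ny D \<and> 0 < nx D \<and> 0 < ny D
   \<and> xs D 0 = -1 \<and> xs D (nx D) = 1 \<and> (\<forall>i<nx D. xs D i < xs D (Suc i))
   \<and> ys D 0 = -1 \<and> ys D (ny D) = 1 \<and> (\<forall>j<ny D. ys D j < ys D (Suc j))
   \<and> (\<forall>l\<in>elements D.
        bij_betw (emap D l) refSc (elem D l)
      \<and> analytic2_on (fst \<circ> emap D l) refSc \<and> analytic2_on (snd \<circ> emap D l) refSc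
      \<and> analytic2_on (fst \<circ> einv D l) (elem D l) \<and> analytic2_on (snd \<circ> einv D l) (elem D l)
      \<and> (\<forall>s. \<exists>g. emap D l ` ref_side s ` {-1..1} = elem_side D l g)
      \<and> (\<forall>p\<in>refSc. jac D l p > 0))
   \<and> (\<forall>i j. Suc i < nx D \<and> j < ny D \<longrightarrow>
        (\<forall>t\<in>{-1..1}. edge_par D (i, j) East t = edge_par D (Suc i, j) West t))
   \<and> (\<forall>i j. i < nx D \<and> Suc j < ny D \<longrightarrow>
        (\<forall>t\<in>{-1..1}. edge_par D (i, j) North t = edge_par D (i, Suc j) South t))"

text \<open>
  Quantitative regularity of the element maps. The maps of a decomposition are analytic with positive
  Jacobian on the compact closed square, so every decomposition satisfies this for some \<open>B\<close>.
  Estimates that are uniform over decompositions depend on the maps through \<open>B\<close>.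
\<close>

definition maps_bounded_by :: "real \<Rightarrow> decomp \<Rightarrow> bool" where
  "maps_bounded_by B D \<longleftrightarrow>
     (\<forall>l\<in>elements D. \<forall>p\<in>refSc.
        (\<forall>f\<in>{fst \<circ> emap D l, snd \<circ> emap D l}. \<forall>b\<in>Basis.
            \<bar>pdiff refSc b f p\<bar> \<le> B \<and> (\<forall>b'\<in>Basis. \<bar>pdiff refSc b (pdiff refSc b' f) p\<bar> \<le> B))
      \<and> jac D l p \<ge> 1 / B)"

definition poly_sep :: "nat \<Rightarrow> (real \<times> real \<Rightarrow> real) set" where
  "poly_sep W =
     {f. \<exists>c :: nat \<Rightarrow> nat \<Rightarrow> real. \<forall>\<xi> \<eta>. f (\<xi>, \<eta>) = (\<Sum>i\<le>W. \<Sum>j\<le>W. c i j * \<xi> ^ i * \<eta> ^ j)}"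

definition spectral_functions :: "decomp \<Rightarrow> nat \<Rightarrow> (nat \<times> nat \<Rightarrow> real \<times> real \<Rightarrow> real) set" where
  "spectral_functions D W = {F. \<forall>l\<in>elements D. F l \<in> poly_sep W}"

definition phys :: "decomp \<Rightarrow> (nat \<times> nat \<Rightarrow> real \<times> real \<Rightarrow> real) \<Rightarrow> nat \<times> nat \<Rightarrow> real \<times> real \<Rightarrow> real" where
  "phys D F l = F l \<circ> einv D l"

definition phys_diff ::
  "decomp \<Rightarrow> (nat \<times> nat \<Rightarrow> real \<times> real \<Rightarrow> real) \<Rightarrow> nat \<times> nat \<Rightarrow> real \<times> real \<Rightarrow> real \<times> real \<Rightarrow> real" where
  "phys_diff D F l b = pdiff (elem D l) b (phys D F l)"

definition opL :: "real \<Rightarrow> real \<Rightarrow> (real \<times> real) set \<Rightarrow> (real \<times> real \<Rightarrow> real) \<Rightarrow> real \<times> real \<Rightarrow> real" where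
  "opL eps a R u p = - eps\<^sup>2 * (\<Sum>b\<in>Basis. pdiff R b (pdiff R b u) p) + a * u p"

definition opL_ref ::
  "real \<Rightarrow> real \<Rightarrow> decomp \<Rightarrow> (nat \<times> nat \<Rightarrow> real \<times> real \<Rightarrow> real) \<Rightarrow> nat \<times> nat \<Rightarrow> real \<times> real \<Rightarrow> real" where
  "opL_ref eps a D F l p = sqrt (jac D l p) * opL eps a (elem D l) (phys D F l) (emap D l p)"

definition norm0_sq :: "(real \<Rightarrow> real) \<Rightarrow> real" where
  "norm0_sq v = (LINT t:refI|lborel. (v t)\<^sup>2)"

text \<open>
  These norms are applied only to functions that are analytic up to the end points of \<open>refI\<close>, and
  only for \<open>s = 1/2\<close>; the integrand is then bounded, so the integral is never infinite (the Bochner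
  integral of a non-integrable function would be 0).
\<close>

definition norm_frac_sq :: "real \<Rightarrow> (real \<Rightarrow> real) \<Rightarrow> real" where
  "norm_frac_sq s v = norm0_sq v
     + (LINT p:refI \<times> refI|lborel. (v (fst p) - v (snd p))\<^sup>2 / \<bar>fst p - snd p\<bar> powr (1 + 2 * s))"

definition norm_1frac_sq :: "real \<Rightarrow> (real \<Rightarrow> real) \<Rightarrow> real" where
  "norm_1frac_sq s v = norm0_sq v + norm_frac_sq s (deriv v)"

text \<open>
  Contribution of the edge that is the side \<open>g\<close> of element \<open>l\<close> and is shared with element \<open>l'\<close>.
  By \<open>is_decomp\<close> the parametrization induced by \<open>l'\<close> is the same.
\<close>

definition jump_sq ::
  "decomp \<Rightarrow> (nat \<times> nat \<Rightarrow> real \<times> real \<Rightarrow> real) \<Rightarrow> nat \<times> nat \<Rightarrow> side \<Rightarrow> nat \<times> nat \<Rightarrow> real" where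
  "jump_sq D F l g l' =
     norm0_sq (\<lambda>t. phys D F l (edge_par D l g t) - phys D F l' (edge_par D l g t))
   + (\<Sum>b\<in>Basis. norm_frac_sq (1/2)
        (\<lambda>t. phys_diff D F l b (edge_par D l g t) - phys_diff D F l' b (edge_par D l g t)))"

definition bdry_sq :: "decomp \<Rightarrow> (nat \<times> nat \<Rightarrow> real \<times> real \<Rightarrow> real) \<Rightarrow> nat \<times> nat \<Rightarrow> side \<Rightarrow> real" where
  "bdry_sq D F l g = norm_1frac_sq (1/2) (\<lambda>t. phys D F l (edge_par D l g t))"

definition formV :: "real \<Rightarrow> real \<Rightarrow> decomp \<Rightarrow> (nat \<times> nat \<Rightarrow> real \<times> real \<Rightarrow> real) \<Rightarrow> real" where
  "formV eps a D F =
     (\<Sum>l\<in>elements D. LINT p:refS|lborel. (opL_ref eps a D F l p)\<^sup>2)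
   + (\<Sum>i<nx D - 1. \<Sum>j<ny D. jump_sq D F (i, j) East (Suc i, j))
   + (\<Sum>i<nx D. \<Sum>j<ny D - 1. jump_sq D F (i, j) North (i, Suc j))
   + (\<Sum>j<ny D. bdry_sq D F (0, j) West + bdry_sq D F (nx D - 1, j) East)
   + (\<Sum>i<nx D. bdry_sq D F (i, 0) South + bdry_sq D F (i, ny D - 1) North)"

definition formU :: "real \<Rightarrow> decomp \<Rightarrow> (nat \<times> nat \<Rightarrow> real \<times> real \<Rightarrow> real) \<Rightarrow> real" where
  "formU eps D F =
     (\<Sum>l\<in>elements D. LINT p:refS|lborel.
        eps ^ 4 * ((pdiff refSc ex (pdiff refSc ex (F l)) p)\<^sup>2
                 + 2 * (pdiff refSc ex (pdiff refSc ey (F l)) p)\<^sup>2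
                 + (pdiff refSc ey (pdiff refSc ey (F l)) p)\<^sup>2)
      + eps\<^sup>2 * ((pdiff refSc ex (F l) p)\<^sup>2 + (pdiff refSc ey (F l) p)\<^sup>2)
      + (F l p)\<^sup>2)"

end

(* Since eps is fixed before the constants, the degree W is bounded by K / eps: all norms of a polynomial on the
   reference square are equivalent with constants depending only on K / eps, and ln W is bounded below by ln 2.
   The easy estimate then bounds every term of formV by the L2 norms of the element functions. For the
   converse, Green's identity on each element (pulled back to the reference square by the Piola transform)
   bounds eps^2 |grad u|^2 + a u^2 by L u and the boundary fluxes. On a shared edge the two fluxes combine to
   u w - u' w' = [u] w + u' [w], and on the boundary u itself occurs, so Young's inequality bounds the fluxes
   by the jump terms of formV plus a small multiple of the traces, which the L2 norms absorb. *)

theory Submission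
  imports Defs
begin

section \<open>Calculus on a closed rectangle\<close>

text \<open>What makes the constants independent of \<open>N\<close> is the zeroth-order term:
  \<open>a > 0\<close> controls the L2 norm element by element, so no Poincare inequality across a
  discontinuous family enters, and the gradient energy in Green's identity is discarded for its
  sign. Passing from elements to edges costs a factor 4, the number of sides. The maps enter
  quantitatively through \<open>B\<close> alone. Two obstacles shape the development. Derivatives
  are taken within closed rectangles, so Green's identity needs regularity up to edges and corners;
  it is extracted from the local double power series, which also give the symmetry of second
  derivatives on which the Piola identity rests. Secondly, an element map may carry any side of the
  reference square to a given physical side, so direction and sign of a flux cannot be read off the
  reference square. They are recovered from the positivity of the Jacobian and from the fact that
  one coordinate of the map attains an extreme value on each side.\<close>

definition rect :: "(real \<times> real) set \<Rightarrow> bool" where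
  "rect T \<longleftrightarrow> (\<exists>a b c d. a < b \<and> c < d \<and> T = {a..b} \<times> {c..d})"

lemma rect_refSc: "rect refSc"
  unfolding rect_def refSc_def by (rule exI[of _ "-1"], rule exI[of _ 1]) (rule exI[of _ "-1"], rule exI[of _ 1], simp)

text \<open>\<open>frechet_derivative\<close> is a choice. On a nondegenerate closed rectangle the
  derivative within the set is unique, at corners too, so any derivative found by other means
  computes \<open>pdiff\<close>.\<close>

lemma pdiff_eqI:
  assumes "rect T" "p \<in> T" "(f has_derivative f') (at p within T)"
  shows "pdiff T b f p = f' b"
proof -
  obtain x0 x1 y0 y1 where *: "x0 < x1" "y0 < y1" "T = {x0..x1} \<times> {y0..y1}"
    using assms(1) unfolding rect_def by blast
  have T: "T = cbox (x0, y0) (x1, y1)"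
    using * by (simp add: cbox_Pair_eq)
  have "frechet_derivative f (at p within T) = f'"
    unfolding T
    by (rule frechet_derivative_unique_within_closed_interval[of "(x0,y0)" "(x1,y1)" p f, symmetric])
      (use assms * T in \<open>auto simp: Basis_prod_def frechet_derivative_works[symmetric] intro!: differentiableI\<close>)
  then show ?thesis by (simp add: pdiff_def)
qed

lemma has_derivative_pdiff:
  fixes f :: "real \<times> real \<Rightarrow> real"
  assumes "f differentiable (at p within T)"
  shows "(f has_derivative (\<lambda>h. fst h * pdiff T ex f p + snd h * pdiff T ey f p)) (at p within T)"
proof -
  let ?D = "frechet_derivative f (at p within T)"
  have 1: "(f has_derivative ?D) (at p within T)"
    using assms frechet_derivative_works by blast
  then have "linear ?D"
    by (meson has_derivative_bounded_linear bounded_linear.linear)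
  then have "?D h = fst h * pdiff T ex f p + snd h * pdiff T ey f p" for h
    using linear_add[of ?D "fst h *\<^sub>R ex" "snd h *\<^sub>R ey"] linear_scale[of ?D "fst h" ex]
      linear_scale[of ?D "snd h" ey]
    by (cases h) (simp add: pdiff_def)
  with 1 show ?thesis by (metis (no_types, lifting) has_derivative_eq_rhs ext)
qed

text \<open>Since only values on \<open>T\<close> matter, a second \<open>pdiff\<close> can be
  computed from a formula for the first one that is valid on \<open>T\<close>.\<close>

lemma pdiff_cong:
  assumes "\<And>q. q \<in> T \<Longrightarrow> f q = g q" "p \<in> T"
  shows "pdiff T b f p = pdiff T b g p"
proof -
  have "(f has_derivative D) (at p within T) \<longleftrightarrow> (g has_derivative D) (at p within T)" for D
    using has_derivative_transform[OF assms(2), of f g D] has_derivative_transform[OF assms(2), of g f D] assms(1)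
    by metis
  then show ?thesis by (simp add: pdiff_def frechet_derivative_def)
qed

section \<open>Calculus rules and continuous differentiability up to the boundary\<close>

lemma pdiff_mult:
  assumes "rect T" "p \<in> T" "f differentiable (at p within T)" "g differentiable (at p within T)"
  shows "pdiff T b (\<lambda>q. f q * g q :: real) p = f p * pdiff T b g p + pdiff T b f p * g p"
  using pdiff_eqI[OF assms(1,2) has_derivative_mult[OF assms(3,4)[unfolded frechet_derivative_works]], of b]
  by (simp add: pdiff_def)

lemma pdiff_diff:
  assumes "rect T" "p \<in> T" "f differentiable (at p within T)" "g differentiable (at p within T)"
  shows "pdiff T b (\<lambda>q. f q - g q :: real) p = pdiff T b f p - pdiff T b g p"
  using pdiff_eqI[OF assms(1,2) has_derivative_diff[OF assms(3,4)[unfolded frechet_derivative_works]], of b]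
  by (simp add: pdiff_def)

lemma pdiff_divide:
  assumes "rect T" "p \<in> T" "f differentiable (at p within T)" "g differentiable (at p within T)" "g p \<noteq> 0"
  shows "pdiff T b (\<lambda>q. f q / g q :: real) p = (pdiff T b f p * g p - f p * pdiff T b g p) / (g p)\<^sup>2"
proof -
  note has_derivative_divide'[OF assms(3)[unfolded frechet_derivative_works] assms(4)[unfolded frechet_derivative_works] assms(5)]
  from pdiff_eqI[OF assms(1,2) this, of b] show ?thesis
    by (simp add: pdiff_def power2_eq_square)
qed

definition C1 :: "(real \<times> real) set \<Rightarrow> (real \<times> real \<Rightarrow> real) \<Rightarrow> bool" where
  "C1 T f \<longleftrightarrow> f differentiable_on T \<and> continuous_on T (pdiff T ex f) \<and> continuous_on T (pdiff T ey f)"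

lemma C1_differentiable: "C1 T f \<Longrightarrow> p \<in> T \<Longrightarrow> f differentiable (at p within T)"
  by (auto simp: C1_def differentiable_on_def)

lemma C1_continuous: "C1 T f \<Longrightarrow> continuous_on T f"
  by (auto simp: C1_def differentiable_imp_continuous_on)

lemma C1_continuous_pdiff: "C1 T f \<Longrightarrow> b \<in> Basis \<Longrightarrow> continuous_on T (pdiff T b f)"
  by (auto simp: C1_def Basis_prod_def)

lemma C1_mult:
  assumes "rect T" "C1 T f" "C1 T g"
  shows "C1 T (\<lambda>q. f q * g q)"
proof -
  have "continuous_on T (pdiff T b (\<lambda>q. f q * g q))" if "b \<in> Basis" for b
  proof (rule continuous_on_eq)
    show "continuous_on T (\<lambda>p. f p * pdiff T b g p + pdiff T b f p * g p)"
      using C1_continuous_pdiff[OF assms(2) that] C1_continuous_pdiff[OF assms(3) that]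
        C1_continuous[OF assms(2)] C1_continuous[OF assms(3)]
      by (intro continuous_intros) auto
  qed (use assms in \<open>auto intro!: pdiff_mult[symmetric] intro: C1_differentiable\<close>)
  then show ?thesis
    using assms by (auto simp: C1_def Basis_prod_def differentiable_on_def)
qed

lemma C1_diff:
  assumes "rect T" "C1 T f" "C1 T g"
  shows "C1 T (\<lambda>q. f q - g q)"
proof -
  have "continuous_on T (pdiff T b (\<lambda>q. f q - g q))" if "b \<in> Basis" for b
  proof (rule continuous_on_eq)
    show "continuous_on T (\<lambda>p. pdiff T b f p - pdiff T b g p)"
      using C1_continuous_pdiff[OF assms(2) that] C1_continuous_pdiff[OF assms(3) that]
        C1_continuous[OF assms(2)] C1_continuous[OF assms(3)]
      by (intro continuous_intros) auto
  qed (use assms in \<open>auto intro!: pdiff_diff[symmetric] intro: C1_differentiable\<close>)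
  then show ?thesis
    using assms by (auto simp: C1_def Basis_prod_def differentiable_on_def)
qed

lemma C1_divide:
  assumes "rect T" "C1 T f" "C1 T g" "\<And>p. p \<in> T \<Longrightarrow> g p \<noteq> 0"
  shows "C1 T (\<lambda>q. f q / g q)"
proof -
  have "continuous_on T (pdiff T b (\<lambda>q. f q / g q))" if "b \<in> Basis" for b
  proof (rule continuous_on_eq)
    show "continuous_on T (\<lambda>p. (pdiff T b f p * g p - f p * pdiff T b g p) / (g p)\<^sup>2)"
      using C1_continuous_pdiff[OF assms(2) that] C1_continuous_pdiff[OF assms(3) that]
        C1_continuous[OF assms(2)] C1_continuous[OF assms(3)] assms(4)
      by (intro continuous_intros) auto
  qed (use assms in \<open>auto intro!: pdiff_divide[symmetric] intro: C1_differentiable\<close>)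
  then show ?thesis
    using assms by (auto simp: C1_def Basis_prod_def differentiable_on_def intro!: differentiable_divide)
qed

lemma C1_cong:
  assumes "\<And>q. q \<in> T \<Longrightarrow> f q = g q" "C1 T f" shows "C1 T g"
proof -
  have "continuous_on T (pdiff T b g)" if "b \<in> Basis" for b
    using C1_continuous_pdiff[OF assms(2) that] pdiff_cong[of T f g] assms(1)
    by (metis (no_types, lifting) continuous_on_cong)
  moreover have "g differentiable_on T"
    unfolding differentiable_on_def differentiable_def
    using C1_differentiable[OF assms(2)] has_derivative_transform[of _ T g f] assms(1)
    unfolding differentiable_def by metis
  ultimately show ?thesis by (auto simp: C1_def Basis_prod_def)
qed

section \<open>Double power series\<close>

definition expands :: "(real \<times> real) set \<Rightarrow> (real \<times> real \<Rightarrow> real) \<Rightarrow> real \<times> real \<Rightarrow> real \<Rightarrow> (nat \<Rightarrow> nat \<Rightarrow> real) \<Rightarrow> bool" where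
  "expands T f p r c \<longleftrightarrow> r > 0 \<and> (\<forall>q\<in>T \<inter> ball p r.
     ((\<lambda>(i, j). c i j * (fst q - fst p) ^ i * (snd q - snd p) ^ j) has_sum f q) UNIV)"

lemma analytic2_on_expands: "analytic2_on f T \<longleftrightarrow> (\<forall>p\<in>T. \<exists>r c. expands T f p r c)"
  unfolding analytic2_on_def expands_def by blast

lemma rect_convex: "rect T \<Longrightarrow> convex T"
  unfolding rect_def by (auto intro: convex_Times)

text \<open>Convergence at a point with both offsets of the same length bounds all coefficients at
  once. At a corner a single quadrant is available, so each offset points into the longer half of
  its interval.\<close>

lemma rect_diagonal_point:
  assumes "rect T" "p \<in> T" "r > 0"
  obtains \<delta> q where "\<delta> > 0" "\<delta> < r" "q \<in> T" "q \<in> ball p r" "\<bar>fst q - fst p\<bar> = \<delta>" "\<bar>snd q - snd p\<bar> = \<delta>"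
proof -
  obtain a b c d where T: "a < b" "c < d" "T = {a..b} \<times> {c..d}"
    using assms(1) unfolding rect_def by blast
  \<comment> \<open>A third of \<open>r\<close> keeps the sum of both offsets below
    \<open>r\<close>; the half widths keep the point in \<open>T\<close>.\<close>
  define \<delta> where "\<delta> = min (r/3) (min ((b-a)/2) ((d-c)/2))"
  have \<delta>: "\<delta> > 0" "\<delta> \<le> r/3" "\<delta> \<le> (b-a)/2" "\<delta> \<le> (d-c)/2"
    unfolding \<delta>_def using T(1,2) assms(3) by (simp, linarith+)
  define x where "x = (if fst p \<le> (a+b)/2 then fst p + \<delta> else fst p - \<delta>)"
  define y where "y = (if snd p \<le> (c+d)/2 then snd p + \<delta> else snd p - \<delta>)"
  have 1: "\<bar>x - fst p\<bar> = \<delta>" "\<bar>y - snd p\<bar> = \<delta>" using \<delta>(1) by (auto simp: x_def y_def)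
  have "dist p (x, y) \<le> dist (fst p) x + dist (snd p) y"
    using norm_Pair_le[of "fst p - x" "snd p - y"] by (cases p) (simp add: dist_norm)
  also have "\<dots> < r" using 1 \<delta> assms(3) by (simp add: dist_real_def abs_minus_commute)
  finally have "(x, y) \<in> ball p r" by simp
  moreover have "(x, y) \<in> T"
    using assms(2) \<delta> T by (cases p) (auto simp: x_def y_def field_simps)
  ultimately show ?thesis using that[of \<delta> "(x,y)"] 1 \<delta> assms(3) by auto
qed

text \<open>The factor \<open>i\<close> produced by differentiation is paid for by halving the
  radius, since i \<le> 2 ^ i.\<close>

lemma index_times_power_le:
  fixes x \<delta> :: real
  assumes "\<bar>x\<bar> \<le> \<delta> / 2" "\<delta> > 0"
  shows "real i * \<bar>x\<bar> ^ (i - 1) \<le> 2 / \<delta> * \<delta> ^ i"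
proof (cases i)
  case (Suc k)
  have "real (Suc k) \<le> 2 ^ Suc k" by (metis less_exp less_imp_le of_nat_less_numeral_power_cancel_iff)
  moreover have "\<bar>x\<bar> ^ k \<le> (\<delta>/2) ^ k" using assms by (intro power_mono) auto
  ultimately have "real (Suc k) * \<bar>x\<bar> ^ k \<le> 2 ^ Suc k * (\<delta>/2) ^ k"
    using assms by (intro mult_mono) auto
  also have "\<dots> = 2 / \<delta> * \<delta> ^ i" using assms(2) Suc by (simp add: power_divide)
  finally show ?thesis using Suc by simp
qed (use assms in auto)

text \<open>Absolute convergence at one diagonal point yields a summable majorant \<open>M\<close>
  for the termwise derivatives on the ball with half that offset as radius. They converge uniformly
  there, and the series can be differentiated within the convex set \<open>S\<close>, whether
  \<open>p\<close> is interior or on the boundary.\<close>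

lemma expands_differentiate:
  assumes T: "rect T" and p: "p \<in> T" and e: "expands T f p r c"
  obtains r' where "\<forall>q\<in>T \<inter> ball p r'. f differentiable (at q within T)"
    "expands T (pdiff T ex f) p r' (\<lambda>i j. real (Suc i) * c (Suc i) j)"
    "expands T (pdiff T ey f) p r' (\<lambda>i j. real (Suc j) * c i (Suc j))"
proof -
  have r: "r > 0" and f: "\<And>q. q \<in> T \<Longrightarrow> q \<in> ball p r \<Longrightarrow>
     ((\<lambda>(i, j). c i j * (fst q - fst p) ^ i * (snd q - snd p) ^ j) has_sum f q) UNIV"
    using e by (auto simp: expands_def)
  obtain \<delta> q0 where \<delta>: "\<delta> > 0" "\<delta> < r" and q0: "q0 \<in> T" "q0 \<in> ball p r"
     "\<bar>fst q0 - fst p\<bar> = \<delta>" "\<bar>snd q0 - snd p\<bar> = \<delta>"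
    using rect_diagonal_point[OF T p r] by blast
  define M where "M = (\<lambda>(i, j). 2 / \<delta> * (\<bar>c i j\<bar> * \<delta> ^ i * \<delta> ^ j))"
  have M: "M summable_on UNIV"
  proof -
    have "(\<lambda>ij. norm (case ij of (i, j) \<Rightarrow> c i j * (fst q0 - fst p) ^ i * (snd q0 - snd p) ^ j)) summable_on UNIV"
      using f[OF q0(1,2)] has_sum_imp_summable summable_on_iff_abs_summable_on_real by blast
    then have "(\<lambda>ij. 2 / \<delta> * norm (case ij of (i, j) \<Rightarrow> c i j * (fst q0 - fst p) ^ i * (snd q0 - snd p) ^ j)) summable_on UNIV"
      by (rule summable_on_cmult_right)
    then show ?thesis
      by (simp add: M_def case_prod_unfold abs_mult power_abs q0)
  qed
  define \<rho> where "\<rho> = \<delta> / 2"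
  define S where "S = T \<inter> ball p \<rho>"
  have \<rho>: "\<rho> > 0" "\<rho> < r" using \<delta> by (auto simp: \<rho>_def)
  have S: "q \<in> T" "q \<in> ball p r" "\<bar>fst q - fst p\<bar> \<le> \<delta>/2" "\<bar>snd q - snd p\<bar> \<le> \<delta>/2" if "q \<in> S" for q
  proof -
    show "q \<in> T" "q \<in> ball p r" using that \<rho> by (auto simp: S_def)
    have "norm (q - p) < \<rho>" using that by (simp add: S_def dist_norm norm_minus_commute)
    then show "\<bar>fst q - fst p\<bar> \<le> \<delta>/2" "\<bar>snd q - snd p\<bar> \<le> \<delta>/2"
      using norm_fst_le[of "fst q - fst p" "snd q - snd p"] norm_snd_le[of "snd q - snd p" "fst q - fst p"]
      by (simp_all add: \<rho>_def minus_prod_def)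
  qed
  define a1 where "a1 = (\<lambda>q (i, j). c i j * (real i * (fst q - fst p) ^ (i - 1)) * (snd q - snd p) ^ j)"
  define a2 where "a2 = (\<lambda>q (i, j). c i j * (fst q - fst p) ^ i * (real j * (snd q - snd p) ^ (j - 1)))"
  have le\<delta>: "\<bar>x\<bar> ^ j \<le> \<delta> ^ j" if "\<bar>x\<bar> \<le> \<delta>/2" for x :: real and j
    using that \<delta> by (intro power_mono) auto
  have a1: "norm (a1 q ij) \<le> M ij" if "q \<in> S" for q ij
  proof -
    obtain i j where ij: "ij = (i, j)" by fastforce
    have "norm (a1 q ij) = \<bar>c i j\<bar> * ((real i * \<bar>fst q - fst p\<bar> ^ (i - 1)) * \<bar>snd q - snd p\<bar> ^ j)"
      by (simp add: a1_def ij abs_mult power_abs)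
    also have "\<dots> \<le> \<bar>c i j\<bar> * ((2 / \<delta> * \<delta> ^ i) * \<delta> ^ j)"
      using S[OF that] \<delta> by (intro mult_left_mono mult_mono index_times_power_le le\<delta>) auto
    finally show ?thesis by (simp add: ij M_def mult_ac)
  qed
  have a2: "norm (a2 q ij) \<le> M ij" if "q \<in> S" for q ij
  proof -
    obtain i j where ij: "ij = (i, j)" by fastforce
    have "norm (a2 q ij) = \<bar>c i j\<bar> * (\<bar>fst q - fst p\<bar> ^ i * (real j * \<bar>snd q - snd p\<bar> ^ (j - 1)))"
      by (simp add: a2_def ij abs_mult power_abs)
    also have "\<dots> \<le> \<bar>c i j\<bar> * (\<delta> ^ i * (2 / \<delta> * \<delta> ^ j))"
      using S[OF that] \<delta> by (intro mult_left_mono mult_mono index_times_power_le le\<delta>) auto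
    finally show ?thesis by (simp add: ij M_def mult_ac)
  qed
  \<comment> \<open>Uniform limits and termwise differentiation are available for sequences, so the
    double sum is enumerated; absolute convergence makes the two kinds of sum agree.\<close>
  define d where "d = prod_decode"
  have d: "bij_betw d UNIV UNIV" by (simp add: d_def bij_prod_decode)
  have sumM: "summable (\<lambda>n. M (d n))"
    using M summable_on_reindex_bij_betw[OF d, of M] summable_on_imp_summable by blast
  have hs: "(h has_sum (\<Sum>n. h (d n))) UNIV" if "\<And>ij. norm (h ij) \<le> M ij" for h :: "nat \<times> nat \<Rightarrow> real"
  proof -
    have "h summable_on UNIV"
      using Infinite_Sum.abs_summable_on_comparison_test'[OF M, of h] that summable_on_iff_abs_summable_on_real by blast
    then obtain s where s: "(h has_sum s) UNIV" by (auto simp: summable_on_def)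
    then have "(\<lambda>n. h (d n)) sums s"
      using has_sum_reindex_bij_betw[OF d, of h s] has_sum_imp_sums by blast
    with s show ?thesis by (simp add: sums_iff)
  qed
  define A1 where "A1 = (\<lambda>q. \<Sum>n. a1 q (d n))"
  define A2 where "A2 = (\<lambda>q. \<Sum>n. a2 q (d n))"
  have u1: "uniform_limit S (\<lambda>n q. \<Sum>i<n. a1 q (d i)) A1 sequentially"
    unfolding A1_def by (rule Weierstrass_m_test[OF _ sumM]) (use a1 in auto)
  have u2: "uniform_limit S (\<lambda>n q. \<Sum>i<n. a2 q (d i)) A2 sequentially"
    unfolding A2_def by (rule Weierstrass_m_test[OF _ sumM]) (use a2 in auto)
  define g where "g = (\<lambda>(i, j) q. c i j * (fst q - fst p) ^ i * (snd q - snd p) ^ j)"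
  have pS: "p \<in> S" using p \<rho> by (simp add: S_def)
  have fs: "(\<lambda>n. g (d n) q) sums f q" if "q \<in> S" for q
    using has_sum_reindex_bij_betw[OF d, of "\<lambda>ij. g ij q" "f q"] f[OF S(1,2)[OF that]] has_sum_imp_sums
    by (auto simp: g_def case_prod_unfold)
  have "\<exists>G. \<forall>q\<in>S. (\<lambda>n. g (d n) q) sums (G q) \<and>
      (G has_derivative (\<lambda>h. fst h * A1 q + snd h * A2 q)) (at q within S)"
  proof (rule has_derivative_series[where f' = "\<lambda>n q h. fst h * a1 q (d n) + snd h * a2 q (d n)"])
    show "convex S" using rect_convex[OF T] by (auto simp: S_def intro: convex_Int)
    show "(g (d n) has_derivative (\<lambda>h. fst h * a1 q (d n) + snd h * a2 q (d n))) (at q within S)" for n q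
      unfolding g_def a1_def a2_def case_prod_unfold
      by (auto intro!: derivative_eq_intros simp: fun_eq_iff algebra_simps)
    show "\<forall>\<^sub>F n in sequentially. \<forall>q\<in>S. \<forall>h. norm ((\<Sum>i<n. fst h * a1 q (d i) + snd h * a2 q (d i))
        - (fst h * A1 q + snd h * A2 q)) \<le> e * norm h" if "e > 0" for e
    proof -
      have "\<forall>\<^sub>F n in sequentially. \<forall>q\<in>S. dist (\<Sum>i<n. a1 q (d i)) (A1 q) < e/2"
        using uniform_limitD[OF u1, of "e/2"] that by simp
      moreover have "\<forall>\<^sub>F n in sequentially. \<forall>q\<in>S. dist (\<Sum>i<n. a2 q (d i)) (A2 q) < e/2"
        using uniform_limitD[OF u2, of "e/2"] that by simp
      ultimately show ?thesis
      proof eventually_elim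
        case (elim n)
        show ?case
        proof (intro ballI allI)
          fix q :: "real \<times> real" and h :: "real \<times> real" assume "q \<in> S"
          then have b: "\<bar>(\<Sum>i<n. a1 q (d i)) - A1 q\<bar> \<le> e/2" "\<bar>(\<Sum>i<n. a2 q (d i)) - A2 q\<bar> \<le> e/2"
            using elim by (auto simp: dist_real_def less_imp_le)
          have "norm ((\<Sum>i<n. fst h * a1 q (d i) + snd h * a2 q (d i)) - (fst h * A1 q + snd h * A2 q))
            = \<bar>fst h * ((\<Sum>i<n. a1 q (d i)) - A1 q) + snd h * ((\<Sum>i<n. a2 q (d i)) - A2 q)\<bar>"
            by (simp add: sum.distrib sum_distrib_left algebra_simps)
          also have "\<dots> \<le> \<bar>fst h\<bar> * \<bar>(\<Sum>i<n. a1 q (d i)) - A1 q\<bar> + \<bar>snd h\<bar> * \<bar>(\<Sum>i<n. a2 q (d i)) - A2 q\<bar>"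
            by (metis abs_mult abs_triangle_ineq)
          also have "\<dots> \<le> norm h * (e/2) + norm h * (e/2)"
            using norm_fst_le[of "fst h" "snd h"] norm_snd_le[of "snd h" "fst h"] b by (intro add_mono mult_mono) auto
          finally show "norm ((\<Sum>i<n. fst h * a1 q (d i) + snd h * a2 q (d i)) - (fst h * A1 q + snd h * A2 q)) \<le> e * norm h"
            by (simp add: algebra_simps)
        qed
      qed
    qed
  qed (rule pS, rule fs[OF pS])
  then obtain G where G: "\<And>q. q \<in> S \<Longrightarrow> (\<lambda>n. g (d n) q) sums (G q)"
     "\<And>q. q \<in> S \<Longrightarrow> (G has_derivative (\<lambda>h. fst h * A1 q + snd h * A2 q)) (at q within S)"
    by blast
  have fG: "f q = G q" if "q \<in> S" for q using fs[OF that] G(1)[OF that] sums_unique2 by blast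
  have der: "(f has_derivative (\<lambda>h. fst h * A1 q + snd h * A2 q)) (at q within T)" if q: "q \<in> S" for q
  proof -
    have "(f has_derivative (\<lambda>h. fst h * A1 q + snd h * A2 q)) (at q within S)"
      using has_derivative_transform[OF q fG G(2)[OF q]] .
    moreover have "at q within S = at q within T"
      by (rule at_within_nhd[of q "ball p \<rho>"]) (use q in \<open>auto simp: S_def\<close>)
    ultimately show ?thesis by simp
  qed
  have e1: "((\<lambda>(i, j). real (Suc i) * c (Suc i) j * (fst q - fst p) ^ i * (snd q - snd p) ^ j)
      has_sum pdiff T ex f q) UNIV" if q: "q \<in> S" for q
  proof -
    \<comment> \<open>Terms of degree 0 in the first variable vanish under differentiation.
      \<open>h\<close> enumerates the other indices, and reindexing along it shifts the coefficients
      into standard form.\<close>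
    define h where "h = (\<lambda>ij::nat \<times> nat. (Suc (fst ij), snd ij))"
    have "(a1 q has_sum A1 q) UNIV" unfolding A1_def by (rule hs) (use a1 q in auto)
    then have "(a1 q has_sum A1 q) (h ` UNIV)"
    proof (subst has_sum_cong_neutral[of UNIV "h ` UNIV" "a1 q" "a1 q"])
      fix ij assume "ij \<in> UNIV - range h"
      then have "fst ij = 0" by (cases ij; cases "fst ij") (auto simp: h_def image_iff)
      then show "a1 q ij = 0" by (simp add: a1_def case_prod_unfold)
    qed auto
    then have "((a1 q \<circ> h) has_sum A1 q) UNIV"
      by (subst (asm) has_sum_reindex) (auto simp: inj_on_def h_def)
    moreover have "pdiff T ex f q = A1 q"
      using pdiff_eqI[OF T S(1)[OF q] der[OF q], of ex] by simp
    ultimately show ?thesis by (simp add: a1_def h_def o_def case_prod_unfold mult_ac)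
  qed
  have e2: "((\<lambda>(i, j). real (Suc j) * c i (Suc j) * (fst q - fst p) ^ i * (snd q - snd p) ^ j)
      has_sum pdiff T ey f q) UNIV" if q: "q \<in> S" for q
  proof -
    define h where "h = (\<lambda>ij::nat \<times> nat. (fst ij, Suc (snd ij)))"
    have "(a2 q has_sum A2 q) UNIV" unfolding A2_def by (rule hs) (use a2 q in auto)
    then have "(a2 q has_sum A2 q) (h ` UNIV)"
    proof (subst has_sum_cong_neutral[of UNIV "h ` UNIV" "a2 q" "a2 q"])
      fix ij assume "ij \<in> UNIV - range h"
      then have "snd ij = 0" by (cases ij; cases "snd ij") (auto simp: h_def image_iff)
      then show "a2 q ij = 0" by (simp add: a2_def case_prod_unfold)
    qed auto
    then have "((a2 q \<circ> h) has_sum A2 q) UNIV"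
      by (subst (asm) has_sum_reindex) (auto simp: inj_on_def h_def)
    moreover have "pdiff T ey f q = A2 q"
      using pdiff_eqI[OF T S(1)[OF q] der[OF q], of ey] by simp
    ultimately show ?thesis by (simp add: a2_def h_def o_def case_prod_unfold mult_ac)
  qed
  show ?thesis
  proof (rule that[of \<rho>])
    show "\<forall>q\<in>T \<inter> ball p \<rho>. f differentiable (at q within T)"
      using der unfolding S_def differentiable_def by blast
  qed (use e1 e2 \<rho> in \<open>auto simp: expands_def S_def\<close>)
qed

text \<open>At the centre only the constant term survives, as \<open>0 ^ 0 = 1\<close>. Equality of
  values thus reduces to equality of one coefficient.\<close>

lemma expands_at:
  assumes "p \<in> T" "expands T f p r c" shows "f p = c 0 0"
proof -
  have "((\<lambda>(i, j). c i j * (0::real) ^ i * 0 ^ j) has_sum f p) UNIV"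
    using assms by (auto simp: expands_def dest!: bspec[of _ _ p])
  moreover have "((\<lambda>(i, j). c i j * (0::real) ^ i * 0 ^ j) has_sum c 0 0) UNIV"
    by (subst has_sum_cong_neutral[where S=UNIV and T="{(0,0)}" and g="\<lambda>_. c 0 0"])
      (auto simp: power_0_left has_sum_finite_iff split: if_splits)
  ultimately show ?thesis using has_sum_unique by blast
qed

lemma analytic2_on_differentiable:
  assumes "rect T" "analytic2_on f T" shows "f differentiable_on T"
  unfolding differentiable_on_def
proof
  fix p assume p: "p \<in> T"
  then obtain r c where "expands T f p r c" using assms(2) analytic2_on_expands by blast
  from expands_differentiate[OF assms(1) p this] obtain r' where
    "\<forall>q\<in>T \<inter> ball p r'. f differentiable (at q within T)" "r' > 0" by (metis expands_def)
  then show "f differentiable at p within T" using p by auto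
qed

lemma analytic2_on_pdiff:
  assumes "rect T" "analytic2_on f T" "b \<in> Basis" shows "analytic2_on (pdiff T b f) T"
  unfolding analytic2_on_expands
proof
  fix p assume p: "p \<in> T"
  then obtain r c where "expands T f p r c" using assms(2) analytic2_on_expands by blast
  from expands_differentiate[OF assms(1) p this] obtain r' where
    "expands T (pdiff T ex f) p r' (\<lambda>i j. real (Suc i) * c (Suc i) j)"
    "expands T (pdiff T ey f) p r' (\<lambda>i j. real (Suc j) * c i (Suc j))" by blast
  then show "\<exists>r c. expands T (pdiff T b f) p r c"
    using assms(3) by (auto simp: Basis_prod_def simp del: of_nat_Suc)
qed

text \<open>Differentiating the expansion at \<open>p\<close> in either order multiplies the same
  coefficient by the same two integers, and evaluation at the centre compares the results. The
  argument is insensitive to \<open>p\<close> lying on the boundary.\<close>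

lemma analytic2_on_pdiff_commute:
  assumes "rect T" "analytic2_on f T" "p \<in> T"
  shows "pdiff T ey (pdiff T ex f) p = pdiff T ex (pdiff T ey f) p"
proof -
  obtain r c where "expands T f p r c" using assms(2,3) analytic2_on_expands by blast
  from expands_differentiate[OF assms(1,3) this] obtain r' where
    1: "expands T (pdiff T ex f) p r' (\<lambda>i j. real (Suc i) * c (Suc i) j)"
    and 2: "expands T (pdiff T ey f) p r' (\<lambda>i j. real (Suc j) * c i (Suc j))" by blast
  obtain r1 where 3: "expands T (pdiff T ey (pdiff T ex f)) p r1 (\<lambda>i j. real (Suc j) * (real (Suc i) * c (Suc i) (Suc j)))"
    by (rule expands_differentiate[OF assms(1,3) 1]) blast
  obtain r2 where 4: "expands T (pdiff T ex (pdiff T ey f)) p r2 (\<lambda>i j. real (Suc i) * (real (Suc j) * c (Suc i) (Suc j)))"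
    by (rule expands_differentiate[OF assms(1,3) 2]) blast
  show ?thesis using expands_at[OF assms(3) 3] expands_at[OF assms(3) 4] by simp
qed

lemma analytic2_on_C1:
  assumes "rect T" "analytic2_on f T" shows "C1 T f"
  using analytic2_on_differentiable[OF assms(1)] analytic2_on_pdiff[OF assms] assms
  by (auto simp: C1_def Basis_prod_def intro!: differentiable_imp_continuous_on)

section \<open>Integration over the reference square\<close>

lemma refI_measurable [measurable]: "refI \<in> sets borel"
  by (simp add: refI_def)

lemma refS_eq_Times: "refS = refI \<times> refI"
  by (simp add: refS_def refI_def)

lemma refS_measurable [measurable]: "refS \<in> sets borel"
  unfolding refS_def by (intro borel_open open_Times) auto

lemma refS_subset: "refS \<subseteq> refSc"
  by (auto simp: refS_def refSc_def)

lemma refI_subset: "refI \<subseteq> {-1..1}"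
  by (auto simp: refI_def)

lemma measure_refI: "measure lborel refI = 2"
  by (simp add: refI_def)

lemma emeasure_refS: "emeasure lborel refS = 4"
proof -
  have "emeasure lborel refS = emeasure lborel refI * emeasure lborel refI"
    unfolding refS_eq_Times using lborel.emeasure_pair_measure_Times[of refI lborel refI]
    by (simp add: lborel_prod refI_measurable)
  then show ?thesis by (simp add: refI_def flip: ennreal_numeral ennreal_mult)
qed

lemma measure_refS: "measure lborel refS = 4"
  by (simp add: measure_def emeasure_refS)

lemma compact_refSc: "compact refSc"
  unfolding refSc_def by (intro compact_Times) auto

lemma set_integrable_refS:
  fixes f :: "real \<times> real \<Rightarrow> real"
  assumes "continuous_on refSc f" shows "set_integrable lborel refS f"
proof -
  have "set_integrable lborel refSc f"
    unfolding set_integrable_def using borel_integrable_compact[OF compact_refSc assms] .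
  then show ?thesis by (rule set_integrable_subset) (auto simp: refS_subset refS_measurable)
qed

lemma set_integrable_refI:
  fixes f :: "real \<Rightarrow> real"
  assumes "continuous_on {-1..1} f" shows "set_integrable lborel refI f"
  using borel_integrable_atLeastAtMost'[OF assms]
  by (rule set_integrable_subset) (auto simp: refI_def)

lemma refI_FTC:
  fixes F :: "real \<Rightarrow> real"
  assumes "\<And>t. t \<in> {-1..1} \<Longrightarrow> (F has_vector_derivative f t) (at t within {-1..1})" "continuous_on {-1..1} f"
  shows "(LINT t:refI|lborel. f t) = F 1 - F (-1)"
proof -
  have "(LINT t:refI|lborel. f t) = (LINT t:{-1..1}|lborel. f t)"
    using interval_integral_Icc[of "-1" 1 f] interval_integral_Ioo[of "-1" 1 f] by (simp add: refI_def one_ereal_def)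
  also have "\<dots> = F 1 - F (-1)"
    unfolding set_lebesgue_integral_def by (rule integral_FTC_atLeastAtMost) (use assms in auto)
  finally show ?thesis .
qed

text \<open>A non-integrable \<open>f\<close> has Bochner integral 0, which is below the bound
  because \<open>0 \<le> M\<close>. Hence fractional seminorms can be estimated from a pointwise
  bound on their integrand alone.\<close>

lemma set_integral_le_bound:
  fixes f :: "'a \<Rightarrow> real"
  assumes "\<And>x. x \<in> A \<Longrightarrow> f x \<le> M" "0 \<le> M" "A \<in> sets L" "emeasure L A < \<infinity>"
  shows "(LINT x:A|L. f x) \<le> M * measure L A"
proof (cases "set_integrable L A f")
  case True
  have "(LINT x:A|L. f x) \<le> (LINT x:A|L. M)"
    using assms by (intro set_integral_mono[OF True]) (auto simp: set_integrable_def)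
  also have "\<dots> = M * measure L A"
    using assms by (simp add: set_lebesgue_integral_def)
  finally show ?thesis .
next
  case False
  then show ?thesis using assms
    by (simp add: set_lebesgue_integral_def set_integrable_def not_integrable_integral_eq)
qed

lemma set_integral_nonneg':
  fixes f :: "'a \<Rightarrow> real"
  assumes "\<And>x. x \<in> A \<Longrightarrow> 0 \<le> f x"
  shows "0 \<le> (LINT x:A|L. f x)"
  unfolding set_lebesgue_integral_def using assms
  by (intro Bochner_Integration.integral_nonneg) (auto simp: indicator_def)

lemma refS_fubini:
  fixes f :: "real \<times> real \<Rightarrow> real"
  assumes "continuous_on refSc f"
  shows "(LINT p:refS|lborel. f p) = (LINT x:refI|lborel. LINT y:refI|lborel. f (x, y))"
    and "(LINT p:refS|lborel. f p) = (LINT y:refI|lborel. LINT x:refI|lborel. f (x, y))"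
proof -
  let ?g = "\<lambda>p. indicator refS p *\<^sub>R f p"
  have g: "integrable (lborel \<Otimes>\<^sub>M lborel) ?g"
    using set_integrable_refS[OF assms] by (simp add: set_integrable_def lborel_prod)
  have "(LINT p:refS|lborel. f p) = (\<integral>x. \<integral>y. ?g (x, y) \<partial>lborel \<partial>lborel)"
    using lborel_pair.integral_fst'[OF g] by (simp add: set_lebesgue_integral_def lborel_prod)
  then show "(LINT p:refS|lborel. f p) = (LINT x:refI|lborel. LINT y:refI|lborel. f (x, y))"
    by (simp add: set_lebesgue_integral_def refS_eq_Times indicator_times mult.assoc)
  have "(LINT p:refS|lborel. f p) = (\<integral>y. \<integral>x. ?g (x, y) \<partial>lborel \<partial>lborel)"
    using lborel_pair.integral_snd[of "\<lambda>x y. ?g (x, y)"] g by (simp add: set_lebesgue_integral_def lborel_prod case_prod_unfold)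
  then show "(LINT p:refS|lborel. f p) = (LINT y:refI|lborel. LINT x:refI|lborel. f (x, y))"
    by (simp add: set_lebesgue_integral_def refS_eq_Times indicator_times mult.assoc mult.left_commute)
qed

section \<open>Traces on the sides and the divergence theorem\<close>

lemma has_vector_derivative_line:
  fixes f :: "real \<times> real \<Rightarrow> real"
  assumes "f differentiable (at (\<gamma> t) within T)" "(\<gamma> has_vector_derivative v) (at t within A)" "\<gamma> ` A \<subseteq> T"
  shows "((\<lambda>t. f (\<gamma> t)) has_vector_derivative fst v * pdiff T ex f (\<gamma> t) + snd v * pdiff T ey f (\<gamma> t)) (at t within A)"
proof -
  have "(f has_derivative (\<lambda>h. fst h * pdiff T ex f (\<gamma> t) + snd h * pdiff T ey f (\<gamma> t))) (at (\<gamma> t) within \<gamma> ` A)"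
    using has_derivative_pdiff[OF assms(1)] assms(3) by (rule has_derivative_subset)
  from diff_chain_within[OF assms(2)[unfolded has_vector_derivative_def] this]
  show ?thesis by (simp add: has_vector_derivative_def o_def algebra_simps)
qed

lemma ref_side_in_refSc: "t \<in> {-1..1} \<Longrightarrow> ref_side s t \<in> refSc"
  by (cases s) (auto simp: refSc_def)

fun side_dir :: "side \<Rightarrow> real \<times> real" where
  "side_dir West = ey" | "side_dir East = ey" | "side_dir South = ex" | "side_dir North = ex"

lemma ref_side_eta:
  "ref_side West = (\<lambda>t. (-1, t))" "ref_side East = (\<lambda>t. (1, t))"
  "ref_side South = (\<lambda>t. (t, -1))" "ref_side North = (\<lambda>t. (t, 1))"
  by auto

lemma continuous_on_ref_side [continuous_intros]: "continuous_on A (ref_side s)"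
  by (cases s) (auto intro!: continuous_intros simp: ref_side_eta)

lemma continuous_on_compose_ref_side:
  assumes "continuous_on refSc f" shows "continuous_on {-1..1} (\<lambda>t. f (ref_side s t))"
  by (rule continuous_on_compose2[OF assms]) (auto simp: ref_side_in_refSc intro!: continuous_intros)

lemma ref_side_has_vector_derivative: "(ref_side s has_vector_derivative side_dir s) (at t within A)"
  by (cases s) (auto intro!: derivative_eq_intros simp: has_vector_derivative_def ref_side_eta fun_eq_iff)

lemma has_vector_derivative_ref_side:
  fixes f :: "real \<times> real \<Rightarrow> real"
  assumes "f differentiable (at (ref_side s t) within refSc)"
  shows "((\<lambda>t. f (ref_side s t)) has_vector_derivative pdiff refSc (side_dir s) f (ref_side s t)) (at t within {-1..1})"
proof -
  have "ref_side s ` {-1..1} \<subseteq> refSc" using ref_side_in_refSc by blast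
  from has_vector_derivative_line[OF assms ref_side_has_vector_derivative this]
  show ?thesis by (cases s) auto
qed

text \<open>Fubini, with the order of integration chosen for each component, and the fundamental
  theorem of calculus on lines parallel to an axis.\<close>

theorem refS_divergence:
  assumes "C1 refSc P" "C1 refSc Q"
  shows "(LINT p:refS|lborel. pdiff refSc ex P p + pdiff refSc ey Q p) =
    (LINT t:refI|lborel. P (ref_side East t)) - (LINT t:refI|lborel. P (ref_side West t))
    + (LINT t:refI|lborel. Q (ref_side North t)) - (LINT t:refI|lborel. Q (ref_side South t))"
proof -
  have cP: "continuous_on refSc (pdiff refSc ex P)" and cQ: "continuous_on refSc (pdiff refSc ey Q)"
    using assms by (auto simp: C1_def)
  have line: "(LINT x:refI|lborel. pdiff refSc ex P (x, y)) = P (1, y) - P (-1, y)" if "y \<in> refI" for y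
  proof (rule refI_FTC[where F="\<lambda>x. P (x, y)"])
    fix t :: real assume t: "t \<in> {-1..1}"
    show "((\<lambda>x. P (x, y)) has_vector_derivative pdiff refSc ex P (t, y)) (at t within {-1..1})"
    proof -
      have sub: "(\<lambda>x. (x, y)) ` {-1..1} \<subseteq> refSc" using that by (auto simp: refSc_def refI_def)
      have d: "((\<lambda>x. (x, y)) has_vector_derivative ex) (at t within {-1..1})"
        unfolding has_vector_derivative_def by (auto intro!: derivative_eq_intros simp: fun_eq_iff)
      have "(t,y) \<in> refSc" using sub t by auto
      from has_vector_derivative_line[OF C1_differentiable[OF assms(1) this] d sub] show ?thesis by simp
    qed
  next
    show "continuous_on {-1..1} (\<lambda>x. pdiff refSc ex P (x, y))"
      by (rule continuous_on_compose2[OF cP]) (use that in \<open>auto simp: refSc_def refI_def intro!: continuous_intros\<close>)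
  qed
  have line': "(LINT y:refI|lborel. pdiff refSc ey Q (x, y)) = Q (x, 1) - Q (x, -1)" if "x \<in> refI" for x
  proof (rule refI_FTC[where F="\<lambda>y. Q (x, y)"])
    fix t :: real assume t: "t \<in> {-1..1}"
    show "((\<lambda>y. Q (x, y)) has_vector_derivative pdiff refSc ey Q (x, t)) (at t within {-1..1})"
    proof -
      have sub: "(\<lambda>y. (x, y)) ` {-1..1} \<subseteq> refSc" using that by (auto simp: refSc_def refI_def)
      have d: "((\<lambda>y. (x, y)) has_vector_derivative ey) (at t within {-1..1})"
        unfolding has_vector_derivative_def by (auto intro!: derivative_eq_intros simp: fun_eq_iff)
      have "(x,t) \<in> refSc" using sub t by auto
      from has_vector_derivative_line[OF C1_differentiable[OF assms(2) this] d sub] show ?thesis by simp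
    qed
  next
    show "continuous_on {-1..1} (\<lambda>y. pdiff refSc ey Q (x, y))"
      by (rule continuous_on_compose2[OF cQ]) (use that in \<open>auto simp: refSc_def refI_def intro!: continuous_intros\<close>)
  qed
  have i: "set_integrable lborel refI (\<lambda>t. P (ref_side s t))" "set_integrable lborel refI (\<lambda>t. Q (ref_side s t))" for s
    by (intro set_integrable_refI continuous_on_compose_ref_side C1_continuous assms)+
  have "(LINT p:refS|lborel. pdiff refSc ex P p) = (LINT y:refI|lborel. P (1, y) - P (-1, y))"
    unfolding refS_fubini(2)[OF cP] by (rule set_lebesgue_integral_cong) (auto simp: line)
  also have "\<dots> = (LINT t:refI|lborel. P (ref_side East t)) - (LINT t:refI|lborel. P (ref_side West t))"
    using set_integral_diff(2)[OF i(1)[of East] i(1)[of West]] by simp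
  finally have 1: "(LINT p:refS|lborel. pdiff refSc ex P p) = \<dots>" .
  have "(LINT p:refS|lborel. pdiff refSc ey Q p) = (LINT x:refI|lborel. Q (x, 1) - Q (x, -1))"
    unfolding refS_fubini(1)[OF cQ] by (rule set_lebesgue_integral_cong) (auto simp: line')
  also have "\<dots> = (LINT t:refI|lborel. Q (ref_side North t)) - (LINT t:refI|lborel. Q (ref_side South t))"
    using set_integral_diff(2)[OF i(2)[of North] i(2)[of South]] by simp
  finally have 2: "(LINT p:refS|lborel. pdiff refSc ey Q p) = \<dots>" .
  show ?thesis
    using set_integral_add(2)[OF set_integrable_refS[OF cP] set_integrable_refS[OF cQ]] 1 2 by simp
qed

section \<open>Polynomials of bounded degree\<close>

text \<open>Tychonoff in the product topology. Pinning the coordinates outside \<open>I\<close> to 0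
  models a finite-dimensional coefficient space without a type of its own.\<close>

lemma compact_cube:
  "compact (PiE UNIV (\<lambda>i. if i \<in> I then {-1..1} else {0::real}))"
proof -
  have "compactin (product_topology (\<lambda>_. euclidean) UNIV) (PiE UNIV (\<lambda>i. if i \<in> I then {-1..1} else {0::real}))"
    by (subst compactin_PiE) (auto simp: compactin_euclidean_iff)
  then show ?thesis by (simp add: euclidean_product_topology compactin_euclidean_iff)
qed

text \<open>Equivalence of norms in finite dimension: \<open>Q\<close> attains a positive minimum on
  the unit sphere of the maximum norm, and homogeneity transports the bound to every scale.\<close>

lemma quadratic_form_coercive:
  fixes Q :: "('i \<Rightarrow> real) \<Rightarrow> real"
  assumes "finite I" and cont: "continuous_on UNIV Q"
    and hom: "\<And>t c. Q (\<lambda>i. t * c i) = t\<^sup>2 * Q c"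
    and pos: "\<And>c i. \<lbrakk>i \<in> I; c i \<noteq> 0; \<And>j. j \<notin> I \<Longrightarrow> c j = 0\<rbrakk> \<Longrightarrow> Q c > 0"
  shows "\<exists>C>0. \<forall>c. (\<forall>i. i \<notin> I \<longrightarrow> c i = 0) \<longrightarrow> (\<forall>i\<in>I. (c i)\<^sup>2 \<le> C * Q c)"
proof (cases "I = {}")
  case False
  \<comment> \<open>The unit sphere of the maximum norm: points of the cube with some coordinate of
    modulus 1. It is closed because \<open>I\<close> is finite.\<close>
  define K where "K = PiE UNIV (\<lambda>i. if i \<in> I then {-1..1} else {0::real}) \<inter> (\<Union>i\<in>I. {c. \<bar>c i\<bar> = 1})"
  have "closed {c. \<bar>c i\<bar> = (1::real)}" for i :: 'i
    by (intro closed_Collect_eq continuous_intros continuous_on_product_coordinates)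
  then have "compact K"
    unfolding K_def using \<open>finite I\<close> by (intro compact_Int_closed compact_cube closed_UN) auto
  moreover obtain i0 where "i0 \<in> I" using False by blast
  then have "(\<lambda>i. if i \<in> I then 1 else 0) \<in> K" by (auto simp: K_def)
  ultimately obtain c0 where c0: "c0 \<in> K" "\<And>c. c \<in> K \<Longrightarrow> Q c0 \<le> Q c"
    using continuous_attains_inf[of K Q] cont continuous_on_subset by blast
  have "Q c0 > 0"
  proof -
    from c0(1) obtain i where "i \<in> I" "\<bar>c0 i\<bar> = 1" by (auto simp: K_def)
    moreover have "c0 j = 0" if "j \<notin> I" for j
      using c0(1) that by (auto simp: K_def PiE_iff dest: spec[of _ j])
    ultimately show ?thesis using pos[of i c0] by auto
  qed
  have "(c i)\<^sup>2 \<le> 1 / Q c0 * Q c" if c: "\<forall>i. i \<notin> I \<longrightarrow> c i = 0" and i: "i \<in> I" for c i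
  proof -
    define m where "m = Max ((\<lambda>i. \<bar>c i\<bar>) ` I)"
    have m: "\<bar>c j\<bar> \<le> m" if "j \<in> I" for j unfolding m_def using that \<open>finite I\<close> by (intro Max_ge) auto
    have "m \<in> (\<lambda>i. \<bar>c i\<bar>) ` I" unfolding m_def using \<open>finite I\<close> False by (intro Max_in) auto
    then obtain k where k: "k \<in> I" "\<bar>c k\<bar> = m" by auto
    show ?thesis
    proof (cases "m = 0")
      case True
      then have "c i = 0" using m[OF i] by simp
      moreover have "c j = 0" for j using True m[of j] c by (cases "j \<in> I") auto
      then have "c = (\<lambda>j. 0 * c j)" by auto
      then have "Q c = 0" using hom[of 0 c] by simp
      ultimately show ?thesis by simp
    next
      case False
      then have m0: "m > 0" using k by linarith
      have "- m \<le> c j" "c j \<le> m" if "j \<in> I" for j using m[OF that] by auto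
      then have "1/m * c j \<in> {-1..1}" if "j \<in> I" for j
        using m0 that by (simp add: pos_le_divide_eq pos_divide_le_eq)
      moreover have "\<bar>1/m * c k\<bar> = 1" using k(2) m0 by (simp add: abs_mult)
      ultimately have "(\<lambda>j. 1/m * c j) \<in> K"
        unfolding K_def using c k(1) by (intro IntI PiE_I UN_I[of k]) auto
      then have "Q c0 \<le> (1/m)\<^sup>2 * Q c" using c0(2) hom by metis
      then have *: "m\<^sup>2 * Q c0 \<le> Q c" using m0 by (simp add: field_simps power2_eq_square)
      have "(c i)\<^sup>2 \<le> m\<^sup>2" using m[OF i] m0 by (simp add: abs_le_square_iff[symmetric])
      then have "(c i)\<^sup>2 * Q c0 \<le> m\<^sup>2 * Q c0" using \<open>Q c0 > 0\<close> by simp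
      then have "(c i)\<^sup>2 * Q c0 \<le> Q c" using * by (rule order_trans)
      then show ?thesis using \<open>Q c0 > 0\<close> by (simp add: field_simps)
    qed
  qed
  then show ?thesis using \<open>Q c0 > 0\<close> by (intro exI[of _ "1 / Q c0"]) auto
qed (auto intro: exI[of _ 1])

definition pol :: "nat \<Rightarrow> (nat \<times> nat \<Rightarrow> real) \<Rightarrow> real \<times> real \<Rightarrow> real" where
  "pol W c p = (\<Sum>ij\<in>{..W} \<times> {..W}. c ij * (fst p ^ fst ij * snd p ^ snd ij))"

lemma poly_sep_pol: "f \<in> poly_sep W \<longleftrightarrow> (\<exists>c. f = pol W c)"
proof
  assume "f \<in> poly_sep W"
  then obtain c where "\<And>x y. f (x, y) = (\<Sum>i\<le>W. \<Sum>j\<le>W. c i j * x ^ i * y ^ j)"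
    unfolding poly_sep_def by blast
  then have "f = pol W (\<lambda>(i, j). c i j)"
    by (auto simp: pol_def fun_eq_iff sum.cartesian_product case_prod_unfold mult.assoc)
  then show "\<exists>c. f = pol W c" by blast
next
  assume "\<exists>c. f = pol W c"
  then obtain c where "f = pol W c" by blast
  then show "f \<in> poly_sep W"
    unfolding poly_sep_def mem_Collect_eq
    by (intro exI[of _ "\<lambda>i j. c (i, j)"])
      (auto simp: pol_def sum.cartesian_product case_prod_unfold mult.assoc)
qed

lemma pol_eq: "pol W c (x, y) = (\<Sum>i\<le>W. (\<Sum>j\<le>W. c (i, j) * y ^ j) * x ^ i)"
proof -
  have "pol W c (x, y) = (\<Sum>(i, j)\<in>{..W} \<times> {..W}. c (i, j) * y ^ j * x ^ i)"
    by (simp add: pol_def case_prod_unfold mult_ac)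
  then show ?thesis by (simp add: sum.cartesian_product sum_distrib_right)
qed

lemma continuous_on_pol [continuous_intros]: "continuous_on A (pol W c)"
  unfolding pol_def by (intro continuous_intros)

text \<open>A polynomial in one variable with infinitely many roots is zero. This is used twice: for
  fixed \<open>y\<close> in the variable \<open>x\<close>, then for each resulting coefficient as a
  polynomial in \<open>y\<close>.\<close>

lemma pol_eq_0:
  assumes "\<And>p. p \<in> refS \<Longrightarrow> pol W c p = 0" "i \<le> W" "j \<le> W"
  shows "c (i, j) = 0"
proof -
  have z: "d k = 0" if "\<And>x. x \<in> {-1<..<1::real} \<Longrightarrow> (\<Sum>i\<le>W. d i * x ^ i) = 0" "k \<le> W" for d :: "nat \<Rightarrow> real" and k
  proof (rule ccontr)
    assume "d k \<noteq> 0"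
    then have "finite {x. (\<Sum>i\<le>W. d i * x ^ i) = 0}" using that by (auto simp: Transcendental.polyfun_finite_roots)
    moreover have "{-1<..<1} \<subseteq> {x. (\<Sum>i\<le>W. d i * x ^ i) = 0}" using that by blast
    ultimately have "finite {-1<..<1::real}" by (rule finite_subset[rotated])
    then show False using infinite_Ioo[of "-1::real" 1] by simp
  qed
  have "(\<Sum>j\<le>W. c (i, j) * y ^ j) = 0" if y: "y \<in> {-1<..<1}" for y
  proof (rule z[of "\<lambda>i. \<Sum>j\<le>W. c (i, j) * y ^ j", OF _ assms(2)])
    fix x :: real assume "x \<in> {-1<..<1}"
    then have "pol W c (x, y) = 0" using assms(1) y by (auto simp: refS_def)
    then show "(\<Sum>i\<le>W. (\<Sum>j\<le>W. c (i, j) * y ^ j) * x ^ i) = 0" by (simp add: pol_eq)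
  qed
  from z[OF this assms(3)] show ?thesis .
qed

text \<open>A nonzero value inside the open square persists on a nonempty open set, and such a set
  is not null.\<close>

lemma set_integral_square_eq_0:
  fixes f :: "real \<times> real \<Rightarrow> real"
  assumes "continuous_on refSc f" "(LINT p:refS|lborel. (f p)\<^sup>2) = 0" "p \<in> refS"
  shows "f p = 0"
proof (rule ccontr)
  assume "f p \<noteq> 0"
  define U where "U = refS \<inter> f -` (- {0})"
  have "open refS" unfolding refS_def by (intro open_Times) auto
  then have U: "open U"
    unfolding U_def using assms(1) refS_subset
    by (intro continuous_open_preimage) (auto intro: continuous_on_subset)
  have i: "integrable lborel (\<lambda>p. indicator refS p *\<^sub>R (f p)\<^sup>2)"
    using set_integrable_refS[of "\<lambda>p. (f p)\<^sup>2"] assms(1) by (auto simp: set_integrable_def intro!: continuous_intros)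
  have "AE p in lborel. indicator refS p *\<^sub>R (f p)\<^sup>2 = 0"
    using integral_nonneg_eq_0_iff_AE[OF i] assms(2) by (auto simp: set_lebesgue_integral_def)
  then have "AE p in lborel. p \<notin> U" by eventually_elim (auto simp: U_def indicator_def)
  then have "U \<in> null_sets lborel" using U by (simp add: AE_iff_null_sets)
  then have "negligible U" by (simp add: negligible_iff_null_sets null_sets_completionI)
  then show False using open_not_negligible[OF U] \<open>f p \<noteq> 0\<close> assms(3) by (auto simp: U_def)
qed

lemma set_integrable_sum:
  fixes h :: "'i \<Rightarrow> 'a \<Rightarrow> real"
  assumes "\<And>i. i \<in> I \<Longrightarrow> set_integrable M A (h i)"
  shows "set_integrable M A (\<lambda>x. \<Sum>i\<in>I. h i x)"
  using assms unfolding set_integrable_def scaleR_sum_right by (rule Bochner_Integration.integrable_sum)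

lemma set_integral_sum:
  fixes h :: "'i \<Rightarrow> 'a \<Rightarrow> real"
  assumes "\<And>i. i \<in> I \<Longrightarrow> set_integrable M A (h i)"
  shows "(LINT x:A|M. (\<Sum>i\<in>I. h i x)) = (\<Sum>i\<in>I. LINT x:A|M. h i x)"
  using assms unfolding set_integrable_def set_lebesgue_integral_def scaleR_sum_right
  by (rule Bochner_Integration.integral_sum)

text \<open>The squared L2 norm is a positive definite quadratic form in the coefficients, so
  coercivity applies; definiteness is \<open>pol_eq_0\<close>.\<close>

lemma pol_coefficients_bound:
  "\<exists>C>0. \<forall>c. \<forall>ij\<in>{..W} \<times> {..W}. (c ij)\<^sup>2 \<le> C * (LINT p:refS|lborel. (pol W c p)\<^sup>2)"
proof -
  let ?I = "{..W} \<times> {..W}"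
  define Q where "Q = (\<lambda>c. LINT p:refS|lborel. (pol W c p)\<^sup>2)"
  define m where "m = (\<lambda>ij (p :: real \<times> real). fst p ^ fst ij * snd p ^ snd ij)"
  have int: "set_integrable lborel refS (\<lambda>p. m ij p * m kl p)" for ij kl
    unfolding m_def by (intro set_integrable_refS continuous_intros)
  \<comment> \<open>Expansion in the Gram matrix of the monomials makes continuity of
    \<open>Q\<close> in the product topology and its homogeneity evident.\<close>
  have Q: "Q c = (\<Sum>ij\<in>?I. \<Sum>kl\<in>?I. c ij * c kl * (LINT p:refS|lborel. m ij p * m kl p))" for c
  proof -
    have "(pol W c p)\<^sup>2 = (\<Sum>ij\<in>?I. \<Sum>kl\<in>?I. c ij * c kl * (m ij p * m kl p))" for p
      by (simp add: pol_def power2_eq_square sum_product m_def mult_ac)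
    then have "Q c = (LINT p:refS|lborel. (\<Sum>ij\<in>?I. \<Sum>kl\<in>?I. c ij * c kl * (m ij p * m kl p)))"
      by (simp add: Q_def)
    also have "\<dots> = (\<Sum>ij\<in>?I. \<Sum>kl\<in>?I. c ij * c kl * (LINT p:refS|lborel. m ij p * m kl p))"
      using int by (subst set_integral_sum, simp add: set_integrable_sum, subst set_integral_sum) simp_all
    finally show ?thesis .
  qed
  have "\<exists>C>0. \<forall>c. (\<forall>ij. ij \<notin> ?I \<longrightarrow> c ij = 0) \<longrightarrow> (\<forall>ij\<in>?I. (c ij)\<^sup>2 \<le> C * Q c)"
  proof (rule quadratic_form_coercive)
    show "continuous_on UNIV Q"
      unfolding Q[abs_def] by (intro continuous_intros continuous_on_product_coordinates)
    show "Q (\<lambda>i. t * c i) = t\<^sup>2 * Q c" for t c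
      unfolding Q by (simp add: sum_distrib_left power2_eq_square mult_ac)
    show "Q c > 0" if "ij \<in> ?I" "c ij \<noteq> 0" for c ij
    proof -
      have "Q c \<ge> 0" unfolding Q_def by (rule set_integral_nonneg') simp
      moreover have "Q c \<noteq> 0"
      proof
        assume "Q c = 0"
        then have "pol W c p = 0" if "p \<in> refS" for p
          using set_integral_square_eq_0[of "pol W c" p] that by (simp add: Q_def continuous_on_pol)
        then show False using pol_eq_0[of W c "fst ij" "snd ij"] that by auto
      qed
      ultimately show ?thesis by simp
    qed
  qed simp
  then obtain C where C: "C > 0" "\<And>c. (\<forall>ij. ij \<notin> ?I \<longrightarrow> c ij = 0) \<Longrightarrow> \<forall>ij\<in>?I. (c ij)\<^sup>2 \<le> C * Q c"
    by metis
  have "(c ij)\<^sup>2 \<le> C * Q c" if "ij \<in> ?I" for c ij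
  proof -
    \<comment> \<open>\<open>c\<close> is arbitrary outside the index square, whereas coercivity
      wants zeros there; truncation leaves the polynomial unchanged.\<close>
    define d where "d = (\<lambda>ij. if ij \<in> ?I then c ij else 0)"
    have "pol W d = pol W c" by (auto simp: pol_def d_def fun_eq_iff intro!: sum.cong)
    moreover have "(d ij)\<^sup>2 \<le> C * Q d" using C(2)[of d] that d_def by (metis (no_types, lifting))
    moreover have "d ij = c ij" using that by (simp only: d_def if_True)
    ultimately show ?thesis by (simp add: Q_def)
  qed
  then show ?thesis using C(1) by (auto simp: Q_def)
qed

text \<open>The derivative of order \<open>k\<close> of the monomial of degree \<open>i\<close>.
  Where \<open>i - 1\<close> truncates, the factor \<open>real i\<close> is 0, so no case
  distinction arises.\<close>

fun dmon :: "nat \<Rightarrow> nat \<Rightarrow> real \<Rightarrow> real" where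
  "dmon 0 i x = x ^ i"
| "dmon (Suc k) i x = real i * dmon k (i - 1) x"

lemma dmon_has_derivative: "(dmon k i has_real_derivative dmon (Suc k) i x) (at x within A)"
proof (induction k arbitrary: i)
  case 0
  have "((\<lambda>x. x ^ i) has_real_derivative real i * x ^ (i - 1)) (at x within A)"
    by (auto intro!: derivative_eq_intros)
  then show ?case by simp
next
  case (Suc k)
  from DERIV_cmult[OF Suc, of "real i" "i - 1"] show ?case by simp
qed

lemma dmon_bound: "\<bar>x\<bar> \<le> 1 \<Longrightarrow> i \<le> W \<Longrightarrow> \<bar>dmon k i x\<bar> \<le> real W ^ k"
proof (induction k arbitrary: i)
  case (Suc k)
  have "real i * \<bar>dmon k (i - 1) x\<bar> \<le> real W * real W ^ k"
    using Suc.IH[of "i - 1"] Suc.prems by (intro mult_mono) auto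
  then show ?case by (simp add: abs_mult)
qed (auto simp: power_abs power_le_one)

text \<open>The partial derivative of \<open>pol W c\<close> of order \<open>k\<close> in the first
  and \<open>l\<close> in the second variable.\<close>

definition dpol :: "nat \<Rightarrow> nat \<Rightarrow> nat \<Rightarrow> (nat \<times> nat \<Rightarrow> real) \<Rightarrow> real \<times> real \<Rightarrow> real" where
  "dpol k l W c p = (\<Sum>ij\<in>{..W} \<times> {..W}. c ij * (dmon k (fst ij) (fst p) * dmon l (snd ij) (snd p)))"

lemma pol_eq_dpol: "pol W c = dpol 0 0 W c"
  by (simp add: pol_def dpol_def fun_eq_iff)

lemma dpol_has_derivative:
  "(dpol k l W c has_derivative (\<lambda>h. fst h * dpol (Suc k) l W c p + snd h * dpol k (Suc l) W c p)) (at p within T)"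
proof -
  have "((\<lambda>p. dmon k i (fst p)) has_derivative (\<lambda>h. dmon (Suc k) i (fst p) * fst h)) (at p within T)" for k i
    using has_derivative_compose[OF has_derivative_fst[OF has_derivative_ident] dmon_has_derivative[of k i "fst p" UNIV, unfolded has_field_derivative_def], of T]
    by simp
  moreover have "((\<lambda>p. dmon k i (snd p)) has_derivative (\<lambda>h. dmon (Suc k) i (snd p) * snd h)) (at p within T)" for k i
    using has_derivative_compose[OF has_derivative_snd[OF has_derivative_ident] dmon_has_derivative[of k i "snd p" UNIV, unfolded has_field_derivative_def], of T]
    by simp
  ultimately have "((\<lambda>p. c ij * (dmon k (fst ij) (fst p) * dmon l (snd ij) (snd p))) has_derivative
      (\<lambda>h. fst h * (c ij * (dmon (Suc k) (fst ij) (fst p) * dmon l (snd ij) (snd p)))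
        + snd h * (c ij * (dmon k (fst ij) (fst p) * dmon (Suc l) (snd ij) (snd p))))) (at p within T)" for ij
    by (rule has_derivative_eq_rhs[OF has_derivative_mult_right[OF has_derivative_mult]]) (simp add: fun_eq_iff algebra_simps)
  then have "((\<lambda>p. \<Sum>ij\<in>{..W} \<times> {..W}. c ij * (dmon k (fst ij) (fst p) * dmon l (snd ij) (snd p))) has_derivative
      (\<lambda>h. \<Sum>ij\<in>{..W} \<times> {..W}. fst h * (c ij * (dmon (Suc k) (fst ij) (fst p) * dmon l (snd ij) (snd p)))
        + snd h * (c ij * (dmon k (fst ij) (fst p) * dmon (Suc l) (snd ij) (snd p))))) (at p within T)"
    by (intro has_derivative_sum)
  then show ?thesis
    unfolding dpol_def[abs_def] by (simp only: sum.distrib sum_distrib_left)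
qed

lemma pdiff_dpol:
  assumes "p \<in> refSc"
  shows "pdiff refSc ex (dpol k l W c) p = dpol (Suc k) l W c p"
    and "pdiff refSc ey (dpol k l W c) p = dpol k (Suc l) W c p"
  using pdiff_eqI[OF rect_refSc assms dpol_has_derivative] by simp_all

lemma C1_dpol: "C1 refSc (dpol k l W c)"
proof -
  have d: "dpol k l W c differentiable_on T" for k l T
    using dpol_has_derivative unfolding differentiable_on_def differentiable_def by blast
  then have "continuous_on refSc (dpol k l W c)" for k l by (rule differentiable_imp_continuous_on)
  with d show ?thesis
    by (auto simp: C1_def pdiff_dpol cong: continuous_on_cong)
qed

lemma pdiff_pdiff_dpol:
  assumes "p \<in> refSc"
  shows "pdiff refSc ex (pdiff refSc ex (dpol k l W c)) p = dpol (Suc (Suc k)) l W c p"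
    "pdiff refSc ex (pdiff refSc ey (dpol k l W c)) p = dpol (Suc k) (Suc l) W c p"
    "pdiff refSc ey (pdiff refSc ex (dpol k l W c)) p = dpol (Suc k) (Suc l) W c p"
    "pdiff refSc ey (pdiff refSc ey (dpol k l W c)) p = dpol k (Suc (Suc l)) W c p"
proof -
  have "pdiff refSc b (pdiff refSc ex (dpol k l W c)) p = pdiff refSc b (dpol (Suc k) l W c) p"
    "pdiff refSc b (pdiff refSc ey (dpol k l W c)) p = pdiff refSc b (dpol k (Suc l) W c) p" for b
    by (rule pdiff_cong; simp add: pdiff_dpol assms)+
  then show "pdiff refSc ex (pdiff refSc ex (dpol k l W c)) p = dpol (Suc (Suc k)) l W c p"
    "pdiff refSc ex (pdiff refSc ey (dpol k l W c)) p = dpol (Suc k) (Suc l) W c p"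
    "pdiff refSc ey (pdiff refSc ex (dpol k l W c)) p = dpol (Suc k) (Suc l) W c p"
    "pdiff refSc ey (pdiff refSc ey (dpol k l W c)) p = dpol k (Suc (Suc l)) W c p"
    by (simp_all add: pdiff_dpol assms)
qed

lemma dpol_bound:
  assumes "p \<in> refSc" shows "\<bar>dpol k l W c p\<bar> \<le> real W ^ (k + l) * (\<Sum>ij\<in>{..W} \<times> {..W}. \<bar>c ij\<bar>)"
proof -
  have "\<bar>c ij * (dmon k (fst ij) (fst p) * dmon l (snd ij) (snd p))\<bar> \<le> real W ^ (k + l) * \<bar>c ij\<bar>" if "ij \<in> {..W} \<times> {..W}" for ij
  proof -
    have "\<bar>dmon k (fst ij) (fst p)\<bar> * \<bar>dmon l (snd ij) (snd p)\<bar> \<le> real W ^ k * real W ^ l"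
      using assms that by (intro mult_mono dmon_bound) (auto simp: refSc_def)
    then have "\<bar>c ij\<bar> * (\<bar>dmon k (fst ij) (fst p)\<bar> * \<bar>dmon l (snd ij) (snd p)\<bar>) \<le> \<bar>c ij\<bar> * (real W ^ k * real W ^ l)"
      by (intro mult_left_mono) auto
    then show ?thesis by (simp add: abs_mult power_add mult_ac)
  qed
  then show ?thesis
    unfolding dpol_def sum_distrib_left by (intro order_trans[OF sum_abs] sum_mono) auto
qed

lemma poly_sep_mono:
  assumes "f \<in> poly_sep W" "W \<le> W'" shows "f \<in> poly_sep W'"
proof -
  obtain c where f: "f = pol W c" using assms(1) poly_sep_pol by blast
  have "f = pol W' (\<lambda>ij. if ij \<in> {..W} \<times> {..W} then c ij else 0)"
  proof
    fix p
    have "{..W} \<times> {..W} \<subseteq> {..W'} \<times> {..W'}" using assms(2) by auto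
    then show "f p = pol W' (\<lambda>ij. if ij \<in> {..W} \<times> {..W} then c ij else 0) p"
      unfolding f pol_def by (intro sum.mono_neutral_cong_left) auto
  qed
  then show ?thesis using poly_sep_pol by blast
qed

lemma poly_sep_C1:
  assumes "f \<in> poly_sep W"
  shows "C1 refSc f" and "b \<in> Basis \<Longrightarrow> C1 refSc (pdiff refSc b f)"
proof -
  obtain c where f: "f = dpol 0 0 W c" using assms poly_sep_pol pol_eq_dpol by metis
  show "C1 refSc f" unfolding f by (rule C1_dpol)
  show "C1 refSc (pdiff refSc b f)" if "b \<in> Basis"
    using that unfolding f
    by (auto simp: Basis_prod_def pdiff_dpol intro: C1_cong[OF _ C1_dpol, of "Suc 0" 0] C1_cong[OF _ C1_dpol, of 0 "Suc 0"])
qed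

text \<open>An inverse inequality whose constant depends on the degree only: the L2 norm bounds the
  coefficients, and these bound all derivatives up to order two at every point of the closed
  square.\<close>

lemma poly_sep_bounds:
  obtains C where "C \<ge> 1" and "\<And>f p b b'. \<lbrakk>f \<in> poly_sep W; p \<in> refSc; b \<in> Basis; b' \<in> Basis\<rbrakk> \<Longrightarrow>
     (f p)\<^sup>2 \<le> C * (LINT p:refS|lborel. (f p)\<^sup>2) \<and>
     (pdiff refSc b f p)\<^sup>2 \<le> C * (LINT p:refS|lborel. (f p)\<^sup>2) \<and>
     (pdiff refSc b (pdiff refSc b' f) p)\<^sup>2 \<le> C * (LINT p:refS|lborel. (f p)\<^sup>2)"
proof -
  let ?I = "{..W} \<times> {..W}"
  obtain C0 where C0: "C0 > 0" "\<And>c ij. ij \<in> ?I \<Longrightarrow> (c ij)\<^sup>2 \<le> C0 * (LINT p:refS|lborel. (pol W c p)\<^sup>2)"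
    using pol_coefficients_bound[of W] by blast
  \<comment> \<open>The maximum with 1 lets \<open>V\<close> dominate \<open>W ^ (k + l)\<close> for
    all orders up to two, also for \<open>W = 0\<close>.\<close>
  define V where "V = real (max 1 W) ^ 2"
  define C where "C = max 1 (V\<^sup>2 * (real (card ?I) * (real (card ?I) * C0)))"
  have *: "(dpol k l W c p)\<^sup>2 \<le> C * (LINT p:refS|lborel. (pol W c p)\<^sup>2)" if "p \<in> refSc" "k + l \<le> 2" for k l c p
  proof -
    let ?Q = "LINT p:refS|lborel. (pol W c p)\<^sup>2"
    have Q: "?Q \<ge> 0" by (rule set_integral_nonneg') simp
    have "(\<Sum>ij\<in>?I. \<bar>c ij\<bar>)\<^sup>2 \<le> real (card ?I) * (\<Sum>ij\<in>?I. \<bar>c ij\<bar>\<^sup>2)"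
      using Convex.Cauchy_Schwarz_ineq_sum[where a="\<lambda>_. 1" and b="\<lambda>ij. \<bar>c ij\<bar>" and I="?I"] by simp
    also have "(\<Sum>ij\<in>?I. \<bar>c ij\<bar>\<^sup>2) \<le> (\<Sum>ij\<in>?I. C0 * ?Q)"
      by (intro sum_mono) (use C0(2) in simp)
    finally have 1: "(\<Sum>ij\<in>?I. \<bar>c ij\<bar>)\<^sup>2 \<le> real (card ?I) * (real (card ?I) * C0) * ?Q"
      by (simp add: mult_left_mono mult.assoc)
    have "real W ^ (k + l) \<le> real (max 1 W) ^ (k + l)" by (intro power_mono) auto
    also have "\<dots> \<le> V" unfolding V_def using that by (intro power_increasing) auto
    finally have "\<bar>dpol k l W c p\<bar> \<le> V * (\<Sum>ij\<in>?I. \<bar>c ij\<bar>)"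
      using dpol_bound[OF that(1), of k l W c] by (meson mult_right_mono order_trans sum_nonneg abs_ge_zero)
    then have "(dpol k l W c p)\<^sup>2 \<le> V\<^sup>2 * (\<Sum>ij\<in>?I. \<bar>c ij\<bar>)\<^sup>2"
      by (metis abs_ge_zero power2_abs power_mono power_mult_distrib)
    also have "\<dots> \<le> V\<^sup>2 * (real (card ?I) * (real (card ?I) * C0) * ?Q)"
      using 1 by (intro mult_left_mono) auto
    also have "\<dots> \<le> C * ?Q" unfolding C_def mult.assoc[symmetric] using Q by (intro mult_right_mono) auto
    finally show ?thesis .
  qed
  show ?thesis
  proof (rule that[of C])
    show "C \<ge> 1" by (simp add: C_def)
  next
    fix f p and b b' :: "real \<times> real" assume f: "f \<in> poly_sep W" and p: "p \<in> refSc" and b: "b \<in> Basis" "b' \<in> Basis"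
    obtain c where c: "f = pol W c" using f poly_sep_pol by metis
    show "(f p)\<^sup>2 \<le> C * (LINT p:refS|lborel. (f p)\<^sup>2) \<and>
     (pdiff refSc b f p)\<^sup>2 \<le> C * (LINT p:refS|lborel. (f p)\<^sup>2) \<and>
     (pdiff refSc b (pdiff refSc b' f) p)\<^sup>2 \<le> C * (LINT p:refS|lborel. (f p)\<^sup>2)"
      using b *[OF p, of 0 0 c] *[OF p, of 1 0 c] *[OF p, of 0 1 c] *[OF p, of 2 0 c] *[OF p, of 1 1 c] *[OF p, of 0 2 c]
      unfolding c
      by (auto simp: Basis_prod_def pdiff_dpol[OF p] pdiff_pdiff_dpol[OF p] pol_eq_dpol numeral_2_eq_2)
  qed
qed

section \<open>Green's identity on one element\<close>

text \<open>Positive where \<open>ref_side\<close> runs counterclockwise around the square, negative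
  where it runs clockwise. This is a sign of tangents, unlike \<open>side_normal\<close>
  below.\<close>

fun side_sign :: "side \<Rightarrow> real" where
  "side_sign West = -1" | "side_sign East = 1" | "side_sign South = 1" | "side_sign North = -1"

lemma UNIV_side: "(UNIV :: side set) = {West, East, South, North}"
  by (auto intro: side.exhaust)

text \<open>One element without indices. Every estimate derived here has a constant built from
  \<open>B\<close>, hence is uniform over elements and decompositions.\<close>

locale element =
  fixes R :: "(real \<times> real) set" and M :: "real \<times> real \<Rightarrow> real \<times> real" and B :: real
  assumes rect_R: "rect R" and bij_M: "bij_betw M refSc R"
    and analytic_M: "analytic2_on (fst \<circ> M) refSc" "analytic2_on (snd \<circ> M) refSc"
    and analytic_inv: "analytic2_on (fst \<circ> inv_into refSc M) R" "analytic2_on (snd \<circ> inv_into refSc M) R"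
    and B_pos: "B > 0"
    and d1_M: "\<And>p b. p \<in> refSc \<Longrightarrow> b \<in> Basis \<Longrightarrow> \<bar>pdiff refSc b (fst \<circ> M) p\<bar> \<le> B"
      "\<And>p b. p \<in> refSc \<Longrightarrow> b \<in> Basis \<Longrightarrow> \<bar>pdiff refSc b (snd \<circ> M) p\<bar> \<le> B"
    and d2_M: "\<And>p b b'. p \<in> refSc \<Longrightarrow> b \<in> Basis \<Longrightarrow> b' \<in> Basis \<Longrightarrow> \<bar>pdiff refSc b (pdiff refSc b' (fst \<circ> M)) p\<bar> \<le> B"
      "\<And>p b b'. p \<in> refSc \<Longrightarrow> b \<in> Basis \<Longrightarrow> b' \<in> Basis \<Longrightarrow> \<bar>pdiff refSc b (pdiff refSc b' (snd \<circ> M)) p\<bar> \<le> B"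
    and jac_bound: "\<And>p. p \<in> refSc \<Longrightarrow> pdiff refSc ex (fst \<circ> M) p * pdiff refSc ey (snd \<circ> M) p
       - pdiff refSc ey (fst \<circ> M) p * pdiff refSc ex (snd \<circ> M) p \<ge> 1 / B"
begin

abbreviation "pd \<equiv> pdiff refSc"
definition "X = fst \<circ> M"
definition "Y = snd \<circ> M"

definition J :: "real \<times> real \<Rightarrow> real" where
  "J p = pd ex X p * pd ey Y p - pd ey X p * pd ex Y p"

text \<open>Cramer's rule for the physical gradient in terms of the reference gradient.\<close>

definition G1 :: "(real \<times> real \<Rightarrow> real) \<Rightarrow> real \<times> real \<Rightarrow> real" where
  "G1 H p = (pd ex H p * pd ey Y p - pd ey H p * pd ex Y p) / J p"

definition G2 :: "(real \<times> real \<Rightarrow> real) \<Rightarrow> real \<times> real \<Rightarrow> real" where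
  "G2 H p = (pd ey H p * pd ex X p - pd ex H p * pd ey X p) / J p"

lemma basis [simp]: "ex \<in> Basis" "ey \<in> Basis"
  by (auto simp: Basis_prod_def)

lemma C1_XY: "C1 refSc X" "C1 refSc Y" "b \<in> Basis \<Longrightarrow> C1 refSc (pd b X)" "b \<in> Basis \<Longrightarrow> C1 refSc (pd b Y)"
  unfolding X_def Y_def
  by (intro analytic2_on_C1 analytic2_on_pdiff rect_refSc analytic_M; assumption)+

lemma mixed_partials_commute: "p \<in> refSc \<Longrightarrow> pd ey (pd ex X) p = pd ex (pd ey X) p"
  "p \<in> refSc \<Longrightarrow> pd ey (pd ex Y) p = pd ex (pd ey Y) p"
  unfolding X_def Y_def by (intro analytic2_on_pdiff_commute rect_refSc analytic_M; assumption)+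

lemma J_bound: "p \<in> refSc \<Longrightarrow> J p \<ge> 1 / B"
  using jac_bound by (simp add: J_def X_def Y_def)

lemma J_pos: "p \<in> refSc \<Longrightarrow> J p > 0"
  using J_bound[of p] B_pos by (meson divide_pos_pos less_le_trans zero_less_one)

lemma J_nz: "p \<in> refSc \<Longrightarrow> J p \<noteq> 0"
  using J_pos by fastforce

lemma C1_J: "C1 refSc J"
  unfolding J_def[abs_def] by (intro C1_diff C1_mult rect_refSc C1_XY basis)

lemma C1_G:
  assumes "C1 refSc (pd ex H)" "C1 refSc (pd ey H)"
  shows "C1 refSc (G1 H)" "C1 refSc (G2 H)"
  unfolding G1_def[abs_def] G2_def[abs_def]
  by (intro C1_divide C1_diff C1_mult rect_refSc C1_XY C1_J assms basis J_nz; assumption)+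

lemma M_in: "p \<in> refSc \<Longrightarrow> M p \<in> R"
  using bij_M by (auto simp: bij_betw_def)

lemma M_has_derivative:
  assumes "p \<in> refSc"
  shows "(M has_derivative (\<lambda>h. (fst h * pd ex X p + snd h * pd ey X p, fst h * pd ex Y p + snd h * pd ey Y p)))
    (at p within refSc)"
proof -
  have "((\<lambda>q. (X q, Y q)) has_derivative (\<lambda>h. (fst h * pd ex X p + snd h * pd ey X p, fst h * pd ex Y p + snd h * pd ey Y p)))
    (at p within refSc)"
    by (intro has_derivative_Pair has_derivative_pdiff C1_differentiable[OF _ assms] C1_XY)
  then show ?thesis by (simp add: X_def Y_def)
qed

text \<open>Analyticity of the inverse map serves to show that \<open>h\<close> is differentiable.
  Its derivative is then found without differentiating the inverse, by the chain rule for
  \<open>H\<close> as \<open>h\<close> after \<open>M\<close> and by solving the resulting 2 by 2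
  system.\<close>

lemma pulled_gradient:
  assumes hH: "\<And>p. p \<in> refSc \<Longrightarrow> h (M p) = H p" and H: "C1 refSc H" and p: "p \<in> refSc"
  shows "h differentiable (at (M p) within R)" "pdiff R ex h (M p) = G1 H p" "pdiff R ey h (M p) = G2 H p"
    and "pd ex H p = G1 H p * pd ex X p + G2 H p * pd ex Y p"
    and "pd ey H p = G1 H p * pd ey X p + G2 H p * pd ey Y p"
proof -
  let ?N = "inv_into refSc M"
  have N: "?N q \<in> refSc" "M (?N q) = q" if "q \<in> R" for q
    using bij_M that by (auto simp: bij_betw_def inv_into_into f_inv_into_f)
  have NM: "?N (M p) = p" using bij_M p by (auto simp: bij_betw_def)
  obtain D1 where D1: "(fst \<circ> ?N has_derivative D1) (at (M p) within R)"
    using analytic2_on_differentiable[OF rect_R analytic_inv(1)] M_in[OF p]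
    unfolding differentiable_on_def differentiable_def by blast
  obtain D2 where D2: "(snd \<circ> ?N has_derivative D2) (at (M p) within R)"
    using analytic2_on_differentiable[OF rect_R analytic_inv(2)] M_in[OF p]
    unfolding differentiable_on_def differentiable_def by blast
  obtain N' where N': "(?N has_derivative N') (at (M p) within R)"
    using has_derivative_Pair[OF D1 D2] by simp
  have "(H has_derivative (\<lambda>h. fst h * pd ex H p + snd h * pd ey H p)) (at p within ?N ` R)"
    using has_derivative_pdiff[OF C1_differentiable[OF H p]] by (rule has_derivative_subset) (use N in auto)
  then have "((H \<circ> ?N) has_derivative (\<lambda>h. fst h * pd ex H p + snd h * pd ey H p) \<circ> N') (at (M p) within R)"
    using N' NM by (intro diff_chain_within) auto
  then have "(h has_derivative (\<lambda>h. fst h * pd ex H p + snd h * pd ey H p) \<circ> N') (at (M p) within R)"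
    by (rule has_derivative_transform[rotated 2]) (use M_in[OF p] in \<open>simp, metis N hH o_apply\<close>)
  then show d: "h differentiable (at (M p) within R)" by (auto simp: differentiable_def)
  let ?a = "pdiff R ex h (M p)" and ?b = "pdiff R ey h (M p)"
  have "(h has_derivative (\<lambda>v. fst v * ?a + snd v * ?b)) (at (M p) within M ` refSc)"
    using has_derivative_pdiff[OF d] by (rule has_derivative_subset) (use M_in in auto)
  from diff_chain_within[OF M_has_derivative[OF p] this]
  have "(H has_derivative (\<lambda>v. fst v * ?a + snd v * ?b) \<circ>
     (\<lambda>h. (fst h * pd ex X p + snd h * pd ey X p, fst h * pd ex Y p + snd h * pd ey Y p))) (at p within refSc)"
    by (rule has_derivative_transform[rotated 2]) (use p hH in auto)
  from pdiff_eqI[OF rect_refSc p this, of ex] pdiff_eqI[OF rect_refSc p this, of ey]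
  have e: "pd ex H p = ?a * pd ex X p + ?b * pd ex Y p" "pd ey H p = ?a * pd ey X p + ?b * pd ey Y p"
    by (simp_all add: mult.commute)
  \<comment> \<open>Elimination in the system \<open>e\<close>: the other unknown cancels and the
    determinant \<open>J p\<close> remains as factor.\<close>
  have "pd ex H p * pd ey Y p - pd ey H p * pd ex Y p = ?a * J p"
    unfolding e J_def by algebra
  then show a: "?a = G1 H p" using J_nz[OF p] by (simp add: G1_def)
  have "pd ey H p * pd ex X p - pd ex H p * pd ey X p = ?b * J p"
    unfolding e J_def by algebra
  then show b: "?b = G2 H p" using J_nz[OF p] by (simp add: G2_def)
  show "pd ex H p = G1 H p * pd ex X p + G2 H p * pd ex Y p" "pd ey H p = G1 H p * pd ey X p + G2 H p * pd ey Y p"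
    using e unfolding a b by auto
qed

text \<open>The first physical derivatives pull back to \<open>G1 U\<close> and \<open>G2 U\<close>,
  so \<open>pulled_gradient\<close> can be applied to them once more.\<close>

lemma pulled_laplacian:
  assumes "\<And>p. p \<in> refSc \<Longrightarrow> u (M p) = U p" "C1 refSc U" "C1 refSc (pd ex U)" "C1 refSc (pd ey U)" "p \<in> refSc"
  shows "opL eps a R u (M p) = - eps\<^sup>2 * (G1 (G1 U) p + G2 (G2 U) p) + a * U p"
proof -
  note g = pulled_gradient[OF assms(1,2)]
  have "pdiff R ex (pdiff R ex u) (M p) = G1 (G1 U) p"
    by (rule pulled_gradient(2)) (use g(2) C1_G[OF assms(3,4)] assms(5) in auto)
  moreover have "pdiff R ey (pdiff R ey u) (M p) = G2 (G2 U) p"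
    by (rule pulled_gradient(3)) (use g(3) C1_G[OF assms(3,4)] assms(5) in auto)
  ultimately show ?thesis using assms(1,5) by (simp add: opL_def Basis_prod_def)
qed

text \<open>The Piola transform of the physical gradient: \<open>J\<close> times the inverse
  Jacobian matrix. Its entries are cofactors and contain no quotient.\<close>

definition "P1 U p = pd ey Y p * G1 U p - pd ey X p * G2 U p"
definition "P2 U p = pd ex X p * G2 U p - pd ex Y p * G1 U p"

lemma C1_P:
  assumes "C1 refSc (pd ex U)" "C1 refSc (pd ey U)"
  shows "C1 refSc (P1 U)" "C1 refSc (P2 U)"
  unfolding P1_def[abs_def] P2_def[abs_def]
  by (intro C1_diff C1_mult rect_refSc C1_XY C1_G assms basis)+

text \<open>The Piola identity: the pulled-back flux has divergence \<open>J\<close> times the physical divergence, because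
  the mixed_partials_commute derivatives of the element map cancel.\<close>

lemma piola:
  assumes "C1 refSc (pd ex U)" "C1 refSc (pd ey U)" "p \<in> refSc"
  shows "pd ex (P1 U) p + pd ey (P2 U) p = J p * (G1 (G1 U) p + G2 (G2 U) p)"
proof -
  note d = C1_differentiable[OF _ assms(3)]
  note G = C1_G[OF assms(1,2)]
  have 1: "pd ex (P1 U) p = (pd ey Y p * pd ex (G1 U) p + pd ex (pd ey Y) p * G1 U p)
       - (pd ey X p * pd ex (G2 U) p + pd ex (pd ey X) p * G2 U p)"
    unfolding P1_def[abs_def] using d[OF G(1)] d[OF G(2)] d[OF C1_XY(3)] d[OF C1_XY(4)]
    by (simp add: pdiff_diff pdiff_mult rect_refSc assms(3))
  have 2: "pd ey (P2 U) p = (pd ex X p * pd ey (G2 U) p + pd ey (pd ex X) p * G2 U p)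
       - (pd ex Y p * pd ey (G1 U) p + pd ey (pd ex Y) p * G1 U p)"
    unfolding P2_def[abs_def] using d[OF G(1)] d[OF G(2)] d[OF C1_XY(3)] d[OF C1_XY(4)]
    by (simp add: pdiff_diff pdiff_mult rect_refSc assms(3))
  have "J p * G1 (G1 U) p = pd ex (G1 U) p * pd ey Y p - pd ey (G1 U) p * pd ex Y p"
    "J p * G2 (G2 U) p = pd ey (G2 U) p * pd ex X p - pd ex (G2 U) p * pd ey X p"
    using J_nz[OF assms(3)] by (simp_all add: G1_def[of "G1 U"] G2_def[of "G2 U"])
  then show ?thesis
    unfolding 1 2 mixed_partials_commute[OF assms(3)] distrib_left by (simp add: mult_ac)
qed

text \<open>The reference gradient carries the transposed Jacobian matrix and the flux carries
  \<open>J\<close> times the inverse; in the inner product the two matrices cancel.\<close>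

lemma gradient_flux:
  assumes "C1 refSc U" "p \<in> refSc"
  shows "pd ex U p * P1 U p + pd ey U p * P2 U p = J p * ((G1 U p)\<^sup>2 + (G2 U p)\<^sup>2)"
proof -
  \<comment> \<open>A physical function with pullback \<open>U\<close> is supplied so that the chain
    rule formulas of \<open>pulled_gradient\<close> become available for \<open>U\<close>.\<close>
  have h: "(U \<circ> inv_into refSc M) (M p) = U p" if "p \<in> refSc" for p
    using bij_M that by (auto simp: bij_betw_def)
  have e: "pd ex U p = G1 U p * pd ex X p + G2 U p * pd ex Y p"
    "pd ey U p = G1 U p * pd ey X p + G2 U p * pd ey Y p"
    by (rule pulled_gradient(4)[OF h assms]; assumption) (rule pulled_gradient(5)[OF h assms]; assumption)
  show ?thesis unfolding P1_def P2_def e J_def by algebra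
qed

text \<open>The divergence theorem for \<open>U\<close> times the Piola flux. On each side this flux
  involves derivatives of the map along that side only: the rotated tangent, which is the physical
  normal times the speed.\<close>

theorem green:
  assumes "C1 refSc U" "C1 refSc (pd ex U)" "C1 refSc (pd ey U)"
  shows "(LINT p:refS|lborel. U p * (J p * (G1 (G1 U) p + G2 (G2 U) p)))
     + (LINT p:refS|lborel. J p * ((G1 U p)\<^sup>2 + (G2 U p)\<^sup>2))
     = (\<Sum>s\<in>UNIV. LINT t:refI|lborel. U (ref_side s t) * (side_sign s *
         (pd (side_dir s) Y (ref_side s t) * G1 U (ref_side s t) - pd (side_dir s) X (ref_side s t) * G2 U (ref_side s t))))"
proof -
  note P = C1_P[OF assms(2,3)] and G = C1_G[OF assms(2,3)]
  note UP = C1_mult[OF rect_refSc assms(1) P(1)] C1_mult[OF rect_refSc assms(1) P(2)]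
  have GG: "continuous_on refSc (G1 (G1 U))" "continuous_on refSc (G2 (G2 U))"
    unfolding G1_def[of "G1 U", abs_def] G2_def[of "G2 U", abs_def]
    by (intro continuous_intros C1_continuous_pdiff C1_continuous C1_XY basis C1_J G J_nz ballI; assumption)+
  have i1: "set_integrable lborel refS (\<lambda>p. U p * (J p * (G1 (G1 U) p + G2 (G2 U) p)))"
    by (intro set_integrable_refS continuous_intros GG C1_continuous assms(1) C1_J)
  have i2: "set_integrable lborel refS (\<lambda>p. J p * ((G1 U p)\<^sup>2 + (G2 U p)\<^sup>2))"
    by (intro set_integrable_refS continuous_intros C1_continuous C1_J G)
  have "(LINT p:refS|lborel. U p * (J p * (G1 (G1 U) p + G2 (G2 U) p)))
     + (LINT p:refS|lborel. J p * ((G1 U p)\<^sup>2 + (G2 U p)\<^sup>2))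
     = (LINT p:refS|lborel. U p * (J p * (G1 (G1 U) p + G2 (G2 U) p)) + J p * ((G1 U p)\<^sup>2 + (G2 U p)\<^sup>2))"
    using set_integral_add(2)[OF i1 i2] by simp
  also have "\<dots> = (LINT p:refS|lborel. pd ex (\<lambda>p. U p * P1 U p) p + pd ey (\<lambda>p. U p * P2 U p) p)"
  proof (rule set_lebesgue_integral_cong, simp add: refS_measurable, intro allI impI)
    fix p assume "p \<in> refS"
    then have p: "p \<in> refSc" using refS_subset by auto
    note d = C1_differentiable[OF _ p]
    have "pd ex (\<lambda>p. U p * P1 U p) p + pd ey (\<lambda>p. U p * P2 U p) p
      = U p * (pd ex (P1 U) p + pd ey (P2 U) p) + (pd ex U p * P1 U p + pd ey U p * P2 U p)"
      using pdiff_mult[OF rect_refSc p d[OF assms(1)] d[OF P(1)], of ex] pdiff_mult[OF rect_refSc p d[OF assms(1)] d[OF P(2)], of ey]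
      by (simp add: algebra_simps)
    then show "U p * (J p * (G1 (G1 U) p + G2 (G2 U) p)) + J p * ((G1 U p)\<^sup>2 + (G2 U p)\<^sup>2)
      = pd ex (\<lambda>p. U p * P1 U p) p + pd ey (\<lambda>p. U p * P2 U p) p"
      using piola[OF assms(2,3) p] gradient_flux[OF assms(1) p] by simp
  qed
  also have "\<dots> = (LINT t:refI|lborel. U (ref_side East t) * P1 U (ref_side East t)) - (LINT t:refI|lborel. U (ref_side West t) * P1 U (ref_side West t))
    + (LINT t:refI|lborel. U (ref_side North t) * P2 U (ref_side North t)) - (LINT t:refI|lborel. U (ref_side South t) * P2 U (ref_side South t))"
    by (rule refS_divergence[OF UP])
  also have "\<dots> = (\<Sum>s\<in>UNIV. LINT t:refI|lborel. U (ref_side s t) * (side_sign s *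
         (pd (side_dir s) Y (ref_side s t) * G1 U (ref_side s t) - pd (side_dir s) X (ref_side s t) * G2 U (ref_side s t))))"
  proof -
    have neg: "- (LINT t:refI|lborel. f t) = (LINT t:refI|lborel. - f t)" for f :: "real \<Rightarrow> real"
      by (simp add: set_lebesgue_integral_def)
    show ?thesis
      unfolding UNIV_side by (simp add: P1_def P2_def neg diff_conv_add_uminus[of "_ :: real" "LINT t:refI|lborel. _ t"] del: add_uminus_conv_diff) (simp add: algebra_simps)
  qed
  finally show ?thesis .
qed

end

section \<open>Edges and derivative bounds of one element\<close>

lemma lipschitz_on_side:
  assumes "C1 refSc f" "\<And>p b. p \<in> refSc \<Longrightarrow> b \<in> Basis \<Longrightarrow> \<bar>pdiff refSc b f p\<bar> \<le> L" "t \<in> {-1..1}" "t' \<in> {-1..1}"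
  shows "\<bar>f (ref_side s t) - f (ref_side s t')\<bar> \<le> L * \<bar>t - t'\<bar>"
proof -
  have "norm (f (ref_side s t) - f (ref_side s t')) \<le> L * norm (t - t')"
  proof (rule differentiable_bound[where S="{-1..1}" and f'="\<lambda>t h. h *\<^sub>R pdiff refSc (side_dir s) f (ref_side s t)"])
    fix r :: real assume r: "r \<in> {-1..1}"
    show "((\<lambda>t. f (ref_side s t)) has_derivative (\<lambda>h. h *\<^sub>R pdiff refSc (side_dir s) f (ref_side s r))) (at r within {-1..1})"
      using has_vector_derivative_ref_side[OF C1_differentiable[OF assms(1) ref_side_in_refSc[OF r]]]
      by (simp add: has_vector_derivative_def)
    have "side_dir s \<in> Basis" by (cases s) (auto simp: Basis_prod_def)
    then have "\<bar>pdiff refSc (side_dir s) f (ref_side s r)\<bar> \<le> L"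
      using assms(2) ref_side_in_refSc[OF r] by blast
    then show "onorm (\<lambda>h. h *\<^sub>R pdiff refSc (side_dir s) f (ref_side s r)) \<le> L"
      by (intro onorm_le) (simp add: abs_mult mult.commute[of L] mult_left_mono)
  qed (use assms(3,4) in auto)
  then show ?thesis by simp
qed

fun outward_diff :: "side \<Rightarrow> (real \<times> real \<Rightarrow> real) \<Rightarrow> real \<times> real \<Rightarrow> real" where
  "outward_diff West f p = - pdiff refSc ex f p"
| "outward_diff East f p = pdiff refSc ex f p"
| "outward_diff South f p = - pdiff refSc ey f p"
| "outward_diff North f p = pdiff refSc ey f p"

section \<open>Signs of derivatives at extreme values on the sides\<close>

lemma right_endpoint_derivative_nonneg:
  fixes F :: "real \<Rightarrow> real"
  assumes "(F has_vector_derivative l) (at 1 within {-1..1})" "\<And>r. r \<in> {-1..1} \<Longrightarrow> F r \<le> F 1"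
  shows "l \<ge> 0"
proof (rule ccontr)
  assume "\<not> l \<ge> 0"
  then have "l < 0" by simp
  from has_real_derivative_neg_dec_left[OF _ this] obtain d where d: "d > 0"
    "\<forall>h>0. 1 - h \<in> {-1..1} \<longrightarrow> h < d \<longrightarrow> F 1 < F (1 - h)"
    using assms(1) has_real_derivative_iff_has_vector_derivative by blast
  define e where "e = min (d/2) 1"
  have e: "0 < e" "e < d" "e \<le> 1" using d(1) by (auto simp: e_def)
  then have "F 1 < F (1 - e)" using d(2) by auto
  then show False using assms(2)[of "1 - e"] e by auto
qed

lemma left_endpoint_derivative_nonpos:
  fixes F :: "real \<Rightarrow> real"
  assumes "(F has_vector_derivative l) (at (-1) within {-1..1})" "\<And>r. r \<in> {-1..1} \<Longrightarrow> F r \<le> F (-1)"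
  shows "l \<le> 0"
proof (rule ccontr)
  assume "\<not> l \<le> 0"
  then have "l > 0" by simp
  from has_real_derivative_pos_inc_right[OF _ this] obtain d where d: "d > 0"
    "\<forall>h>0. -1 + h \<in> {-1..1} \<longrightarrow> h < d \<longrightarrow> F (-1) < F (-1 + h)"
    using assms(1) has_real_derivative_iff_has_vector_derivative by blast
  define e where "e = min (d/2) 1"
  have e: "0 < e" "e < d" "e \<le> 1" using d(1) by (auto simp: e_def)
  then have "F (-1) < F (-1 + e)" using d(2) by auto
  then show False using assms(2)[of "-1 + e"] e by auto
qed

text \<open>The factor \<open>k\<close> covers maxima and minima together. It will be used with the
  coordinates of the element map, which are extreme on the sides mapped to physical sides.\<close>

lemma outward_diff_nonneg:
  assumes "C1 refSc f" "t \<in> {-1..1}" "\<And>p. p \<in> refSc \<Longrightarrow> k * f p \<le> k * f (ref_side s t)"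
  shows "k * outward_diff s f (ref_side s t) \<ge> 0"
proof -
  define F where "F = (\<lambda>r. k * f (case s of West \<Rightarrow> (r, t) | East \<Rightarrow> (r, t) | South \<Rightarrow> (t, r) | North \<Rightarrow> (t, r)))"
  define d where "d = (case s of West \<Rightarrow> ex | East \<Rightarrow> ex | South \<Rightarrow> ey | North \<Rightarrow> ey)"
  have F: "(F has_vector_derivative k * pdiff refSc d f (case s of West \<Rightarrow> (r, t) | East \<Rightarrow> (r, t) | South \<Rightarrow> (t, r) | North \<Rightarrow> (t, r)))
      (at r within {-1..1})" if r: "r \<in> {-1..1}" for r
  proof -
    let ?\<gamma> = "\<lambda>r. case s of West \<Rightarrow> (r, t) | East \<Rightarrow> (r, t) | South \<Rightarrow> (t, r) | North \<Rightarrow> (t, r)"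
    have sub: "?\<gamma> ` {-1..1} \<subseteq> refSc" using assms(2) by (cases s) (auto simp: refSc_def)
    have "(?\<gamma> has_vector_derivative d) (at r within {-1..1})"
      unfolding has_vector_derivative_def d_def
      by (cases s) (auto intro!: derivative_eq_intros simp: fun_eq_iff)
    moreover have "?\<gamma> r \<in> refSc" using sub r by blast
    ultimately have "((\<lambda>r. f (?\<gamma> r)) has_vector_derivative pdiff refSc d f (?\<gamma> r)) (at r within {-1..1})"
      using has_vector_derivative_line[OF C1_differentiable[OF assms(1)] _ sub, of r d]
      by (cases s) (auto simp: d_def)
    from has_vector_derivative_mult_right[OF this, of k] show ?thesis by (simp add: F_def)
  qed
  have le: "F r \<le> k * f (ref_side s t)" if "r \<in> {-1..1}" for r
    unfolding F_def by (rule assms(3)) (use that assms(2) in \<open>cases s; auto simp: refSc_def\<close>)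
  show ?thesis
  proof (cases s)
    case West
    then show ?thesis using left_endpoint_derivative_nonpos[OF F[of "-1"]] le by (auto simp: F_def d_def)
  next
    case East
    then show ?thesis using right_endpoint_derivative_nonneg[OF F[of 1]] le by (auto simp: F_def d_def)
  next
    case South
    then show ?thesis using left_endpoint_derivative_nonpos[OF F[of "-1"]] le by (auto simp: F_def d_def)
  next
    case North
    then show ?thesis using right_endpoint_derivative_nonneg[OF F[of 1]] le by (auto simp: F_def d_def)
  qed
qed

lemma constant_on_side:
  assumes "C1 refSc f" "t \<in> {-1..1}" "\<And>r. r \<in> {-1..1} \<Longrightarrow> f (ref_side s r) = k"
  shows "pdiff refSc (side_dir s) f (ref_side s t) = 0"
proof -
  have "((\<lambda>r. f (ref_side s r)) has_vector_derivative 0) (at t within {-1..1})"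
    by (rule has_vector_derivative_transform[OF assms(2) _ has_vector_derivative_const[of k]]) (use assms(3) in auto)
  moreover note has_vector_derivative_ref_side[OF C1_differentiable[OF assms(1) ref_side_in_refSc[OF assms(2)]], of s]
  ultimately show ?thesis
    using vector_derivative_unique_within_closed_interval[of "-1" 1 t "\<lambda>r. f (ref_side s r)"] assms(2) by auto
qed

fun rect_side :: "real \<Rightarrow> real \<Rightarrow> real \<Rightarrow> real \<Rightarrow> side \<Rightarrow> (real \<times> real) set" where
  "rect_side a b c d West = {a} \<times> {c..d}"
| "rect_side a b c d East = {b} \<times> {c..d}"
| "rect_side a b c d South = {a..b} \<times> {c}"
| "rect_side a b c d North = {a..b} \<times> {d}"

fun side_normal :: "side \<Rightarrow> real" where
  "side_normal West = -1" | "side_normal East = 1" | "side_normal South = -1" | "side_normal North = 1"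

fun normal_dir :: "side \<Rightarrow> real \<times> real" where
  "normal_dir West = ex" | "normal_dir East = ex" | "normal_dir South = ey" | "normal_dir North = ey"

context element
begin

text \<open>The length of the tangent of the physical edge. Physical sides are parallel to an axis,
  so one of the summands is 0 there.\<close>

definition speed :: "side \<Rightarrow> real \<Rightarrow> real" where
  "speed s t = \<bar>pd (side_dir s) X (ref_side s t)\<bar> + \<bar>pd (side_dir s) Y (ref_side s t)\<bar>"

text \<open>The Jacobian in the frame of outward normal and tangent of a side;
  \<open>side_sign s\<close> is the determinant of that frame.\<close>

lemma J_outward: "J p = side_sign s * (outward_diff s X p * pd (side_dir s) Y p - pd (side_dir s) X p * outward_diff s Y p)"
  by (cases s) (auto simp: J_def algebra_simps)

text \<open>Since \<open>J > 0\<close>, element maps preserve orientation; this fixes the sign of the tangent on every physical side.\<close>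

lemma physical_flux:
  assumes R: "R = {a..b} \<times> {c..d}" and g: "M ` ref_side s ` {-1..1} = rect_side a b c d g" and t: "t \<in> {-1..1}"
  shows "side_sign s * (pd (side_dir s) Y (ref_side s t) * w1 - pd (side_dir s) X (ref_side s t) * w2)
    = side_normal g * speed s t * (if normal_dir g = ex then w1 else w2)"
proof -
  let ?p = "ref_side s t"
  have p: "?p \<in> refSc" using ref_side_in_refSc t by blast
  have XY: "X q \<in> {a..b}" "Y q \<in> {c..d}" if "q \<in> refSc" for q
    using M_in[OF that] by (auto simp: X_def Y_def R mem_Times_iff)
  have side: "(X (ref_side s r), Y (ref_side s r)) \<in> rect_side a b c d g" if "r \<in> {-1..1}" for r
    using g that by (auto simp: X_def Y_def)
  have Jp: "side_sign s * (outward_diff s X ?p * pd (side_dir s) Y ?p - pd (side_dir s) X ?p * outward_diff s Y ?p) > 0"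
    using J_pos[OF p] J_outward by metis
  have sgn: "side_sign s = 1 \<or> side_sign s = -1" by (cases s) auto
  show ?thesis
  proof (cases g)
    case West
    have x: "X (ref_side s r) = a" if "r \<in> {-1..1}" for r using side[OF that] West by simp
    have 0: "pd (side_dir s) X ?p = 0" by (rule constant_on_side[OF C1_XY(1) t x])
    have "-1 * outward_diff s X ?p \<ge> 0"
      by (rule outward_diff_nonneg[OF C1_XY(1) t]) (use XY(1) x[OF t] in auto)
    \<comment> \<open>With the tangential derivative of \<open>X\<close> equal to 0,
      \<open>J\<close> is a product of the sign, the outward derivative of \<open>X\<close> and the
      tangential derivative of \<open>Y\<close>. The second factor is not positive since
      \<open>X\<close> is minimal on this side, so \<open>J > 0\<close> decides the sign of the
      rest.\<close>
    then have "side_sign s * pd (side_dir s) Y ?p < 0"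
      using Jp unfolding 0 by (auto simp: zero_less_mult_iff mult_less_0_iff)
    then show ?thesis using sgn 0 West by (auto simp: speed_def)
  next
    case East
    have x: "X (ref_side s r) = b" if "r \<in> {-1..1}" for r using side[OF that] East by simp
    have 0: "pd (side_dir s) X ?p = 0" by (rule constant_on_side[OF C1_XY(1) t x])
    have "1 * outward_diff s X ?p \<ge> 0"
      by (rule outward_diff_nonneg[OF C1_XY(1) t]) (use XY(1) x[OF t] in auto)
    then have "side_sign s * pd (side_dir s) Y ?p > 0"
      using Jp unfolding 0 by (auto simp: zero_less_mult_iff mult_less_0_iff)
    then show ?thesis using sgn 0 East by (auto simp: speed_def)
  next
    case South
    have y: "Y (ref_side s r) = c" if "r \<in> {-1..1}" for r using side[OF that] South by simp
    have 0: "pd (side_dir s) Y ?p = 0" by (rule constant_on_side[OF C1_XY(2) t y])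
    have "-1 * outward_diff s Y ?p \<ge> 0"
      by (rule outward_diff_nonneg[OF C1_XY(2) t]) (use XY(2) y[OF t] in auto)
    then have "side_sign s * pd (side_dir s) X ?p > 0"
      using Jp unfolding 0 by (auto simp: zero_less_mult_iff mult_less_0_iff)
    then show ?thesis using sgn 0 South by (auto simp: speed_def)
  next
    case North
    have y: "Y (ref_side s r) = d" if "r \<in> {-1..1}" for r using side[OF that] North by simp
    have 0: "pd (side_dir s) Y ?p = 0" by (rule constant_on_side[OF C1_XY(2) t y])
    have "1 * outward_diff s Y ?p \<ge> 0"
      by (rule outward_diff_nonneg[OF C1_XY(2) t]) (use XY(2) y[OF t] in auto)
    then have "side_sign s * pd (side_dir s) X ?p < 0"
      using Jp unfolding 0 by (auto simp: zero_less_mult_iff mult_less_0_iff)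
    then show ?thesis using sgn 0 North by (auto simp: speed_def)
  qed
qed

section \<open>Bounds for the pulled-back derivatives in terms of \<open>B\<close>\<close>

lemma speed_bound: assumes "t \<in> {-1..1}" shows "0 \<le> speed s t" "speed s t \<le> 2 * B"
proof -
  have "side_dir s \<in> Basis" by (cases s) auto
  then show "0 \<le> speed s t" "speed s t \<le> 2 * B"
    using d1_M[OF ref_side_in_refSc[OF assms], of "side_dir s" s] by (auto simp: speed_def X_def Y_def)
qed

lemma d_XY:
  assumes "p \<in> refSc" "b \<in> Basis"
  shows "\<bar>pd b X p\<bar> \<le> B" "\<bar>pd b Y p\<bar> \<le> B"
    "b' \<in> Basis \<Longrightarrow> \<bar>pd b (pd b' X) p\<bar> \<le> B" "b' \<in> Basis \<Longrightarrow> \<bar>pd b (pd b' Y) p\<bar> \<le> B"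
  using d1_M[OF assms] d2_M[OF assms] by (auto simp: X_def Y_def)

lemma abs_mult_diff_le:
  fixes x y z w :: real
  assumes "\<bar>x\<bar> \<le> p" "\<bar>y\<bar> \<le> q" "\<bar>z\<bar> \<le> p" "\<bar>w\<bar> \<le> q"
  shows "\<bar>x * y - z * w\<bar> \<le> 2 * (p * q)"
proof -
  have "\<bar>x * y - z * w\<bar> \<le> \<bar>x\<bar> * \<bar>y\<bar> + \<bar>z\<bar> * \<bar>w\<bar>" by (metis abs_mult abs_triangle_ineq4)
  also have "\<dots> \<le> p * q + p * q" using assms by (intro add_mono mult_mono) auto
  finally show ?thesis by simp
qed

lemma J_le: "p \<in> refSc \<Longrightarrow> J p \<le> 2 * B\<^sup>2"
  using abs_mult_diff_le[OF d_XY(1)[of p ex] d_XY(2)[of p ey] d_XY(1)[of p ey] d_XY(2)[of p ex]]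
  by (simp add: J_def power2_eq_square)

lemma pd_J_bound:
  assumes p: "p \<in> refSc" and b: "b \<in> Basis" shows "\<bar>pd b J p\<bar> \<le> 4 * B\<^sup>2"
proof -
  note d = C1_differentiable[OF _ p]
  have "pd b J p = (pd ex X p * pd b (pd ey Y) p + pd b (pd ex X) p * pd ey Y p)
      - (pd ey X p * pd b (pd ex Y) p + pd b (pd ey X) p * pd ex Y p)"
    unfolding J_def[abs_def] using d[OF C1_XY(3)] d[OF C1_XY(4)]
    by (simp add: pdiff_diff pdiff_mult rect_refSc p)
  also have "\<dots> = (pd ex X p * pd b (pd ey Y) p - pd ey X p * pd b (pd ex Y) p)
      + (pd b (pd ex X) p * pd ey Y p - pd b (pd ey X) p * pd ex Y p)" by simp
  also have "\<bar>\<dots>\<bar> \<le> 2 * (B * B) + 2 * (B * B)"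
    by (intro order_trans[OF abs_triangle_ineq] add_mono abs_mult_diff_le d_XY p b basis)
  finally show ?thesis by (simp add: power2_eq_square)
qed

text \<open>A 2 by 2 determinant with rows bounded by \<open>m\<close> and \<open>B\<close> is at
  most \<open>2 * (m * B)\<close>; division by \<open>J\<close> costs another factor
  \<open>B\<close>.\<close>

lemma G_bound:
  assumes "p \<in> refSc" "\<And>b. b \<in> Basis \<Longrightarrow> \<bar>pd b H p\<bar> \<le> m"
  shows "\<bar>G1 H p\<bar> \<le> 2 * B\<^sup>2 * m" "\<bar>G2 H p\<bar> \<le> 2 * B\<^sup>2 * m"
proof -
  have m: "\<bar>pd ex H p\<bar> \<le> m" "\<bar>pd ey H p\<bar> \<le> m" using assms(2) by auto
  then have "m \<ge> 0" by linarith
  have *: "\<bar>z / J p\<bar> \<le> 2 * B\<^sup>2 * m" if "\<bar>z\<bar> \<le> 2 * (m * B)" for z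
  proof -
    have "\<bar>z / J p\<bar> = \<bar>z\<bar> * (1 / J p)" using J_pos[OF assms(1)] by (simp add: abs_divide)
    also have "\<dots> \<le> (2 * (m * B)) * B"
      using that J_bound[OF assms(1)] J_pos[OF assms(1)] B_pos \<open>m \<ge> 0\<close>
      by (intro mult_mono) (auto simp: field_simps)
    finally show ?thesis by (simp add: power2_eq_square mult_ac)
  qed
  show "\<bar>G1 H p\<bar> \<le> 2 * B\<^sup>2 * m" "\<bar>G2 H p\<bar> \<le> 2 * B\<^sup>2 * m"
    unfolding G1_def G2_def by (intro * abs_mult_diff_le m d_XY assms(1) basis)+
qed

text \<open>By the quotient rule the numerator is at most \<open>16 * B ^ 3 * m\<close>, each of its
  two products giving 8; division by the square of \<open>J\<close> contributes two more factors
  \<open>B\<close>.\<close>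

lemma pd_G_bound:
  assumes p: "p \<in> refSc" and H: "C1 refSc (pd ex H)" "C1 refSc (pd ey H)" and b: "b \<in> Basis"
    and m1: "\<And>b. b \<in> Basis \<Longrightarrow> \<bar>pd b H p\<bar> \<le> m"
    and m2: "\<And>b b'. b \<in> Basis \<Longrightarrow> b' \<in> Basis \<Longrightarrow> \<bar>pd b (pd b' H) p\<bar> \<le> m"
  shows "\<bar>pd b (G1 H) p\<bar> \<le> 16 * B ^ 5 * m" "\<bar>pd b (G2 H) p\<bar> \<le> 16 * B ^ 5 * m"
proof -
  note d = C1_differentiable[OF _ p]
  have "m \<ge> 0" using m1[of ex] by auto
  have *: "\<bar>(z' * J p - z * pd b J p) / (J p)\<^sup>2\<bar> \<le> 16 * B ^ 5 * m" if "\<bar>z\<bar> \<le> 2 * (m * B)" "\<bar>z'\<bar> \<le> 4 * (m * B)" for z z'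
  proof -
    have J: "\<bar>J p\<bar> \<le> 2 * B\<^sup>2" using J_le[OF p] J_pos[OF p] by simp
    have "\<bar>z' * J p - z * pd b J p\<bar> \<le> \<bar>z'\<bar> * \<bar>J p\<bar> + \<bar>z\<bar> * \<bar>pd b J p\<bar>" by (metis abs_mult abs_triangle_ineq4)
    also have "\<dots> \<le> 4 * (m * B) * (2 * B\<^sup>2) + 2 * (m * B) * (4 * B\<^sup>2)"
      using that J pd_J_bound[OF p b] \<open>m \<ge> 0\<close> B_pos by (intro add_mono mult_mono) auto
    finally have 1: "\<bar>z' * J p - z * pd b J p\<bar> \<le> 16 * B ^ 3 * m" by (simp add: eval_nat_numeral)
    have "1 / J p \<le> B" using J_bound[OF p] J_pos[OF p] B_pos by (auto simp: field_simps)
    then have "(1 / J p)\<^sup>2 \<le> B\<^sup>2" using J_pos[OF p] by (intro power_mono) auto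
    then have 2: "1 / (J p)\<^sup>2 \<le> B\<^sup>2" by (simp add: power_divide)
    have "\<bar>(z' * J p - z * pd b J p) / (J p)\<^sup>2\<bar> = \<bar>z' * J p - z * pd b J p\<bar> * (1 / (J p)\<^sup>2)"
      by (simp add: abs_divide)
    also have "\<dots> \<le> (16 * B ^ 3 * m) * B\<^sup>2"
      using 1 2 B_pos \<open>m \<ge> 0\<close> by (intro mult_mono) auto
    finally show ?thesis by (simp add: eval_nat_numeral mult_ac)
  qed
  have A: "pd b (\<lambda>q. f q * g q - h q * k q) p = (f p * pd b g p - h p * pd b k p) + (pd b f p * g p - pd b h p * k p)"
    if "C1 refSc f" "C1 refSc g" "C1 refSc h" "C1 refSc k" for f g h k
    using that[THEN d] by (simp add: pdiff_diff pdiff_mult rect_refSc p)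
  have A1: "\<bar>pd b (\<lambda>q. pd ex H q * pd ey Y q - pd ey H q * pd ex Y q) p\<bar> \<le> 4 * (m * B)"
    unfolding A[OF H(1) C1_XY(4)[OF basis(2)] H(2) C1_XY(4)[OF basis(1)]]
    using abs_mult_diff_le[OF m1[of ex] d_XY(4)[OF p b, of ey] m1[of ey] d_XY(4)[OF p b, of ex]]
      abs_mult_diff_le[OF m2[OF b, of ex] d_XY(2)[OF p, of ey] m2[OF b, of ey] d_XY(2)[OF p, of ex]] by simp
  have A2: "\<bar>pd b (\<lambda>q. pd ey H q * pd ex X q - pd ex H q * pd ey X q) p\<bar> \<le> 4 * (m * B)"
    unfolding A[OF H(2) C1_XY(3)[OF basis(1)] H(1) C1_XY(3)[OF basis(2)]]
    using abs_mult_diff_le[OF m1[of ey] d_XY(3)[OF p b, of ex] m1[of ex] d_XY(3)[OF p b, of ey]]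
      abs_mult_diff_le[OF m2[OF b, of ey] d_XY(1)[OF p, of ex] m2[OF b, of ex] d_XY(1)[OF p, of ey]] by simp
  have C: "C1 refSc (\<lambda>q. pd ex H q * pd ey Y q - pd ey H q * pd ex Y q)" "C1 refSc (\<lambda>q. pd ey H q * pd ex X q - pd ex H q * pd ey X q)"
    by (intro C1_diff C1_mult rect_refSc H C1_XY basis)+
  show "\<bar>pd b (G1 H) p\<bar> \<le> 16 * B ^ 5 * m"
    unfolding G1_def[abs_def] pdiff_divide[OF rect_refSc p d[OF C(1)] d[OF C1_J] J_nz[OF p]]
    by (intro * A1 abs_mult_diff_le m1 d_XY p basis)
  show "\<bar>pd b (G2 H) p\<bar> \<le> 16 * B ^ 5 * m"
    unfolding G2_def[abs_def] pdiff_divide[OF rect_refSc p d[OF C(2)] d[OF C1_J] J_nz[OF p]]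
    by (intro * A2 abs_mult_diff_le m1 d_XY p basis)
qed

end

section \<open>Norms and sums over edges\<close>

lemma norm0_sq_nonneg: "0 \<le> norm0_sq v"
  unfolding norm0_sq_def by (rule set_integral_nonneg') simp

lemma norm0_sq_le_norm_frac_sq: "norm0_sq v \<le> norm_frac_sq s v"
  unfolding norm_frac_sq_def using set_integral_nonneg'[of "refI \<times> refI"] by simp

lemma norm_frac_sq_nonneg: "0 \<le> norm_frac_sq s v"
  using norm0_sq_nonneg norm0_sq_le_norm_frac_sq order_trans by blast

lemma norm0_sq_le_norm_1frac_sq: "norm0_sq v \<le> norm_1frac_sq s v"
  unfolding norm_1frac_sq_def using norm_frac_sq_nonneg by simp

lemma norm0_sq_cong: "(\<And>t. t \<in> refI \<Longrightarrow> v t = w t) \<Longrightarrow> norm0_sq v = norm0_sq w"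
  unfolding norm0_sq_def by (rule set_lebesgue_integral_cong) (auto simp: refI_measurable)

lemma norm_frac_sq_cong:
  assumes "\<And>t. t \<in> refI \<Longrightarrow> v t = w t" shows "norm_frac_sq s v = norm_frac_sq s w"
proof -
  have "(LINT p:refI \<times> refI|lborel. (v (fst p) - v (snd p))\<^sup>2 / \<bar>fst p - snd p\<bar> powr (1 + 2 * s))
    = (LINT p:refI \<times> refI|lborel. (w (fst p) - w (snd p))\<^sup>2 / \<bar>fst p - snd p\<bar> powr (1 + 2 * s))"
    by (rule set_lebesgue_integral_cong) (auto simp: refS_measurable[unfolded refS_eq_Times] assms)
  then show ?thesis using norm0_sq_cong[OF assms] by (simp add: norm_frac_sq_def)
qed

lemma norm0_sq_le:
  assumes "\<And>t. t \<in> refI \<Longrightarrow> (v t)\<^sup>2 \<le> m" "m \<ge> 0" shows "norm0_sq v \<le> 2 * m"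
  unfolding norm0_sq_def
  using set_integral_le_bound[of refI "\<lambda>t. (v t)\<^sup>2" m lborel] assms
  by (simp add: refI_measurable measure_refI mult.commute) (simp add: refI_def)

text \<open>For exponent 1/2 the kernel is the inverse square of the distance, so a Lipschitz bound
  makes the quotient at most \<open>L\<close>, and 4 is the area of the square. On the diagonal the
  quotient is 0.\<close>

lemma norm_frac_sq_le:
  assumes "\<And>t. t \<in> refI \<Longrightarrow> (v t)\<^sup>2 \<le> m" "m \<ge> 0" "L \<ge> 0"
    "\<And>t t'. t \<in> refI \<Longrightarrow> t' \<in> refI \<Longrightarrow> (v t - v t')\<^sup>2 \<le> L * (t - t')\<^sup>2"
  shows "norm_frac_sq (1/2) v \<le> 2 * m + 4 * L"
proof -
  have "(LINT p:refS|lborel. (v (fst p) - v (snd p))\<^sup>2 / \<bar>fst p - snd p\<bar> powr (1 + 2 * (1/2))) \<le> L * measure lborel refS"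
  proof (rule set_integral_le_bound)
    fix p assume p: "p \<in> refS"
    show "(v (fst p) - v (snd p))\<^sup>2 / \<bar>fst p - snd p\<bar> powr (1 + 2 * (1/2)) \<le> L"
    proof (cases "fst p = snd p")
      case False
      then have "\<bar>fst p - snd p\<bar> powr (1 + 2 * (1/2)) = (fst p - snd p)\<^sup>2" by simp
      then show ?thesis using assms(4)[of "fst p" "snd p"] p False
        by (simp add: refS_eq_Times mem_Times_iff divide_le_eq)
    qed (use assms in simp)
  qed (use assms in \<open>auto simp: refS_measurable emeasure_refS\<close>)
  moreover have "norm0_sq v \<le> 2 * m" by (rule norm0_sq_le) (use assms in auto)
  ultimately show ?thesis
    unfolding norm_frac_sq_def measure_refS refS_eq_Times[symmetric] by linarith
qed

section \<open>Summation over edges and counting of sides\<close>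

definition opp :: "side \<Rightarrow> side" where
  "opp g = (case g of West \<Rightarrow> East | East \<Rightarrow> West | South \<Rightarrow> North | North \<Rightarrow> South)"

text \<open>The edge part of \<open>formV\<close> with the contributions left open, so that
  comparison edge by edge and the counting of sides are proved once for all integrands.\<close>

definition edge_sum :: "decomp \<Rightarrow> (nat \<times> nat \<Rightarrow> side \<Rightarrow> nat \<times> nat \<Rightarrow> real) \<Rightarrow> (nat \<times> nat \<Rightarrow> side \<Rightarrow> real) \<Rightarrow> real" where
  "edge_sum D P b =
     (\<Sum>i<nx D - 1. \<Sum>j<ny D. P (i, j) East (Suc i, j))
   + (\<Sum>i<nx D. \<Sum>j<ny D - 1. P (i, j) North (i, Suc j))
   + (\<Sum>j<ny D. b (0, j) West + b (nx D - 1, j) East)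
   + (\<Sum>i<nx D. b (i, 0) South + b (i, ny D - 1) North)"

text \<open>What the flux argument uses of a shared edge. \<open>g\<close> is East or North because
  each interior edge is visited once, from its western or southern element.\<close>

definition adjacent :: "decomp \<Rightarrow> nat \<times> nat \<Rightarrow> side \<Rightarrow> nat \<times> nat \<Rightarrow> bool" where
  "adjacent D l g l' \<longleftrightarrow> l \<in> elements D \<and> l' \<in> elements D \<and> g \<in> {East, North} \<and>
     (\<forall>t\<in>{-1..1}. edge_par D l g t = edge_par D l' (opp g) t)"

lemma edge_sum_mono:
  assumes "is_decomp N D"
    and "\<And>l g l'. adjacent D l g l' \<Longrightarrow> P l g l' \<le> P' l g l'"
    and "\<And>l g. l \<in> elements D \<Longrightarrow> b l g \<le> b' l g"
  shows "edge_sum D P b \<le> edge_sum D P' b'"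
proof -
  have n: "0 < nx D" "0 < ny D" using assms(1) by (auto simp: is_decomp_def)
  have E: "adjacent D (i, j) East (Suc i, j)" if "i < nx D - 1" "j < ny D" for i j
    using assms(1) that by (auto simp: adjacent_def is_decomp_def elements_def opp_def)
  have N: "adjacent D (i, j) North (i, Suc j)" if "i < nx D" "j < ny D - 1" for i j
    using assms(1) that by (auto simp: adjacent_def is_decomp_def elements_def opp_def)
  show ?thesis
    unfolding edge_sum_def
    by (intro add_mono sum_mono assms(2,3) E N) (use n in \<open>auto simp: elements_def\<close>)
qed

lemma edge_sum_linear:
  "edge_sum D (\<lambda>l g l'. c * P l g l' + c' * P' l g l') (\<lambda>l g. c * b l g + c' * b' l g)
    = c * edge_sum D P b + c' * edge_sum D P' b'"
  by (simp add: edge_sum_def sum.distrib sum_distrib_left distrib_left)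

text \<open>Interior edges in a row pair \<open>A i\<close> with \<open>B (Suc i)\<close>; the two
  boundary edges supply the unpaired \<open>B 0\<close> and \<open>A (n - 1)\<close>.\<close>

lemma sum_shift_pairs:
  fixes A B :: "nat \<Rightarrow> real"
  assumes "0 < n"
  shows "(\<Sum>i<n - 1. A i + B (Suc i)) + (B 0 + A (n - 1)) = (\<Sum>i<n. A i + B i)"
proof -
  obtain k where "n = Suc k" using assms by (cases n) auto
  moreover have "(\<Sum>i<Suc k. B i) = B 0 + (\<Sum>i<k. B (Suc i))" by (rule sum.lessThan_Suc_shift)
  ultimately show ?thesis by (simp add: sum.distrib)
qed

text \<open>Double counting: running through all edges meets each side of each element exactly once.
  This turns sums of outward fluxes over elements into sums over edges and also yields the factor 4
  in \<open>sum_Q_edges\<close>.\<close>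

lemma edge_sum_sides:
  assumes "is_decomp N D"
  shows "edge_sum D (\<lambda>l g l'. T l g + T l' (opp g)) T = (\<Sum>l\<in>elements D. \<Sum>g\<in>UNIV. T l g)"
proof -
  have n: "0 < nx D" "0 < ny D" using assms by (auto simp: is_decomp_def)
  have 1: "(\<Sum>i<nx D - 1. \<Sum>j<ny D. T (i, j) East + T (Suc i, j) West) + (\<Sum>j<ny D. T (0, j) West + T (nx D - 1, j) East)
    = (\<Sum>i<nx D. \<Sum>j<ny D. T (i, j) East + T (i, j) West)"
    using sum_shift_pairs[OF n(1), of "\<lambda>i. \<Sum>j<ny D. T (i, j) East" "\<lambda>i. \<Sum>j<ny D. T (i, j) West"]
    by (simp add: sum.distrib)
  have 2: "(\<Sum>i<nx D. \<Sum>j<ny D - 1. T (i, j) North + T (i, Suc j) South) + (\<Sum>i<nx D. T (i, 0) South + T (i, ny D - 1) North)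
    = (\<Sum>i<nx D. \<Sum>j<ny D. T (i, j) North + T (i, j) South)"
    using sum_shift_pairs[OF n(2), of "\<lambda>j. T (i, j) North" "\<lambda>j. T (i, j) South" for i]
    by (simp add: sum.distrib[symmetric])
  have "(\<Sum>l\<in>elements D. \<Sum>g\<in>UNIV. T l g) = (\<Sum>i<nx D. \<Sum>j<ny D. \<Sum>g\<in>UNIV. T (i, j) g)"
    using sum.cartesian_product[of "\<lambda>i j. \<Sum>g\<in>UNIV. T (i, j) g" "{..<ny D}" "{..<nx D}"]
    by (simp add: elements_def)
  also have "\<dots> = (\<Sum>i<nx D. \<Sum>j<ny D. T (i, j) East + T (i, j) West) + (\<Sum>i<nx D. \<Sum>j<ny D. T (i, j) North + T (i, j) South)"
    unfolding UNIV_side by (simp add: sum.distrib[symmetric] add_ac)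
  finally show ?thesis unfolding 1[symmetric] 2[symmetric] edge_sum_def by (simp add: opp_def)
qed

lemma formV_edge_sum:
  "formV eps a D F = (\<Sum>l\<in>elements D. LINT p:refS|lborel. (opL_ref eps a D F l p)\<^sup>2) + edge_sum D (jump_sq D F) (bdry_sq D F)"
  by (simp add: formV_def edge_sum_def)

section \<open>Energy balance of one element\<close>

text \<open>The midpoint of a side lies on no other side.\<close>

lemma ref_side_determined: "ref_side s ` {-1..1} = ref_side s' ` {-1..1} \<Longrightarrow> s = s'"
proof -
  assume "ref_side s ` {-1..1} = ref_side s' ` {-1..1}"
  then have "ref_side s 0 \<in> ref_side s' ` {-1..1}" by force
  then show "s = s'" by (cases s; cases s') auto
qed

text \<open>\<open>C\<close> and \<open>poly\<close> are carried as data: the degree influences the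
  estimates through \<open>C\<close> alone.\<close>

locale spectral =
  fixes N :: nat and D :: decomp and B :: real and W :: nat and F :: "nat \<times> nat \<Rightarrow> real \<times> real \<Rightarrow> real"
    and C a eps :: real
  assumes D: "is_decomp N D" and maps: "maps_bounded_by B D" and B_pos: "B > 0"
    and F: "F \<in> spectral_functions D W" and a_pos: "a > 0" and eps_pos: "eps > 0" and eps_le: "eps \<le> 1" and C_ge: "C \<ge> 1"
    and poly: "\<And>f p b b'. \<lbrakk>f \<in> poly_sep W; p \<in> refSc; b \<in> Basis; b' \<in> Basis\<rbrakk> \<Longrightarrow>
     (f p)\<^sup>2 \<le> C * (LINT p:refS|lborel. (f p)\<^sup>2) \<and>
     (pdiff refSc b f p)\<^sup>2 \<le> C * (LINT p:refS|lborel. (f p)\<^sup>2) \<and>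
     (pdiff refSc b (pdiff refSc b' f) p)\<^sup>2 \<le> C * (LINT p:refS|lborel. (f p)\<^sup>2)"
begin

definition "Q l = (LINT p:refS|lborel. (F l p)\<^sup>2)"
text \<open>A common pointwise bound for \<open>F l\<close> and its derivatives up to order two, see
  \<open>F_bounds\<close>.\<close>

definition "m l = sqrt (C * Q l)"
definition "side_of l g = (THE s. emap D l ` ref_side s ` {-1..1} = elem_side D l g)"
abbreviation "grad l b \<equiv> (if b = ex then element.G1 (emap D l) (F l) else element.G2 (emap D l) (F l))"
abbreviation "lap l p \<equiv> element.G1 (emap D l) (element.G1 (emap D l) (F l)) p + element.G2 (emap D l) (element.G2 (emap D l) (F l)) p"
definition "edge_speed l g = element.speed (emap D l) (side_of l g)"
definition "u l g t = F l (ref_side (side_of l g) t)"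
definition "w l g b t = grad l b (ref_side (side_of l g) t)"
text \<open>The flux of \<open>u\<close> times its physical gradient out of the element through the
  side \<open>g\<close>.\<close>

definition "T l g = (LINT t:refI|lborel. u l g t * (side_normal g * edge_speed l g t * w l g (normal_dir g) t))"

lemma Q_nonneg: "0 \<le> Q l"
  unfolding Q_def by (rule set_integral_nonneg') simp

lemma CQ_nonneg: "0 \<le> C * Q l"
  using Q_nonneg C_ge by simp

lemma m_nonneg: "0 \<le> m l" and m_sq: "(m l)\<^sup>2 = C * Q l"
  using CQ_nonneg by (simp_all add: m_def)

lemma C1_F: "l \<in> elements D \<Longrightarrow> C1 refSc (F l)" "l \<in> elements D \<Longrightarrow> b \<in> Basis \<Longrightarrow> C1 refSc (pdiff refSc b (F l))"
  using F poly_sep_C1[of "F l" W] unfolding spectral_functions_def by blast+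

lemma F_bounds:
  assumes "l \<in> elements D" "p \<in> refSc" "b \<in> Basis" "b' \<in> Basis"
  shows "\<bar>F l p\<bar> \<le> m l" "\<bar>pdiff refSc b (F l) p\<bar> \<le> m l" "\<bar>pdiff refSc b (pdiff refSc b' (F l)) p\<bar> \<le> m l"
proof -
  have "F l \<in> poly_sep W" using F assms(1) unfolding spectral_functions_def by blast
  note * = poly[OF this assms(2-4), folded Q_def]
  have abs_le: "\<bar>x\<bar> \<le> m l" if "x\<^sup>2 \<le> C * Q l" for x
    unfolding m_def using real_sqrt_le_mono[OF that] by simp
  show "\<bar>F l p\<bar> \<le> m l" "\<bar>pdiff refSc b (F l) p\<bar> \<le> m l" "\<bar>pdiff refSc b (pdiff refSc b' (F l)) p\<bar> \<le> m l"
    using * by (intro abs_le; blast)+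
qed

lemma element_elem:
  assumes "l \<in> elements D" shows "element (elem D l) (emap D l) B"
proof -
  obtain i j where l: "l = (i, j)" "i < nx D" "j < ny D" using assms by (auto simp: elements_def)
  have "xs D i < xs D (Suc i)" "ys D j < ys D (Suc j)" using D l by (auto simp: is_decomp_def)
  then have r: "rect (elem D l)" unfolding rect_def elem_def l by auto
  have e: "bij_betw (emap D l) refSc (elem D l)"
    "analytic2_on (fst \<circ> emap D l) refSc" "analytic2_on (snd \<circ> emap D l) refSc"
    "analytic2_on (fst \<circ> einv D l) (elem D l)" "analytic2_on (snd \<circ> einv D l) (elem D l)"
    using D assms unfolding is_decomp_def by blast+
  have m: "\<bar>pdiff refSc b f p\<bar> \<le> B" "b' \<in> Basis \<Longrightarrow> \<bar>pdiff refSc b (pdiff refSc b' f) p\<bar> \<le> B"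
    if "p \<in> refSc" "b \<in> Basis" "f \<in> {fst \<circ> emap D l, snd \<circ> emap D l}" for p b b' f
    using maps assms that unfolding maps_bounded_by_def by blast+
  have J: "jac D l p \<ge> 1 / B" if "p \<in> refSc" for p
    using maps assms that unfolding maps_bounded_by_def by blast
  show ?thesis
    by (rule element.intro) (use r e B_pos m J in \<open>simp_all add: einv_def jac_def\<close>)
qed

text \<open>Gives meaning to the description operator in \<open>edge_par\<close>. Distinct reference
  sides have distinct images by injectivity of the map, and an injection between the four sides is a
  bijection; \<open>side_of\<close> is its inverse.\<close>

lemma sides:
  assumes "l \<in> elements D"
  shows "emap D l ` ref_side (side_of l g) ` {-1..1} = elem_side D l g" and "bij (side_of l)"
proof -
  interpret element "elem D l" "emap D l" B by (rule element_elem[OF assms])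
  have "\<forall>s. \<exists>g. emap D l ` ref_side s ` {-1..1} = elem_side D l g" using D assms by (auto simp: is_decomp_def)
  then obtain h where h: "\<And>s. emap D l ` ref_side s ` {-1..1} = elem_side D l (h s)" by metis
  have eq: "s = s'" if "emap D l ` ref_side s ` {-1..1} = emap D l ` ref_side s' ` {-1..1}" for s s'
  proof (rule ref_side_determined)
    have sub: "ref_side s ` {-1..1} \<subseteq> refSc" for s using ref_side_in_refSc by blast
    show "ref_side s ` {-1..1} = ref_side s' ` {-1..1}"
      by (rule iffD1[OF inj_on_image_eq_iff[OF bij_betw_imp_inj_on[OF bij_M] sub sub] that])
  qed
  have "inj h" by (rule injI, rule eq) (simp only: h)
  moreover have "finite (UNIV :: side set)" unfolding UNIV_side by simp
  ultimately have "bij h" by (simp add: bij_def finite_UNIV_inj_surj)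
  have "side_of l (h s) = s" for s
    unfolding side_of_def
  proof (rule the_equality)
    show "s' = s" if "emap D l ` ref_side s' ` {-1..1} = elem_side D l (h s)" for s'
      by (rule eq) (use that h in simp)
  qed (rule h)
  then have "side_of l \<circ> h = id" by auto
  then have s: "side_of l = inv h"
    using \<open>bij h\<close> by (metis bij_is_surj comp_assoc comp_id id_comp surj_iff)
  show "bij (side_of l)" unfolding s using \<open>bij h\<close> bij_imp_bij_inv by blast
  show "emap D l ` ref_side (side_of l g) ` {-1..1} = elem_side D l g"
    unfolding h s using \<open>bij h\<close> by (simp add: bij_is_surj surj_f_inv_f)
qed

lemma edge_par_eq: "edge_par D l g t = emap D l (ref_side (side_of l g) t)"
  by (simp add: edge_par_def side_of_def)

lemma phys_emap: "l \<in> elements D \<Longrightarrow> p \<in> refSc \<Longrightarrow> phys D F l (emap D l p) = F l p"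
  using bij_betw_inv_into_left[OF element.bij_M[OF element_elem]] by (simp add: phys_def einv_def)

lemma phys_edge: "l \<in> elements D \<Longrightarrow> t \<in> {-1..1} \<Longrightarrow> phys D F l (edge_par D l g t) = u l g t"
  by (simp add: edge_par_eq phys_emap ref_side_in_refSc u_def)

lemma phys_diff_emap:
  assumes "l \<in> elements D" "p \<in> refSc" "b \<in> Basis"
  shows "phys_diff D F l b (emap D l p) = grad l b p"
proof -
  interpret element "elem D l" "emap D l" B by (rule element_elem[OF assms(1)])
  show ?thesis
    using pulled_gradient(2,3)[of "phys D F l" "F l", OF phys_emap[OF assms(1)] C1_F(1)[OF assms(1)] assms(2)] assms(3)
    by (auto simp: phys_diff_def Basis_prod_def)
qed

lemma phys_diff_edge:
  assumes "l \<in> elements D" "t \<in> {-1..1}" "b \<in> Basis"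
  shows "phys_diff D F l b (edge_par D l g t) = w l g b t"
  using phys_diff_emap[OF assms(1) ref_side_in_refSc[OF assms(2)] assms(3)] by (simp add: edge_par_eq w_def)

lemma grad_C1:
  assumes "l \<in> elements D" shows "C1 refSc (grad l b)"
proof -
  interpret element "elem D l" "emap D l" B by (rule element_elem[OF assms(1)])
  show ?thesis using C1_G[OF C1_F(2)[OF assms] C1_F(2)[OF assms]] by simp
qed

text \<open>The Laplacian consists of two terms, each bounded by \<open>G_bound\<close> applied to
  the derivative bound \<open>16 * B ^ 5 * m l\<close> of the gradient; hence 64 = 2 * 2 *
  16.\<close>

lemma grad_bounds:
  assumes "l \<in> elements D" "p \<in> refSc"
  shows "\<bar>grad l b p\<bar> \<le> 2 * B\<^sup>2 * m l" "c \<in> Basis \<Longrightarrow> \<bar>pdiff refSc c (grad l b) p\<bar> \<le> 16 * B ^ 5 * m l"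
    "\<bar>lap l p\<bar> \<le> 64 * B ^ 7 * m l"
proof -
  interpret element "elem D l" "emap D l" B by (rule element_elem[OF assms(1)])
  have b1: "c \<in> Basis \<Longrightarrow> \<bar>pd c (F l) p\<bar> \<le> m l" for c using F_bounds(2)[OF assms] by blast
  show "\<bar>grad l b p\<bar> \<le> 2 * B\<^sup>2 * m l" using G_bound[OF assms(2) b1] by auto
  have g: "\<bar>pd c (G1 (F l)) p\<bar> \<le> 16 * B ^ 5 * m l" "\<bar>pd c (G2 (F l)) p\<bar> \<le> 16 * B ^ 5 * m l" if "c \<in> Basis" for c
    using pd_G_bound[OF assms(2) C1_F(2)[OF assms(1)] C1_F(2)[OF assms(1)] that b1 F_bounds(3)[OF assms]] by auto
  then show "c \<in> Basis \<Longrightarrow> \<bar>pdiff refSc c (grad l b) p\<bar> \<le> 16 * B ^ 5 * m l" by auto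
  have "\<bar>G1 (G1 (F l)) p\<bar> \<le> 2 * B\<^sup>2 * (16 * B ^ 5 * m l)" by (rule G_bound(1)[OF assms(2) g(1)])
  moreover have "\<bar>G2 (G2 (F l)) p\<bar> \<le> 2 * B\<^sup>2 * (16 * B ^ 5 * m l)" by (rule G_bound(2)[OF assms(2) g(2)])
  ultimately show "\<bar>lap l p\<bar> \<le> 64 * B ^ 7 * m l"
    by (simp add: eval_nat_numeral mult_ac)
qed

lemma u_bounds:
  assumes "l \<in> elements D" "t \<in> {-1..1}"
  shows "(u l g t)\<^sup>2 \<le> C * Q l" "(w l g b t)\<^sup>2 \<le> 4 * B ^ 4 * (C * Q l)"
proof -
  note p = ref_side_in_refSc[OF assms(2)]
  show "(u l g t)\<^sup>2 \<le> C * Q l"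
    using F_bounds(1)[OF assms(1) p, of ex ex] m_nonneg[of l] unfolding m_sq[symmetric] u_def
    by (simp add: abs_le_square_iff[symmetric] Basis_prod_def)
  have "\<bar>w l g b t\<bar> \<le> 2 * B\<^sup>2 * m l" using grad_bounds(1)[OF assms(1) p] by (simp add: w_def)
  then have "(w l g b t)\<^sup>2 \<le> (2 * B\<^sup>2 * m l)\<^sup>2" by (metis abs_ge_zero power2_abs power_mono)
  also have "\<dots> = 4 * B ^ 4 * (C * Q l)" by (simp add: power_mult_distrib m_sq flip: power_mult)
  finally show "(w l g b t)\<^sup>2 \<le> 4 * B ^ 4 * (C * Q l)" .
qed

lemma w_lipschitz:
  assumes "l \<in> elements D" "t \<in> {-1..1}" "t' \<in> {-1..1}"
  shows "\<bar>w l g b t - w l g b t'\<bar> \<le> 16 * B ^ 5 * m l * \<bar>t - t'\<bar>"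
  unfolding w_def by (rule lipschitz_on_side[OF grad_C1[OF assms(1)] _ assms(2,3)]) (rule grad_bounds(2)[OF assms(1)])

lemma continuous_u: "l \<in> elements D \<Longrightarrow> continuous_on {-1..1} (u l g)"
  unfolding u_def[abs_def] by (intro continuous_on_compose_ref_side C1_continuous C1_F)

lemma continuous_w: "l \<in> elements D \<Longrightarrow> continuous_on {-1..1} (w l g b)"
  unfolding w_def[abs_def] by (intro continuous_on_compose_ref_side C1_continuous grad_C1)

lemma edge_speed_bound:
  assumes "l \<in> elements D" "t \<in> {-1..1}" shows "0 \<le> edge_speed l g t" "edge_speed l g t \<le> 2 * B"
  unfolding edge_speed_def using element.speed_bound[OF element_elem[OF assms(1)] assms(2)] by auto

lemma continuous_edge_speed:
  assumes "l \<in> elements D" shows "continuous_on {-1..1} (edge_speed l g)"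
proof -
  interpret element "elem D l" "emap D l" B by (rule element_elem[OF assms(1)])
  have "side_dir s \<in> Basis" for s by (cases s) auto
  then show ?thesis
    unfolding edge_speed_def speed_def[abs_def]
    by (intro continuous_intros continuous_on_compose_ref_side C1_continuous_pdiff C1_XY)
qed

text \<open>Equal parametrizations have equal tangents. Without a common speed the two fluxes
  through a shared edge could not be combined into jumps.\<close>

lemma edge_speed_adjacent:
  assumes "adjacent D l g l'" "t \<in> {-1..1}"
  shows "edge_speed l g t = edge_speed l' (opp g) t"
proof -
  have el: "l \<in> elements D" "l' \<in> elements D" and e: "\<And>t. t \<in> {-1..1} \<Longrightarrow> edge_par D l g t = edge_par D l' (opp g) t"
    using assms by (auto simp: adjacent_def)
  have d: "((\<lambda>t. f (edge_par D l g t)) has_vector_derivative pdiff refSc (side_dir (side_of l g)) (f \<circ> emap D l) (ref_side (side_of l g) t))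
     (at t within {-1..1})" if "l \<in> elements D" "f \<in> {fst, snd}" for l g f
  proof -
    interpret element "elem D l" "emap D l" B by (rule element_elem[OF that(1)])
    have "C1 refSc (f \<circ> emap D l)" using C1_XY(1,2) that(2) by (auto simp: X_def Y_def)
    from has_vector_derivative_ref_side[OF C1_differentiable[OF this ref_side_in_refSc[OF assms(2)]], of "side_of l g"]
    show ?thesis by (simp add: edge_par_eq)
  qed
  have "pdiff refSc (side_dir (side_of l g)) (f \<circ> emap D l) (ref_side (side_of l g) t)
    = pdiff refSc (side_dir (side_of l' (opp g))) (f \<circ> emap D l') (ref_side (side_of l' (opp g)) t)" if f: "f \<in> {fst, snd}" for f
  proof -
    have "((\<lambda>t. f (edge_par D l g t)) has_vector_derivative pdiff refSc (side_dir (side_of l' (opp g))) (f \<circ> emap D l') (ref_side (side_of l' (opp g)) t))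
     (at t within {-1..1})"
      by (rule has_vector_derivative_transform[OF assms(2) _ d[OF el(2) f]]) (use e in auto)
    then show ?thesis
      using vector_derivative_unique_within_closed_interval[of "-1" 1 t] d[OF el(1) f, of g] assms(2) by auto
  qed
  then show ?thesis
    unfolding edge_speed_def element.speed_def[OF element_elem[OF el(1)]] element.speed_def[OF element_elem[OF el(2)]]
      element.X_def[OF element_elem[OF el(1)]] element.X_def[OF element_elem[OF el(2)]]
      element.Y_def[OF element_elem[OF el(1)]] element.Y_def[OF element_elem[OF el(2)]]
    by simp
qed

text \<open>The operator is tested with \<open>F l\<close> under the weight \<open>J\<close>. Of the
  coefficient \<open>a / B\<close>, which stems from \<open>J \<ge> 1 / B\<close>, one half stays on
  the left and the other absorbs the product of \<open>F l\<close> with the operator.\<close>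

lemma element_energy:
  assumes l: "l \<in> elements D"
  shows "a / (2 * B) * Q l \<le> 2 * B ^ 3 / a * (LINT p:refS|lborel. (opL_ref eps a D F l p)\<^sup>2) + eps\<^sup>2 * (\<Sum>g\<in>UNIV. T l g)"
proof -
  interpret element "elem D l" "emap D l" B by (rule element_elem[OF l])
  obtain i j where ij: "l = (i, j)" by fastforce
  let ?w2 = "\<lambda>p. J p * ((G1 (F l) p)\<^sup>2 + (G2 (F l) p)\<^sup>2)"
  let ?L = "\<lambda>p. - eps\<^sup>2 * lap l p + a * F l p"
  have c: "continuous_on refSc (F l)" "continuous_on refSc J"
    "continuous_on refSc (G1 (F l))" "continuous_on refSc (G2 (F l))"
    using C1_continuous C1_F(1)[OF l] C1_J C1_G[OF C1_F(2)[OF l] C1_F(2)[OF l]] by auto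
  have cL: "continuous_on refSc (lap l)"
    unfolding G1_def[of "G1 (F l)"] G2_def[of "G2 (F l)"]
    by (intro continuous_intros C1_continuous_pdiff C1_continuous C1_XY basis C1_J C1_G C1_F(2)[OF l] J_nz ballI; assumption?)
  have L: "opL_ref eps a D F l p = sqrt (J p) * ?L p" if "p \<in> refSc" for p
  proof -
    have "jac D l p = J p" by (simp add: jac_def J_def X_def Y_def)
    then show ?thesis
      using pulled_laplacian[of "phys D F l" "F l", OF phys_emap[OF l] C1_F(1)[OF l] C1_F(2)[OF l] C1_F(2)[OF l] that] 
      by (simp add: opL_ref_def)
  qed
  have flux: "(LINT t:refI|lborel. F l (ref_side (side_of l g) t) * (side_sign (side_of l g) *
         (pd (side_dir (side_of l g)) Y (ref_side (side_of l g) t) * G1 (F l) (ref_side (side_of l g) t)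
          - pd (side_dir (side_of l g)) X (ref_side (side_of l g) t) * G2 (F l) (ref_side (side_of l g) t)))) = T l g" for g
    unfolding T_def
  proof (rule set_lebesgue_integral_cong, simp add: refI_measurable, intro allI impI)
    fix t assume "t \<in> refI"
    then have t: "t \<in> {-1..1}" using refI_subset by auto
    have R: "elem D l = {xs D i..xs D (Suc i)} \<times> {ys D j..ys D (Suc j)}" by (simp add: elem_def ij)
    have "elem_side D l g = rect_side (xs D i) (xs D (Suc i)) (ys D j) (ys D (Suc j)) g" by (cases g) (simp_all add: ij)
    then have g: "emap D l ` ref_side (side_of l g) ` {-1..1} = rect_side (xs D i) (xs D (Suc i)) (ys D j) (ys D (Suc j)) g"
      using sides(1)[OF l] by simp
    show "F l (ref_side (side_of l g) t) * (side_sign (side_of l g) *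
         (pd (side_dir (side_of l g)) Y (ref_side (side_of l g) t) * G1 (F l) (ref_side (side_of l g) t)
          - pd (side_dir (side_of l g)) X (ref_side (side_of l g) t) * G2 (F l) (ref_side (side_of l g) t)))
      = u l g t * (side_normal g * edge_speed l g t * w l g (normal_dir g) t)"
      unfolding physical_flux[OF R g t] by (simp add: u_def edge_speed_def w_def)
  qed
  \<comment> \<open>\<open>green\<close> sums over reference sides, \<open>T\<close> is indexed by
    physical sides; the bijection \<open>side_of l\<close> translates.\<close>
  have green': "(LINT p:refS|lborel. F l p * (J p * lap l p)) + (LINT p:refS|lborel. ?w2 p) = (\<Sum>g\<in>UNIV. T l g)"
    unfolding green[OF C1_F(1)[OF l] C1_F(2)[OF l basis(1)] C1_F(2)[OF l basis(2)]] flux[symmetric]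
    by (rule sum.reindex_bij_betw[OF sides(2)[OF l], of "\<lambda>s. LINT t:refI|lborel. F l (ref_side s t) * (side_sign s *
         (pd (side_dir s) Y (ref_side s t) * G1 (F l) (ref_side s t) - pd (side_dir s) X (ref_side s t) * G2 (F l) (ref_side s t)))", symmetric])
  have w2: "0 \<le> (LINT p:refS|lborel. ?w2 p)"
  proof (rule set_integral_nonneg')
    fix p assume "p \<in> refS"
    then have "J p > 0" using J_pos refS_subset by blast
    then show "0 \<le> ?w2 p" by simp
  qed
  have i1: "set_integrable lborel refS (\<lambda>p. F l p * (J p * lap l p))" by (intro set_integrable_refS continuous_intros c cL)
  have i2: "set_integrable lborel refS (\<lambda>p. J p * (F l p)\<^sup>2)" by (intro set_integrable_refS continuous_intros c)
  have i3: "set_integrable lborel refS (\<lambda>p. F l p * (J p * ?L p))" by (intro set_integrable_refS continuous_intros c cL)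
  have i4: "set_integrable lborel refS (\<lambda>p. (F l p)\<^sup>2)" by (intro set_integrable_refS continuous_intros c)
  have iL: "set_integrable lborel refS (\<lambda>p. J p * (?L p)\<^sup>2)" by (intro set_integrable_refS continuous_intros c cL)
  have eq: "(LINT p:refS|lborel. (opL_ref eps a D F l p)\<^sup>2) = (LINT p:refS|lborel. J p * (?L p)\<^sup>2)"
  proof (rule set_lebesgue_integral_cong, simp add: refS_measurable, intro allI impI)
    fix p assume "p \<in> refS"
    then have p: "p \<in> refSc" using refS_subset by auto
    show "(opL_ref eps a D F l p)\<^sup>2 = J p * (?L p)\<^sup>2"
      unfolding L[OF p] using J_pos[OF p] by (simp add: power_mult_distrib)
  qed
  have "(LINT p:refS|lborel. F l p * (J p * ?L p)) = (LINT p:refS|lborel. a * (J p * (F l p)\<^sup>2) - eps\<^sup>2 * (F l p * (J p * lap l p)))"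
    by (rule arg_cong[where f="set_lebesgue_integral lborel refS"]) (simp add: fun_eq_iff algebra_simps power2_eq_square)
  also have "\<dots> = a * (LINT p:refS|lborel. J p * (F l p)\<^sup>2) - eps\<^sup>2 * (LINT p:refS|lborel. F l p * (J p * lap l p))"
    using set_integral_diff(2)[of lborel refS "\<lambda>p. a * (J p * (F l p)\<^sup>2)" "\<lambda>p. eps\<^sup>2 * (F l p * (J p * lap l p))"] i1 i2
    by simp
  finally have id: "a * (LINT p:refS|lborel. J p * (F l p)\<^sup>2)
     = (LINT p:refS|lborel. F l p * (J p * ?L p)) + eps\<^sup>2 * (LINT p:refS|lborel. F l p * (J p * lap l p))" by simp
  have "eps\<^sup>2 * (LINT p:refS|lborel. F l p * (J p * lap l p)) \<le> eps\<^sup>2 * (\<Sum>g\<in>UNIV. T l g)"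
    using green' w2 by (intro mult_left_mono) auto
  moreover have "(1 / B) * Q l \<le> (LINT p:refS|lborel. J p * (F l p)\<^sup>2)"
    unfolding Q_def set_integral_mult_right[symmetric]
  proof (rule set_integral_mono)
    fix p assume "p \<in> refS"
    then have "1 / B \<le> J p" using J_bound refS_subset by blast
    then show "1 / B * (F l p)\<^sup>2 \<le> J p * (F l p)\<^sup>2" by (rule mult_right_mono) simp
  qed (use i2 i4 in auto)
  then have "a * ((1 / B) * Q l) \<le> a * (LINT p:refS|lborel. J p * (F l p)\<^sup>2)" using a_pos by (intro mult_left_mono) auto
  moreover have "(LINT p:refS|lborel. F l p * (J p * ?L p))
      \<le> (LINT p:refS|lborel. a / (2 * B) * (F l p)\<^sup>2 + 2 * B ^ 3 / a * (J p * (?L p)\<^sup>2))"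
  proof (rule set_integral_mono)
    fix p assume "p \<in> refS"
    then have p: "p \<in> refSc" using refS_subset by auto
    let ?x = "F l p" and ?y = "J p * ?L p"
    \<comment> \<open>Weights chosen so that the coefficient of \<open>?x\<^sup>2\<close> is exactly
      half of \<open>a / B\<close>.\<close>
    have "0 \<le> (a / B * ?x - ?y)\<^sup>2 * (B / (2 * a))" using a_pos B_pos by simp
    also have "\<dots> = a / (2 * B) * ?x\<^sup>2 - ?x * ?y + B / (2 * a) * ?y\<^sup>2"
      using a_pos B_pos by (simp add: field_simps power2_eq_square)
    finally have 1: "?x * ?y \<le> a / (2 * B) * ?x\<^sup>2 + B / (2 * a) * ?y\<^sup>2" by simp
    \<comment> \<open>\<open>opL_ref\<close> carries one factor \<open>J\<close> in its square but
      \<open>?y\<^sup>2\<close> has two; the surplus factor is bounded by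
      \<open>2 * B\<^sup>2\<close>.\<close>
    have "?y\<^sup>2 = J p * (J p * (?L p)\<^sup>2)" by (simp add: power2_eq_square)
    also have "\<dots> \<le> 2 * B\<^sup>2 * (J p * (?L p)\<^sup>2)" using J_le[OF p] J_pos[OF p] by (intro mult_right_mono) auto
    finally have "B / (2 * a) * ?y\<^sup>2 \<le> B / (2 * a) * (2 * B\<^sup>2 * (J p * (?L p)\<^sup>2))"
      using a_pos B_pos by (intro mult_left_mono) auto
    also have "\<dots> = B ^ 3 / a * (J p * (?L p)\<^sup>2)" by (simp add: eval_nat_numeral)
    also have "\<dots> \<le> 2 * B ^ 3 / a * (J p * (?L p)\<^sup>2)"
      using a_pos B_pos J_pos[OF p] by (intro mult_right_mono divide_right_mono) auto
    finally show "?x * ?y \<le> a / (2 * B) * ?x\<^sup>2 + 2 * B ^ 3 / a * (J p * (?L p)\<^sup>2)" using 1 by linarith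
  qed (use i3 i4 iL in auto)
  moreover have "(LINT p:refS|lborel. a / (2 * B) * (F l p)\<^sup>2 + 2 * B ^ 3 / a * (J p * (?L p)\<^sup>2))
    = a / (2 * B) * Q l + 2 * B ^ 3 / a * (LINT p:refS|lborel. (opL_ref eps a D F l p)\<^sup>2)"
    unfolding eq Q_def
    using set_integral_add(2)[of lborel refS "\<lambda>p. a / (2 * B) * (F l p)\<^sup>2" "\<lambda>p. 2 * B ^ 3 / a * (J p * (?L p)\<^sup>2)"] i4 iL
    by simp
  moreover have "a * ((1 / B) * Q l) = a / (2 * B) * Q l + a / (2 * B) * Q l" by (simp add: field_simps)
  ultimately show ?thesis using id by linarith
qed

end

section \<open>Bounding the traces by the quadratic form\<close>

context spectral
begin

text \<open>The weight \<open>d\<close> sits on \<open>y\<close>, the trace to be absorbed by L2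
  norms; \<open>x\<close> is a jump or a boundary value and is charged to the form.\<close>

lemma young_mult:
  fixes x y s d :: real
  assumes "0 \<le> s" "s \<le> 2 * B" "d > 0"
  shows "\<bar>s * (x * y)\<bar> \<le> d * y\<^sup>2 + B\<^sup>2 / d * x\<^sup>2"
proof -
  have "0 \<le> (d * \<bar>y\<bar> - B * \<bar>x\<bar>)\<^sup>2 / d" using assms by simp
  also have "\<dots> = d * y\<^sup>2 + B\<^sup>2 / d * x\<^sup>2 - 2 * B * (\<bar>x\<bar> * \<bar>y\<bar>)"
    using assms(3) by (simp add: power2_diff power_mult_distrib field_simps power2_eq_square)
  finally have "2 * B * (\<bar>x\<bar> * \<bar>y\<bar>) \<le> d * y\<^sup>2 + B\<^sup>2 / d * x\<^sup>2" by simp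
  moreover have "\<bar>s * (x * y)\<bar> \<le> 2 * B * (\<bar>x\<bar> * \<bar>y\<bar>)"
    using assms by (auto simp: abs_mult intro!: mult_right_mono)
  ultimately show ?thesis by linarith
qed

definition "trace_const = (1 + 4 * B ^ 4) * C"

lemma trace_const_pos: "trace_const > 0"
  unfolding trace_const_def using C_ge B_pos by (intro mult_pos_pos) (auto intro: add_pos_nonneg)

lemma u_sq_le: assumes "l \<in> elements D" "t \<in> {-1..1}" shows "(u l g t)\<^sup>2 \<le> trace_const * Q l" "(w l g b t)\<^sup>2 \<le> trace_const * Q l"
proof -
  have "1 * (C * Q l) \<le> (1 + 4 * B ^ 4) * (C * Q l)" "4 * B ^ 4 * (C * Q l) \<le> (1 + 4 * B ^ 4) * (C * Q l)"
    using CQ_nonneg B_pos by (intro mult_right_mono; simp)+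
  then show "(u l g t)\<^sup>2 \<le> trace_const * Q l" "(w l g b t)\<^sup>2 \<le> trace_const * Q l"
    using u_bounds(1)[OF assms, of g] u_bounds(2)[OF assms, of g b] unfolding trace_const_def mult.assoc by simp_all
qed

lemma set_integral_refI_le:
  fixes f h :: "real \<Rightarrow> real"
  assumes "continuous_on {-1..1} f" "continuous_on {-1..1} h" "\<And>t. t \<in> refI \<Longrightarrow> f t \<le> k + c * h t"
  shows "(LINT t:refI|lborel. f t) \<le> 2 * k + c * (LINT t:refI|lborel. h t)"
proof -
  have i: "set_integrable lborel refI (\<lambda>_. k)" "set_integrable lborel refI h" "set_integrable lborel refI f"
    using set_integrable_refI[OF assms(1)] set_integrable_refI[OF assms(2)] set_integrable_refI[OF continuous_on_const] by auto
  have "(LINT t:refI|lborel. f t) \<le> (LINT t:refI|lborel. k + c * h t)"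
    by (rule set_integral_mono) (use i assms(3) in auto)
  also have "\<dots> = (LINT t:refI|lborel. k) + c * (LINT t:refI|lborel. h t)"
    using set_integral_add(2)[OF i(1), of "\<lambda>t. c * h t"] i by simp
  also have "(LINT t:refI|lborel. k) = 2 * k"
    by (simp add: set_lebesgue_integral_def measure_refI[unfolded refI_def] refI_def)
  finally show ?thesis .
qed

lemma normal_dir_Basis: "normal_dir g \<in> Basis" "normal_dir (opp g) = normal_dir g" "side_normal (opp g) = - side_normal g"
  "\<bar>side_normal g\<bar> = 1"
  by (cases g; simp add: opp_def Basis_prod_def)+

text \<open>Only the L2 part of the boundary norm is used: it pays for \<open>u\<close>, while the
  normal derivative is bounded by the element's L2 norm with the small weight
  \<open>d\<close>.\<close>

lemma boundary_flux:
  assumes "l \<in> elements D" "d > 0"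
  shows "T l g \<le> 2 * (d * trace_const) * Q l + B\<^sup>2 / d * bdry_sq D F l g"
proof -
  have "T l g \<le> 2 * (d * (trace_const * Q l)) + B\<^sup>2 / d * (LINT t:refI|lborel. (u l g t)\<^sup>2)"
    unfolding T_def
  proof (rule set_integral_refI_le)
    fix t assume "t \<in> refI"
    then have t: "t \<in> {-1..1}" using refI_subset by auto
    let ?w = "w l g (normal_dir g) t"
    have "u l g t * (side_normal g * edge_speed l g t * ?w) \<le> \<bar>edge_speed l g t * (u l g t * ?w)\<bar>"
      by (rule order_trans[OF abs_ge_self]) (simp add: abs_mult normal_dir_Basis)
    also have "\<dots> \<le> d * ?w\<^sup>2 + B\<^sup>2 / d * (u l g t)\<^sup>2" by (rule young_mult[OF edge_speed_bound[OF assms(1) t] assms(2)])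
    also have "d * ?w\<^sup>2 \<le> d * (trace_const * Q l)" using u_sq_le(2)[OF assms(1) t] assms(2) by (intro mult_left_mono) auto
    finally show "u l g t * (side_normal g * edge_speed l g t * ?w) \<le> d * (trace_const * Q l) + B\<^sup>2 / d * (u l g t)\<^sup>2" by simp
  qed (intro continuous_intros continuous_u continuous_w continuous_edge_speed assms)+
  also have "(LINT t:refI|lborel. (u l g t)\<^sup>2) = norm0_sq (\<lambda>t. phys D F l (edge_par D l g t))"
    unfolding norm0_sq_def
    by (rule set_lebesgue_integral_cong) (use phys_edge[OF assms(1)] refI_subset in \<open>auto simp: refI_measurable subset_iff\<close>)
  also have "B\<^sup>2 / d * \<dots> \<le> B\<^sup>2 / d * bdry_sq D F l g"
    unfolding bdry_sq_def using assms(2) norm0_sq_le_norm_1frac_sq by (intro mult_left_mono) auto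
  finally show ?thesis by (simp add: mult.assoc)
qed

lemma adjacent_edge:
  assumes "adjacent D l g l'" "t \<in> {-1..1}"
  shows "phys D F l (edge_par D l g t) - phys D F l' (edge_par D l g t) = u l g t - u l' (opp g) t"
    "b \<in> Basis \<Longrightarrow> phys_diff D F l b (edge_par D l g t) - phys_diff D F l' b (edge_par D l g t) = w l g b t - w l' (opp g) b t"
proof -
  have el: "l \<in> elements D" "l' \<in> elements D" and e: "edge_par D l g t = edge_par D l' (opp g) t"
    using assms by (auto simp: adjacent_def)
  show "phys D F l (edge_par D l g t) - phys D F l' (edge_par D l g t) = u l g t - u l' (opp g) t"
    using phys_edge[OF el(1) assms(2), of g] phys_edge[OF el(2) assms(2), of "opp g"] e by simp
  show "phys_diff D F l b (edge_par D l g t) - phys_diff D F l' b (edge_par D l g t) = w l g b t - w l' (opp g) b t" if "b \<in> Basis"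
    using phys_diff_edge[OF el(1) assms(2) that, of g] phys_diff_edge[OF el(2) assms(2) that, of "opp g"] e by simp
qed

lemma jump_sq_eq:
  assumes "adjacent D l g l'"
  shows "jump_sq D F l g l' = norm0_sq (\<lambda>t. u l g t - u l' (opp g) t)
    + (\<Sum>b\<in>Basis. norm_frac_sq (1/2) (\<lambda>t. w l g b t - w l' (opp g) b t))"
proof -
  have t: "t \<in> {-1..1}" if "t \<in> refI" for t using that refI_subset by auto
  show ?thesis
    unfolding jump_sq_def
    by (intro arg_cong2[of _ _ _ _ "(+)"] norm0_sq_cong sum.cong refl norm_frac_sq_cong)
      (use adjacent_edge[OF assms t] in blast)+
qed

text \<open>The flux estimate needs L2 jumps only, and of the derivatives just the one in the normal
  direction, which \<open>b\<close> will be.\<close>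

lemma jump_sq_ge:
  assumes "adjacent D l g l'" "b \<in> Basis"
  shows "(LINT t:refI|lborel. (u l g t - u l' (opp g) t)\<^sup>2) + (LINT t:refI|lborel. (w l g b t - w l' (opp g) b t)\<^sup>2) \<le> jump_sq D F l g l'"
proof -
  have "norm0_sq (\<lambda>t. w l g b t - w l' (opp g) b t) \<le> norm_frac_sq (1/2) (\<lambda>t. w l g b t - w l' (opp g) b t)"
    by (rule norm0_sq_le_norm_frac_sq)
  also have "\<dots> \<le> (\<Sum>b\<in>Basis. norm_frac_sq (1/2) (\<lambda>t. w l g b t - w l' (opp g) b t))"
    using assms(2) by (intro member_le_sum norm_frac_sq_nonneg) auto
  finally show ?thesis unfolding jump_sq_eq[OF assms(1)] by (simp add: norm0_sq_def)
qed

lemma interior_flux: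
  assumes adj: "adjacent D l g l'" and d: "d > 0"
  shows "T l g + T l' (opp g) \<le> 2 * (d * trace_const) * (Q l + Q l') + B\<^sup>2 / d * jump_sq D F l g l'"
proof -
  have el: "l \<in> elements D" "l' \<in> elements D" using adj by (auto simp: adjacent_def)
  define b where "b = normal_dir g"
  have b: "b \<in> Basis" "normal_dir g = b" "normal_dir (opp g) = b" by (auto simp: b_def normal_dir_Basis)
  let ?u = "u l g" and ?u' = "u l' (opp g)" and ?w = "w l g b" and ?w' = "w l' (opp g) b"
  have c: "continuous_on {-1..1} (\<lambda>t. ?u t * (side_normal g * edge_speed l g t * ?w t))"
    "continuous_on {-1..1} (\<lambda>t. ?u' t * (side_normal (opp g) * edge_speed l' (opp g) t * ?w' t))"
    by (intro continuous_intros continuous_u continuous_w continuous_edge_speed el)+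
  have cu: "continuous_on {-1..1} (\<lambda>t. (?u t - ?u' t)\<^sup>2)" and cw: "continuous_on {-1..1} (\<lambda>t. (?w t - ?w' t)\<^sup>2)"
    by (intro continuous_intros continuous_u continuous_w el)+
  have "T l g + T l' (opp g) = (LINT t:refI|lborel. ?u t * (side_normal g * edge_speed l g t * ?w t) + ?u' t * (side_normal (opp g) * edge_speed l' (opp g) t * ?w' t))"
    unfolding T_def b using set_integral_add(2)[OF c[THEN set_integrable_refI]] by simp
  also have "\<dots> \<le> 2 * (d * (trace_const * (Q l + Q l'))) + B\<^sup>2 / d * (LINT t:refI|lborel. (?u t - ?u' t)\<^sup>2 + (?w t - ?w' t)\<^sup>2)"
  proof (rule set_integral_refI_le)
    fix t assume "t \<in> refI"
    then have t: "t \<in> {-1..1}" using refI_subset by auto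
    note edge_speed = edge_speed_bound[OF el(1) t, of g]
    \<comment> \<open>The outward normals of the two elements are opposite and the speeds agree, so
      one common factor can be split off.\<close>
    have "?u t * (side_normal g * edge_speed l g t * ?w t) + ?u' t * (side_normal (opp g) * edge_speed l' (opp g) t * ?w' t)
      = side_normal g * (edge_speed l g t * ((?u t - ?u' t) * ?w t)) + side_normal g * (edge_speed l g t * ((?w t - ?w' t) * ?u' t))"
      unfolding normal_dir_Basis(3) edge_speed_adjacent[OF adj t, symmetric] by (simp add: algebra_simps)
    also have "\<dots> \<le> \<bar>edge_speed l g t * ((?u t - ?u' t) * ?w t)\<bar> + \<bar>edge_speed l g t * ((?w t - ?w' t) * ?u' t)\<bar>"
      by (rule add_mono; rule order_trans[OF abs_ge_self]) (simp_all add: abs_mult normal_dir_Basis)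
    also have "\<dots> \<le> (d * (?w t)\<^sup>2 + B\<^sup>2 / d * (?u t - ?u' t)\<^sup>2) + (d * (?u' t)\<^sup>2 + B\<^sup>2 / d * (?w t - ?w' t)\<^sup>2)"
      by (intro add_mono young_mult edge_speed d)
    also have "\<dots> \<le> (d * (trace_const * Q l) + B\<^sup>2 / d * (?u t - ?u' t)\<^sup>2) + (d * (trace_const * Q l') + B\<^sup>2 / d * (?w t - ?w' t)\<^sup>2)"
      using u_sq_le(2)[OF el(1) t, of g b] u_sq_le(1)[OF el(2) t, of "opp g"] d by (intro add_mono mult_left_mono) auto
    finally show "?u t * (side_normal g * edge_speed l g t * ?w t) + ?u' t * (side_normal (opp g) * edge_speed l' (opp g) t * ?w' t)
      \<le> d * (trace_const * (Q l + Q l')) + B\<^sup>2 / d * ((?u t - ?u' t)\<^sup>2 + (?w t - ?w' t)\<^sup>2)"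
      by (simp add: algebra_simps)
  qed (intro continuous_on_add c cu cw)+
  also have "(LINT t:refI|lborel. (?u t - ?u' t)\<^sup>2 + (?w t - ?w' t)\<^sup>2) \<le> jump_sq D F l g l'"
    using set_integral_add(2)[OF cu[THEN set_integrable_refI] cw[THEN set_integrable_refI]] jump_sq_ge[OF adj b(1)] by simp
  finally show ?thesis using d by (simp add: mult.assoc divide_right_mono mult_left_mono)
qed

section \<open>Summation over the decomposition\<close>

definition "P = (\<Sum>l\<in>elements D. Q l)"

lemma P_nonneg: "0 \<le> P"
  unfolding P_def by (intro sum_nonneg Q_nonneg)

lemma sum_Q_edges: "edge_sum D (\<lambda>l g l'. Q l + Q l') (\<lambda>l g. Q l) = 4 * P"
  using edge_sum_sides[OF D, of "\<lambda>l g. Q l"] by (simp add: P_def UNIV_side sum_distrib_left)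

definition "interior_V = (\<Sum>l\<in>elements D. LINT p:refS|lborel. (opL_ref eps a D F l p)\<^sup>2)"
definition "edge_V = edge_sum D (jump_sq D F) (bdry_sq D F)"

lemma formV_split: "formV eps a D F = interior_V + edge_V"
  by (simp add: formV_edge_sum interior_V_def edge_V_def)

lemma interior_V_nonneg: "0 \<le> interior_V"
  unfolding interior_V_def by (intro sum_nonneg set_integral_nonneg') simp

lemma jump_bdry_nonneg: "0 \<le> jump_sq D F l g l'" "0 \<le> bdry_sq D F l g"
  unfolding jump_sq_def bdry_sq_def norm_1frac_sq_def
  by (intro add_nonneg_nonneg sum_nonneg norm0_sq_nonneg norm_frac_sq_nonneg)+

lemma edge_V_nonneg: "0 \<le> edge_V"
  unfolding edge_V_def edge_sum_def by (intro add_nonneg_nonneg sum_nonneg jump_bdry_nonneg)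

lemma total_flux:
  assumes "d > 0"
  shows "(\<Sum>l\<in>elements D. \<Sum>g\<in>UNIV. T l g) \<le> 8 * d * trace_const * P + B\<^sup>2 / d * edge_V"
proof -
  have "(\<Sum>l\<in>elements D. \<Sum>g\<in>UNIV. T l g) \<le>
    edge_sum D (\<lambda>l g l'. 2 * (d * trace_const) * (Q l + Q l') + B\<^sup>2 / d * jump_sq D F l g l') (\<lambda>l g. 2 * (d * trace_const) * Q l + B\<^sup>2 / d * bdry_sq D F l g)"
    unfolding edge_sum_sides[OF D, symmetric]
    by (rule edge_sum_mono[OF D]) (use interior_flux boundary_flux assms in auto)
  also have "\<dots> = 2 * (d * trace_const) * (4 * P) + B\<^sup>2 / d * edge_V"
    unfolding edge_sum_linear sum_Q_edges edge_V_def ..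
  finally show ?thesis by simp
qed

definition "energy_const = 2 * B ^ 3 / a + B\<^sup>2 * (32 * B * trace_const / a)"

lemma energy_bound: "P \<le> 4 * B / a * energy_const * formV eps a D F"
proof -
  \<comment> \<open>Chosen so that \<open>8 * d * trace_const\<close> equals
    \<open>a / (4 * B)\<close>, half the coefficient on the left. The price
    \<open>B\<^sup>2 / d\<close> is the second summand of \<open>energy_const\<close>.\<close>
  define d where "d = a / (32 * B * trace_const)"
  have d: "d > 0" unfolding d_def using a_pos B_pos trace_const_pos by simp
  have "a / (2 * B) * P \<le> (\<Sum>l\<in>elements D. 2 * B ^ 3 / a * (LINT p:refS|lborel. (opL_ref eps a D F l p)\<^sup>2) + eps\<^sup>2 * (\<Sum>g\<in>UNIV. T l g))"
    unfolding P_def by (subst sum_distrib_left, intro sum_mono element_energy)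
  also have "\<dots> = 2 * B ^ 3 / a * interior_V + eps\<^sup>2 * (\<Sum>l\<in>elements D. \<Sum>g\<in>UNIV. T l g)"
    by (simp add: sum.distrib interior_V_def sum_distrib_left)
  also have "eps\<^sup>2 * (\<Sum>l\<in>elements D. \<Sum>g\<in>UNIV. T l g) \<le> eps\<^sup>2 * (8 * d * trace_const * P + B\<^sup>2 / d * edge_V)"
    by (intro mult_left_mono total_flux d) simp
  also have "\<dots> \<le> 1 * (8 * d * trace_const * P + B\<^sup>2 / d * edge_V)"
    using d trace_const_pos P_nonneg edge_V_nonneg eps_pos eps_le by (intro mult_right_mono add_nonneg_nonneg) (auto simp: power_le_one)
  also have "\<dots> = a / (4 * B) * P + B\<^sup>2 * (32 * B * trace_const / a) * edge_V"
    using B_pos trace_const_pos a_pos by (simp add: d_def field_simps)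
  finally have "a / (4 * B) * P \<le> 2 * B ^ 3 / a * interior_V + B\<^sup>2 * (32 * B * trace_const / a) * edge_V" by (simp add: field_simps)
  also have "\<dots> \<le> energy_const * interior_V + energy_const * edge_V"
    unfolding energy_const_def using interior_V_nonneg edge_V_nonneg B_pos a_pos trace_const_pos by (intro add_mono mult_right_mono) auto
  finally have "a / (4 * B) * P \<le> energy_const * formV eps a D F" by (simp add: formV_split distrib_left)
  then have "4 * B / a * (a / (4 * B) * P) \<le> 4 * B / a * (energy_const * formV eps a D F)" using B_pos a_pos by (intro mult_left_mono) auto
  then show ?thesis using B_pos a_pos by simp
qed

end

section \<open>Equivalence of the quadratic forms\<close>

context spectral
begin

text \<open>The zeroth-order term alone gives the lower bound. Above, the integrand has seven
  squares counted with multiplicity, each at most \<open>C * Q l\<close>, on a square of area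
  4.\<close>

lemma formU_bounds: "P \<le> formU eps D F" "formU eps D F \<le> 28 * C * P"
proof -
  define h where "h = (\<lambda>l p. eps ^ 4 * ((pdiff refSc ex (pdiff refSc ex (F l)) p)\<^sup>2
                 + 2 * (pdiff refSc ex (pdiff refSc ey (F l)) p)\<^sup>2
                 + (pdiff refSc ey (pdiff refSc ey (F l)) p)\<^sup>2)
      + eps\<^sup>2 * ((pdiff refSc ex (F l) p)\<^sup>2 + (pdiff refSc ey (F l) p)\<^sup>2))"
  have U: "formU eps D F = (\<Sum>l\<in>elements D. LINT p:refS|lborel. h l p + (F l p)\<^sup>2)"
    by (simp add: formU_def h_def)
  have b: "ex \<in> Basis" "ey \<in> Basis" by (auto simp: Basis_prod_def)
  have Fl: "F l \<in> poly_sep W" if "l \<in> elements D" for l using F that unfolding spectral_functions_def by blast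
  have h0: "0 \<le> h l p" for l p by (simp add: h_def)
  have "Q l \<le> (LINT p:refS|lborel. h l p + (F l p)\<^sup>2)" if l: "l \<in> elements D" for l
    unfolding Q_def
  proof (rule set_integral_mono)
    have c: "continuous_on refSc (F l)" "continuous_on refSc (h l)"
      unfolding h_def by (intro continuous_intros C1_continuous C1_continuous_pdiff C1_F l b)+
    then show "set_integrable lborel refS (\<lambda>p. (F l p)\<^sup>2)" "set_integrable lborel refS (\<lambda>p. h l p + (F l p)\<^sup>2)"
      by (auto intro!: set_integrable_refS continuous_intros)
  qed (use h0 in simp)
  then show "P \<le> formU eps D F" unfolding P_def U by (rule sum_mono)
  have "(LINT p:refS|lborel. h l p + (F l p)\<^sup>2) \<le> 7 * (C * Q l) * measure lborel refS" if l: "l \<in> elements D" for l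
  proof (rule set_integral_le_bound)
    fix p assume "p \<in> refS"
    then have p: "p \<in> refSc" using refS_subset by blast
    note * = poly[OF Fl[OF l] p, folded Q_def]
    have e4: "eps ^ 4 \<le> 1" "eps\<^sup>2 \<le> 1" using eps_pos eps_le by (auto intro: power_le_one)
    have mono: "e * x \<le> x" if "e \<le> 1" "0 \<le> x" for e x :: real using mult_right_mono[OF that] by simp
    have "h l p \<le> ((pdiff refSc ex (pdiff refSc ex (F l)) p)\<^sup>2
                 + 2 * (pdiff refSc ex (pdiff refSc ey (F l)) p)\<^sup>2
                 + (pdiff refSc ey (pdiff refSc ey (F l)) p)\<^sup>2)
      + ((pdiff refSc ex (F l) p)\<^sup>2 + (pdiff refSc ey (F l) p)\<^sup>2)"
      unfolding h_def by (intro add_mono mono e4) auto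
    then show "h l p + (F l p)\<^sup>2 \<le> 7 * (C * Q l)"
      using *[OF b(1) b(1)] *[OF b(1) b(2)] *[OF b(2) b(2)] by linarith
  qed (use CQ_nonneg in \<open>auto simp: refS_measurable emeasure_refS\<close>)
  then have "formU eps D F \<le> (\<Sum>l\<in>elements D. 7 * (C * Q l) * measure lborel refS)"
    unfolding U by (rule sum_mono)
  also have "\<dots> = 28 * C * P" by (simp only: measure_refS P_def sum_distrib_left) (simp add: mult_ac)
  finally show "formU eps D F \<le> 28 * C * P" .
qed

text \<open>The factor \<open>2 * B\<^sup>2\<close> bounds \<open>J\<close>, the area contributes 4,
  and \<open>64 * B ^ 7\<close> is the bound for the Laplacian.\<close>

lemma opL_ref_bound:
  assumes l: "l \<in> elements D"
  shows "(LINT p:refS|lborel. (opL_ref eps a D F l p)\<^sup>2) \<le> 8 * B\<^sup>2 * (64 * B ^ 7 + a)\<^sup>2 * C * Q l"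
proof -
  interpret element "elem D l" "emap D l" B by (rule element_elem[OF l])
  have "(LINT p:refS|lborel. (opL_ref eps a D F l p)\<^sup>2) \<le> (2 * B\<^sup>2 * ((64 * B ^ 7 + a) * m l)\<^sup>2) * measure lborel refS"
  proof (rule set_integral_le_bound)
    fix p assume "p \<in> refS"
    then have p: "p \<in> refSc" using refS_subset by blast
    let ?L = "- eps\<^sup>2 * lap l p + a * F l p"
    have "jac D l p = J p" by (simp add: jac_def J_def X_def Y_def)
    then have "opL_ref eps a D F l p = sqrt (J p) * ?L"
      using pulled_laplacian[of "phys D F l" "F l", OF phys_emap[OF l] C1_F(1)[OF l] C1_F(2)[OF l] C1_F(2)[OF l] p]
      by (simp add: opL_ref_def)
    then have 1: "(opL_ref eps a D F l p)\<^sup>2 = J p * ?L\<^sup>2"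
      using J_pos[OF p] by (simp add: power_mult_distrib)
    have "\<bar>?L\<bar> \<le> eps\<^sup>2 * \<bar>lap l p\<bar> + a * \<bar>F l p\<bar>"
      by (rule order_trans[OF abs_triangle_ineq]) (use a_pos in \<open>simp add: abs_mult\<close>)
    also have "\<dots> \<le> 1 * (64 * B ^ 7 * m l) + a * m l"
      using grad_bounds(3)[OF l p] F_bounds(1)[OF l p basis(1) basis(1)] eps_pos eps_le a_pos
      by (intro add_mono mult_mono) (auto simp: power_le_one)
    finally have "\<bar>?L\<bar> \<le> (64 * B ^ 7 + a) * m l" by (simp add: algebra_simps)
    then have "?L\<^sup>2 \<le> ((64 * B ^ 7 + a) * m l)\<^sup>2" by (metis abs_ge_zero power2_abs power_mono)
    then show "(opL_ref eps a D F l p)\<^sup>2 \<le> 2 * B\<^sup>2 * ((64 * B ^ 7 + a) * m l)\<^sup>2"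
      unfolding 1 using J_le[OF p] J_pos[OF p] by (intro mult_mono) auto
  qed (auto simp: refS_measurable emeasure_refS)
  also have "\<dots> = 8 * B\<^sup>2 * (64 * B ^ 7 + a)\<^sup>2 * C * Q l"
    unfolding measure_refS power_mult_distrib m_sq by simp
  finally show ?thesis .
qed

lemma diff_square_le:
  fixes x y :: real
  assumes "x\<^sup>2 \<le> k" "y\<^sup>2 \<le> k'" shows "(x - y)\<^sup>2 \<le> 2 * (k + k')"
proof -
  have "0 \<le> (x + y)\<^sup>2" by simp
  then have "(x - y)\<^sup>2 \<le> 2 * x\<^sup>2 + 2 * y\<^sup>2" by (simp add: power2_sum power2_diff)
  also have "\<dots> \<le> 2 * k + 2 * k'" using assms by (intro add_mono) auto
  finally show ?thesis by (simp add: distrib_left)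
qed

text \<open>12 = 4 + 2 * 4 comes from the L2 jumps of the function and of two derivatives; 4096 = 2
  * 4 * 2 * 256 from the seminorms of two derivatives, with \<open>256 * B ^ 10\<close> the square
  of the Lipschitz factor \<open>16 * B ^ 5\<close>. A boundary edge costs
  \<open>8 * C\<close>.\<close>

definition "edge_const = 12 * trace_const + 4096 * B ^ 10 * C + 8 * C"

lemma jump_bound:
  assumes adj: "adjacent D l g l'"
  shows "jump_sq D F l g l' \<le> edge_const * (Q l + Q l')"
proof -
  have el: "l \<in> elements D" "l' \<in> elements D" using adj by (auto simp: adjacent_def)
  let ?q = "trace_const * Q l + trace_const * Q l'"
  let ?L = "2 * (256 * B ^ 10 * (C * Q l) + 256 * B ^ 10 * (C * Q l'))"
  have t: "t \<in> {-1..1}" if "t \<in> refI" for t using that refI_subset by auto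
  have q: "0 \<le> 2 * ?q" "0 \<le> ?L" using trace_const_pos Q_nonneg CQ_nonneg B_pos by auto
  have 1: "norm0_sq (\<lambda>t. u l g t - u l' (opp g) t) \<le> 2 * (2 * ?q)"
    by (rule norm0_sq_le[OF diff_square_le q(1)]) (intro u_sq_le(1) el t; assumption)+
  have lip: "(w l g b t - w l g b t')\<^sup>2 \<le> 256 * B ^ 10 * (C * Q l) * (t - t')\<^sup>2"
    if "l \<in> elements D" "t \<in> refI" "t' \<in> refI" for l g b t t'
  proof -
    have "(w l g b t - w l g b t')\<^sup>2 \<le> (16 * B ^ 5 * m l * \<bar>t - t'\<bar>)\<^sup>2"
      using w_lipschitz[OF that(1) t[OF that(2)] t[OF that(3)], of g b] by (metis abs_ge_zero power2_abs power_mono)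
    also have "\<dots> = 256 * B ^ 10 * (C * Q l) * (t - t')\<^sup>2"
      unfolding power_mult_distrib m_sq by (simp flip: power_mult)
    finally show ?thesis .
  qed
  have 2: "norm_frac_sq (1/2) (\<lambda>t. w l g b t - w l' (opp g) b t) \<le> 2 * (2 * ?q) + 4 * ?L" for b
  proof (rule norm_frac_sq_le[OF diff_square_le q])
    fix t t' assume tt: "t \<in> refI" "t' \<in> refI"
    \<comment> \<open>The increment of the jump is rewritten as the difference of the increments of
      the two traces, each of which is Lipschitz.\<close>
    have "((w l g b t - w l g b t') - (w l' (opp g) b t - w l' (opp g) b t'))\<^sup>2
      \<le> 2 * (256 * B ^ 10 * (C * Q l) * (t - t')\<^sup>2 + 256 * B ^ 10 * (C * Q l') * (t - t')\<^sup>2)"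
      by (rule diff_square_le[OF lip[OF el(1) tt] lip[OF el(2) tt]])
    then show "(w l g b t - w l' (opp g) b t - (w l g b t' - w l' (opp g) b t'))\<^sup>2 \<le> ?L * (t - t')\<^sup>2"
      by (simp add: algebra_simps)
  qed (intro u_sq_le(2) el t; assumption)+
  have "jump_sq D F l g l' \<le> 2 * (2 * ?q) + (\<Sum>b\<in>(Basis :: (real \<times> real) set). 2 * (2 * ?q) + 4 * ?L)"
    unfolding jump_sq_eq[OF adj] by (intro add_mono 1 sum_mono 2)
  also have "(\<Sum>b\<in>(Basis :: (real \<times> real) set). 2 * (2 * ?q) + 4 * ?L) = 2 * (2 * (2 * ?q) + 4 * ?L)"
    by simp
  also have "2 * (2 * ?q) + 2 * (2 * (2 * ?q) + 4 * ?L) = (12 * trace_const + 4096 * B ^ 10 * C) * (Q l + Q l')"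
    by (simp add: algebra_simps)
  also have "\<dots> \<le> edge_const * (Q l + Q l')"
    unfolding edge_const_def using C_ge Q_nonneg by (intro mult_right_mono add_nonneg_nonneg) auto
  finally show ?thesis .
qed

lemma bdry_bound:
  assumes l: "l \<in> elements D"
  shows "bdry_sq D F l g \<le> edge_const * Q l"
proof -
  let ?s = "side_of l g"
  define v where "v = (\<lambda>t. phys D F l (edge_par D l g t))"
  have t: "t \<in> {-1..1}" if "t \<in> refI" for t using that refI_subset by auto
  have s: "side_dir s \<in> Basis" for s by (cases s) (auto simp: Basis_prod_def)
  have v: "v t = u l g t" if "t \<in> {-1..1}" for t using phys_edge[OF l that] by (simp add: v_def)
  have d: "deriv v t = pdiff refSc (side_dir ?s) (F l) (ref_side ?s t)" if "t \<in> refI" for t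
  proof -
    have "(u l g has_vector_derivative pdiff refSc (side_dir ?s) (F l) (ref_side ?s t)) (at t within {-1..1})"
      unfolding u_def[abs_def]
      by (rule has_vector_derivative_ref_side[OF C1_differentiable[OF C1_F(1)[OF l] ref_side_in_refSc[OF t[OF that]]]])
    then have "(v has_vector_derivative pdiff refSc (side_dir ?s) (F l) (ref_side ?s t)) (at t within {-1..1})"
      by (rule has_vector_derivative_transform[rotated 2]) (use v t[OF that] in auto)
    \<comment> \<open>\<open>deriv\<close> is two-sided and \<open>v\<close> is arbitrary outside
      the closed interval, so the one-sided derivative is transferred at interior points; the norms
      see \<open>refI\<close> only.\<close>
    moreover have "at t within {-1..1} = at t"
      using that by (intro at_within_interior) (auto simp: refI_def)
    ultimately show ?thesis
      by (intro DERIV_imp_deriv) (simp add: has_real_derivative_iff_has_vector_derivative)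
  qed
  have sq: "x\<^sup>2 \<le> C * Q l" if "\<bar>x\<bar> \<le> m l" for x
    using power_mono[OF that, of 2] by (simp add: m_sq)
  have 1: "norm0_sq v \<le> 2 * (C * Q l)"
    by (rule norm0_sq_le[OF _ CQ_nonneg]) (use v t u_bounds(1)[OF l] in simp)
  have 2: "norm_frac_sq (1/2) (deriv v) \<le> 2 * (C * Q l) + 4 * (C * Q l)"
  proof (rule norm_frac_sq_le[OF _ CQ_nonneg CQ_nonneg])
    show "(deriv v t)\<^sup>2 \<le> C * Q l" if "t \<in> refI" for t
      unfolding d[OF that] by (intro sq F_bounds(2)[OF l _ s s] ref_side_in_refSc t that)
    fix t t' assume tt: "t \<in> refI" "t' \<in> refI"
    have "\<bar>deriv v t - deriv v t'\<bar> \<le> m l * \<bar>t - t'\<bar>"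
      unfolding d[OF tt(1)] d[OF tt(2)]
      by (rule lipschitz_on_side[OF C1_F(2)[OF l s] _ t[OF tt(1)] t[OF tt(2)]]) (rule F_bounds(3)[OF l _ _ s])
    then have "(deriv v t - deriv v t')\<^sup>2 \<le> (m l * \<bar>t - t'\<bar>)\<^sup>2" by (metis abs_ge_zero power2_abs power_mono)
    then show "(deriv v t - deriv v t')\<^sup>2 \<le> C * Q l * (t - t')\<^sup>2" by (simp add: power_mult_distrib m_sq)
  qed
  have "bdry_sq D F l g \<le> 8 * C * Q l"
    using 1 2 unfolding bdry_sq_def norm_1frac_sq_def v_def[symmetric] by simp
  also have "\<dots> \<le> edge_const * Q l"
    unfolding edge_const_def using trace_const_pos C_ge B_pos Q_nonneg by (intro mult_right_mono) auto
  finally show ?thesis .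
qed

definition "V_const = 8 * B\<^sup>2 * (64 * B ^ 7 + a)\<^sup>2 * C + 4 * edge_const"

lemma V_const_pos: "V_const > 0"
  unfolding V_const_def edge_const_def using trace_const_pos C_ge B_pos a_pos by (intro add_nonneg_pos) (auto intro!: add_pos_pos)

lemma formV_bound: "formV eps a D F \<le> V_const * P"
proof -
  have "interior_V \<le> (\<Sum>l\<in>elements D. 8 * B\<^sup>2 * (64 * B ^ 7 + a)\<^sup>2 * C * Q l)"
    unfolding interior_V_def by (intro sum_mono opL_ref_bound)
  also have "\<dots> = 8 * B\<^sup>2 * (64 * B ^ 7 + a)\<^sup>2 * C * P" by (simp add: P_def sum_distrib_left)
  finally have 1: "interior_V \<le> \<dots>" .
  \<comment> \<open>The summands \<open>0 * 0\<close> give the bound the shape of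
    \<open>edge_sum_linear\<close>.\<close>
  have "edge_V \<le> edge_sum D (\<lambda>l g l'. edge_const * (Q l + Q l') + 0 * 0) (\<lambda>l g. edge_const * Q l + 0 * 0)"
    unfolding edge_V_def by (rule edge_sum_mono[OF D]) (use jump_bound bdry_bound in auto)
  also have "\<dots> = 4 * edge_const * P" unfolding edge_sum_linear sum_Q_edges by simp
  finally show ?thesis using 1 by (simp add: formV_split V_const_def distrib_right)
qed

lemma equivalence:
  shows "1 / V_const * formV eps a D F \<le> formU eps D F"
    and "formU eps D F \<le> 28 * C * (4 * B / a * energy_const) * formV eps a D F"
proof -
  have "1 / V_const * formV eps a D F \<le> P" using formV_bound V_const_pos by (simp add: field_simps)
  then show "1 / V_const * formV eps a D F \<le> formU eps D F" using formU_bounds(1) by linarith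
  have "28 * C * P \<le> 28 * C * (4 * B / a * energy_const * formV eps a D F)"
    using energy_bound C_ge by (intro mult_left_mono) auto
  then show "formU eps D F \<le> 28 * C * (4 * B / a * energy_const) * formV eps a D F" using formU_bounds(2) by (simp add: mult.assoc)
qed

end

theorem theorem5p1:
  fixes a eps K B :: real
  assumes "a > 0" and "0 < eps" and "eps \<le> 1" and "K > 0" and "B > 0"
  shows "\<exists>c C :: real. c > 0 \<and> C > 0 \<and>
    (\<forall>(N :: nat) (D :: decomp) (W :: nat) F.
       is_decomp N D \<longrightarrow> maps_bounded_by B D \<longrightarrow>
       2 \<le> W \<longrightarrow> real W \<le> K / eps \<longrightarrow> F \<in> spectral_functions D W \<longrightarrow>
         c * formV eps a D F \<le> formU eps D F \<and>
         formU eps D F \<le> C * (ln (real W))\<^sup>2 * formV eps a D F)"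
proof -
  text \<open>As \<open>eps\<close> is fixed, only finitely many degrees \<open>W\<close> occur; all of them embed into degree \<open>W'\<close>.\<close>
  define W' where "W' = nat \<lfloor>K / eps\<rfloor>"
  obtain C where C: "C \<ge> 1" and poly: "\<And>f p b b'. \<lbrakk>f \<in> poly_sep W'; p \<in> refSc; b \<in> Basis; b' \<in> Basis\<rbrakk> \<Longrightarrow>
     (f p)\<^sup>2 \<le> C * (LINT p:refS|lborel. (f p)\<^sup>2) \<and>
     (pdiff refSc b f p)\<^sup>2 \<le> C * (LINT p:refS|lborel. (f p)\<^sup>2) \<and>
     (pdiff refSc b (pdiff refSc b' f) p)\<^sup>2 \<le> C * (LINT p:refS|lborel. (f p)\<^sup>2)"
    using poly_sep_bounds[of W'] by metis
  \<comment> \<open>\<open>k1\<close> and \<open>k3\<close> are \<open>energy_const\<close> and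
    \<open>V_const\<close> written out: they must be fixed before the decomposition and the family,
    hence outside the locale.\<close>
  define k1 where "k1 = 2 * B ^ 3 / a + B\<^sup>2 * (32 * B * ((1 + 4 * B ^ 4) * C) / a)"
  define k3 where "k3 = 8 * B\<^sup>2 * (64 * B ^ 7 + a)\<^sup>2 * C + 4 * (12 * ((1 + 4 * B ^ 4) * C) + 4096 * B ^ 10 * C + 8 * C)"
  define k where "k = 28 * C * (4 * B / a * k1)"
  have "0 < 1 + 4 * B ^ 4" using assms by (simp add: add_pos_nonneg)
  then have pos: "k1 > 0" "k3 > 0"
    unfolding k1_def k3_def using assms C by (auto intro!: add_pos_pos add_nonneg_pos)
  then have k: "k > 0" unfolding k_def using assms C by simp
  have ln2: "ln 2 > (0::real)" by simp
  have main: "1 / k3 * formV eps a D F \<le> formU eps D F \<and> formU eps D F \<le> k / (ln 2)\<^sup>2 * (ln (real W))\<^sup>2 * formV eps a D F"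
    if "is_decomp N D" "maps_bounded_by B D" "2 \<le> W" "real W \<le> K / eps" "F \<in> spectral_functions D W" for N D W F
  proof -
    have "W \<le> W'" unfolding W'_def using that(4) by (simp add: le_nat_floor)
    then have "F \<in> spectral_functions D W'" using that(5) poly_sep_mono unfolding spectral_functions_def by blast
    then interpret spectral N D B W' F C a eps
      using that(1,2) assms C poly by unfold_locales auto
    have e: "1 / k3 * formV eps a D F \<le> formU eps D F" "formU eps D F \<le> k * formV eps a D F"
      using equivalence unfolding V_const_def edge_const_def energy_const_def trace_const_def k_def k1_def k3_def by auto
    have V: "0 \<le> formV eps a D F" using interior_V_nonneg edge_V_nonneg by (simp add: formV_split)
    have "(ln 2)\<^sup>2 \<le> (ln (real W))\<^sup>2" using that(3) ln2 by (intro power_mono) auto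
    then have "1 \<le> (ln (real W))\<^sup>2 / (ln 2)\<^sup>2" using ln2 by simp
    then have "k * formV eps a D F * 1 \<le> k * formV eps a D F * ((ln (real W))\<^sup>2 / (ln 2)\<^sup>2)"
      using k V by (intro mult_left_mono) auto
    then have "k * formV eps a D F \<le> k / (ln 2)\<^sup>2 * (ln (real W))\<^sup>2 * formV eps a D F"
      by (simp add: mult_ac)
    with e show ?thesis by linarith
  qed
  have "1 / k3 > 0" "k / (ln 2)\<^sup>2 > 0" using pos k by auto
  then show ?thesis using main by blast
qed

end
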